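(* Suppose there is an algorithm which, given query access to $f:\{-1,1\}^n\to\{-1,1\}$ and parameters $s\in\mathbb{N}$ and $\varepsilon\in(0,1)$, makes $\mathrm{poly}(s,n,1/\varepsilon)$ queries to $f$, runs in $\mathrm{poly}(s,n,1/\varepsilon)$ time, accepts with high probability if $f$ is $\varepsilon$-close to a size-$s$ decision tree, and rejects with high probability if $f$ is $\Omega(\varepsilon)$-far from all size-$s$ decision trees. Then there is a $\mathrm{poly}(s,n,1/\varepsilon)$-time membership query algorithm for properly learning size-$s$ decision trees with respect to the uniform distribution; that is, an algorithm which, given query access to any $g:\{-1,1\}^n\to\{-1,1\}$ computed by a size-$s$ decision tree and $\varepsilon\in(0,1)$, outputs with high probability a size-$s$ decision tree $T$ with $\Pr_{\mathbf{x}}[T(\mathbf{x})\ne g(\mathbf{x})]\le\varepsilon$.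
   Context: Decision trees compute functions $\{-1,1\}^n\to\{-1,1\}$ by querying coordinates at internal nodes and outputting labels in $\{-1,1\}$ at leaves; the size of a decision tree is its number of leaves. Two functions are $\varepsilon$-close if they disagree on at most an $\varepsilon$ fraction of $\{-1,1\}^n$ (uniform $\mathbf{x}$), and $\varepsilon$-far otherwise. *)

theory Defs
  imports "HOL-Probability.Probability"
begin

definition cube :: "nat \<Rightarrow> int list set" where
  "cube n = {x. length x = n \<and> set x \<subseteq> {-1, 1}}"

definition bool_funs :: "nat \<Rightarrow> (int list \<Rightarrow> int) set" where
  "bool_funs n = cube n \<rightarrow> {-1, 1}"

definition disagreement :: "nat \<Rightarrow> (int list \<Rightarrow> int) \<Rightarrow> (int list \<Rightarrow> int) \<Rightarrow> real" where
  "disagreement n f g = measure_pmf.prob (pmf_of_set (cube n)) {x. f x \<noteq> g x}"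

definition close :: "nat \<Rightarrow> real \<Rightarrow> (int list \<Rightarrow> int) \<Rightarrow> (int list \<Rightarrow> int) \<Rightarrow> bool" where
  "close n e f g \<longleftrightarrow> disagreement n f g \<le> e"

definition far :: "nat \<Rightarrow> real \<Rightarrow> (int list \<Rightarrow> int) \<Rightarrow> (int list \<Rightarrow> int) \<Rightarrow> bool" where
  "far n e f g \<longleftrightarrow> \<not> close n e f g"

datatype dtree = Leaf int | Node nat dtree dtree

primrec dt_eval :: "dtree \<Rightarrow> int list \<Rightarrow> int" where
  "dt_eval (Leaf b) x = b"
| "dt_eval (Node i l r) x = (if x ! i = -1 then dt_eval l x else dt_eval r x)"

primrec leaves :: "dtree \<Rightarrow> nat" where
  "leaves (Leaf b) = 1"
| "leaves (Node i l r) = leaves l + leaves r"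

primrec dt_wf :: "nat \<Rightarrow> dtree \<Rightarrow> bool" where
  "dt_wf n (Leaf b) \<longleftrightarrow> b \<in> {-1, 1}"
| "dt_wf n (Node i l r) \<longleftrightarrow> i < n \<and> dt_wf n l \<and> dt_wf n r"

text \<open>As usual, a size-\<open>s\<close> tree is one with at most \<open>s\<close> leaves.\<close>

definition size_dtrees :: "nat \<Rightarrow> nat \<Rightarrow> dtree set" where
  "size_dtrees n s = {T. dt_wf n T \<and> leaves T \<le> s}"

text \<open>
  The machine model is Jones's WHILE language over binary trees (N. D. Jones, Computability and
  Complexity from a Programming Perspective, 1997), extended by coin tosses and oracle calls.
  With trees held as pointers into shared memory, each operation below takes constant time, and
  polynomially many steps here amount to polynomial time on
  probabilistic oracle Turing machines.

  Each primitive command and each test costs one step. The expressions in a program are fixed, so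
  this agrees with counting operators up to a constant factor that depends only on the program.
\<close>

datatype data = Empty | Pair data data

datatype expr = Var nat | EmptyE | PairE expr expr | Fst expr | Snd expr

datatype com =
    Skip
  | Assign nat expr
  | Coin nat
  | Query nat expr   \<comment> \<open>oracle access to the unknown function\<close>
  | Digit nat expr   \<comment> \<open>oracle access to the binary digits of the accuracy parameter\<close>
  | Seq com com
  | If expr com com
  | While expr com

type_synonym store = "nat \<Rightarrow> data"

fun fst_data :: "data \<Rightarrow> data" where
  "fst_data Empty = Empty"
| "fst_data (Pair a b) = a"

fun snd_data :: "data \<Rightarrow> data" where
  "snd_data Empty = Empty"
| "snd_data (Pair a b) = b"

primrec expr_val :: "expr \<Rightarrow> store \<Rightarrow> data" where
  "expr_val (Var v) \<sigma> = \<sigma> v"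
| "expr_val EmptyE \<sigma> = Empty"
| "expr_val (PairE a b) \<sigma> = Pair (expr_val a \<sigma>) (expr_val b \<sigma>)"
| "expr_val (Fst a) \<sigma> = fst_data (expr_val a \<sigma>)"
| "expr_val (Snd a) \<sigma> = snd_data (expr_val a \<sigma>)"

definition bool_data :: "bool \<Rightarrow> data" where
  "bool_data b = (if b then Pair Empty Empty else Empty)"

text \<open>
  A configuration consists of the commands still to be executed, the store, and the number of
  queries to the unknown function so far. The execution has halted when no command is left.
  The parameters \<open>Q\<close> and \<open>D\<close> answer the two kinds of oracle calls.
\<close>

type_synonym config = "com list \<times> store \<times> nat"

fun step :: "(data \<Rightarrow> bool) \<Rightarrow> (data \<Rightarrow> bool) \<Rightarrow> config \<Rightarrow> config pmf" where
  "step Q D ([], \<sigma>, q) = return_pmf ([], \<sigma>, q)"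
| "step Q D (Skip # cs, \<sigma>, q) = return_pmf (cs, \<sigma>, q)"
| "step Q D (Assign v e # cs, \<sigma>, q) = return_pmf (cs, \<sigma>(v := expr_val e \<sigma>), q)"
| "step Q D (Coin v # cs, \<sigma>, q) =
     map_pmf (\<lambda>b. (cs, \<sigma>(v := bool_data b), q)) (bernoulli_pmf (1/2))"
| "step Q D (Query v e # cs, \<sigma>, q) =
     return_pmf (cs, \<sigma>(v := bool_data (Q (expr_val e \<sigma>))), Suc q)"
| "step Q D (Digit v e # cs, \<sigma>, q) =
     return_pmf (cs, \<sigma>(v := bool_data (D (expr_val e \<sigma>))), q)"
| "step Q D (Seq c d # cs, \<sigma>, q) = return_pmf (c # d # cs, \<sigma>, q)"
| "step Q D (If e c d # cs, \<sigma>, q) =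
     return_pmf ((if expr_val e \<sigma> \<noteq> Empty then c else d) # cs, \<sigma>, q)"
| "step Q D (While e c # cs, \<sigma>, q) =
     return_pmf (if expr_val e \<sigma> \<noteq> Empty then c # While e c # cs else cs, \<sigma>, q)"

primrec steps :: "(data \<Rightarrow> bool) \<Rightarrow> (data \<Rightarrow> bool) \<Rightarrow> nat \<Rightarrow> config \<Rightarrow> config pmf" where
  "steps Q D 0 cfg = return_pmf cfg"
| "steps Q D (Suc t) cfg = bind_pmf (step Q D cfg) (steps Q D t)"

text \<open>
  Naturals are in unary, which is harmless as all time bounds are polynomial in their values.
  Decoding is total, so that every oracle call has an answer: signs are read off the root of a
  tree, numbers off the length of its right spine, and missing coordinates of a point are -1.
\<close>

primrec nat_data :: "nat \<Rightarrow> data" where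
  "nat_data 0 = Empty"
| "nat_data (Suc k) = Pair Empty (nat_data k)"

fun data_nat :: "data \<Rightarrow> nat" where
  "data_nat Empty = 0"
| "data_nat (Pair a b) = Suc (data_nat b)"

definition sign_data :: "int \<Rightarrow> data" where
  "sign_data b = bool_data (b = 1)"

definition data_sign :: "data \<Rightarrow> int" where
  "data_sign v = (if v = Empty then -1 else 1)"

primrec data_point :: "nat \<Rightarrow> data \<Rightarrow> int list" where
  "data_point 0 v = []"
| "data_point (Suc n) v = data_sign (fst_data v) # data_point n (snd_data v)"

primrec dtree_data :: "dtree \<Rightarrow> data" where
  "dtree_data (Leaf b) = Pair Empty (sign_data b)"
| "dtree_data (Node i l r) =
     Pair (Pair Empty Empty) (Pair (nat_data i) (Pair (dtree_data l) (dtree_data r)))"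

definition query_oracle :: "nat \<Rightarrow> (int list \<Rightarrow> int) \<Rightarrow> data \<Rightarrow> bool" where
  "query_oracle n f v \<longleftrightarrow> f (data_point n v) = 1"

text \<open>
  The accuracy parameter is an arbitrary real, so it cannot be passed as a finite input.
  The algorithm may ask for any digit of its binary expansion instead.
\<close>

definition digit_oracle :: "real \<Rightarrow> data \<Rightarrow> bool" where
  "digit_oracle \<epsilon> v \<longleftrightarrow> odd \<lfloor>\<epsilon> * 2 ^ data_nat v\<rfloor>"

definition init_store :: "nat \<Rightarrow> nat \<Rightarrow> store" where
  "init_store n s = (\<lambda>v. Empty)(0 := nat_data n, 1 := nat_data s)"

definition run :: "com \<Rightarrow> nat \<Rightarrow> nat \<Rightarrow> real \<Rightarrow> (int list \<Rightarrow> int) \<Rightarrow> nat \<Rightarrow> config pmf" where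
  "run P n s \<epsilon> f t = steps (query_oracle n f) (digit_oracle \<epsilon>) t ([P], init_store n s, 0)"

text \<open>
  Worst case over the coin tosses. Halted configurations do not change any more, so if this
  holds then \<open>run P n s \<epsilon> f t\<close> is the distribution of final configurations.
\<close>

definition halts_by :: "com \<Rightarrow> nat \<Rightarrow> nat \<Rightarrow> real \<Rightarrow> (int list \<Rightarrow> int) \<Rightarrow> nat \<Rightarrow> bool" where
  "halts_by P n s \<epsilon> f t \<longleftrightarrow> (\<forall>(cs, \<sigma>, q) \<in> set_pmf (run P n s \<epsilon> f t). cs = [])"

definition result :: "config \<Rightarrow> data" where
  "result cfg = (case cfg of (cs, \<sigma>, q) \<Rightarrow> \<sigma> 0)"

definition query_count :: "config \<Rightarrow> nat" where
  "query_count cfg = (case cfg of (cs, \<sigma>, q) \<Rightarrow> q)"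

text \<open>
  Since \<open>s + n + 1/\<epsilon> > 1\<close>, a quantity is bounded by a polynomial in \<open>s\<close>, \<open>n\<close>, \<open>1/\<epsilon>\<close>
  iff it is bounded by this for some \<open>K\<close> and \<open>d\<close>.
\<close>

definition poly_bound :: "real \<Rightarrow> nat \<Rightarrow> nat \<Rightarrow> nat \<Rightarrow> real \<Rightarrow> real" where
  "poly_bound K d s n \<epsilon> = K * (real s + real n + 1 / \<epsilon>) ^ d"

text \<open>
  The constant \<open>C\<close> is the one hidden in \<open>\<Omega>(\<epsilon>)\<close>; \<open>p\<close> is the constant meant by ``high probability''.
\<close>

definition dt_tester :: "real \<Rightarrow> com \<Rightarrow> bool" where
  "dt_tester p P \<longleftrightarrow>
     (\<exists>C K d. C > 0 \<and>
       (\<forall>n s \<epsilon> f. 0 < \<epsilon> \<and> \<epsilon> < 1 \<and> f \<in> bool_funs n \<longrightarrow>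
         (\<exists>t. real t \<le> poly_bound K d s n \<epsilon> \<and>
              halts_by P n s \<epsilon> f t \<and>
              (\<forall>cfg \<in> set_pmf (run P n s \<epsilon> f t). real (query_count cfg) \<le> poly_bound K d s n \<epsilon>) \<and>
              ((\<exists>T \<in> size_dtrees n s. close n \<epsilon> f (dt_eval T)) \<longrightarrow>
                 measure_pmf.prob (run P n s \<epsilon> f t) {cfg. result cfg \<noteq> Empty} \<ge> p) \<and>
              ((\<forall>T \<in> size_dtrees n s. far n (C * \<epsilon>) f (dt_eval T)) \<longrightarrow>
                 measure_pmf.prob (run P n s \<epsilon> f t) {cfg. result cfg = Empty} \<ge> p))))"

text \<open>
  The time bound holds for every oracle, the guarantee on the output for those computed by a
  size-\<open>s\<close> tree.
\<close>

definition dt_proper_learner :: "real \<Rightarrow> com \<Rightarrow> bool" where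
  "dt_proper_learner p L \<longleftrightarrow>
     (\<exists>K d. \<forall>n s \<epsilon> g. 0 < \<epsilon> \<and> \<epsilon> < 1 \<and> g \<in> bool_funs n \<longrightarrow>
         (\<exists>t. real t \<le> poly_bound K d s n \<epsilon> \<and>
              halts_by L n s \<epsilon> g t \<and>
              ((\<exists>T \<in> size_dtrees n s. \<forall>x \<in> cube n. dt_eval T x = g x) \<longrightarrow>
                 measure_pmf.prob (run L n s \<epsilon> g t)
                   {cfg. \<exists>T \<in> size_dtrees n s. result cfg = dtree_data T \<and>
                           disagreement n (dt_eval T) g \<le> \<epsilon>} \<ge> p)))"

end

theory Submission
  imports Defs
begin

text \<open>
  Restricting an approximating tree of size \<open>s\<close> by the variable \<open>i\<close> at its root yields two functions that
  are close to trees of sizes \<open>a\<close> and \<open>s - a\<close>, with the error at most doubled. The learner therefore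
  tries all \<open>i\<close> and \<open>a\<close> with the tester, fixes a pair for which both halves are accepted, and
  recurses. Every level loses a factor \<open>2 * C\<close> in accuracy, which stays polynomial because the
  recursion is cut off at depth \<open>O (log (s / \<epsilon>))\<close>: sizes add up to \<open>s\<close> on every level, so at most
  \<open>s\<close> nodes are cut off, each of weight \<open>2 ^ - depth\<close>. A node at which no pair is accepted is close to a
  constant, which a single random query reveals. The tester is run repeatedly with a majority vote,
  so that a union bound covers all calls.
\<close>

text \<open>The tester asks for the digits of its accuracy, and at a node this is not the given one.
  All accuracies are therefore powers of two, whose single nonzero digit is easy to simulate, and
  the loss per level is rounded up to \<open>2 ^ c \<ge> 2 * C\<close>. The 2 arises because the
  error of a tree is the average of its errors on the two halves, the \<open>C\<close> because an
  accepted half is certified only up to \<open>C\<close> times the tested accuracy. The time bound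
  must hold for all coin tosses, even when tests err. Hence every specification has two layers: what
  holds surely, and what may fail with small probability. The number of nodes belongs to the first:
  the search proposes only sizes \<open>a, b \<ge> 1\<close> with \<open>a + b = s\<close>, so at
  most \<open>2 * s - 1\<close> nodes arise whatever the tester says, and the union bound can be
  fixed in advance. Between its two accuracies the tester may answer anything, so the split found
  need not be that of the approximating tree; it suffices that both halves are again close to trees
  of their sizes.\<close>

section \<open>Weakest preexpectations\<close>

text \<open>
  The expectation of \<open>F\<close> on the final store, with value \<open>top\<close> as soon as some run has not halted
  after \<open>T\<close> steps: one inequality thus bounds both the time and a failure probability.
\<close>

fun wpn :: "(data \<Rightarrow> bool) \<Rightarrow> (data \<Rightarrow> bool) \<Rightarrow> nat \<Rightarrow> com list \<Rightarrow> (store \<Rightarrow> ennreal) \<Rightarrow> store \<Rightarrow> ennreal" where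
  "wpn Q D T [] F st = F st"
| "wpn Q D 0 (c # cs) F st = top"
| "wpn Q D (Suc T) (Skip # cs) F st = wpn Q D T cs F st"
| "wpn Q D (Suc T) (Assign v e # cs) F st = wpn Q D T cs F (st(v := expr_val e st))"
| "wpn Q D (Suc T) (Coin v # cs) F st =
     (wpn Q D T cs F (st(v := bool_data True)) + wpn Q D T cs F (st(v := bool_data False))) / 2"
| "wpn Q D (Suc T) (Query v e # cs) F st = wpn Q D T cs F (st(v := bool_data (Q (expr_val e st))))"
| "wpn Q D (Suc T) (Digit v e # cs) F st = wpn Q D T cs F (st(v := bool_data (D (expr_val e st))))"
| "wpn Q D (Suc T) (Seq c d # cs) F st = wpn Q D T (c # d # cs) F st"
| "wpn Q D (Suc T) (If e c d # cs) F st = wpn Q D T ((if expr_val e st \<noteq> Empty then c else d) # cs) F st"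
| "wpn Q D (Suc T) (While e c # cs) F st =
     wpn Q D T (if expr_val e st \<noteq> Empty then c # While e c # cs else cs) F st"

lemma ennreal_half_double: "(x + x) / 2 = (x :: ennreal)"
  by (simp add: mult_divide_eq_ennreal flip: mult_2_right)

lemma ennreal_half: "ennreal (1 / 2) = inverse 2"
  using inverse_ennreal[of 2] by simp

lemma steps_halted: "steps Q D T ([], st, q) = return_pmf ([], st, q)"
  by (induction T) (auto simp: bind_return_pmf)

text \<open>Ties the recursion to the semantics. The query counter \<open>q\<close> is arbitrary,
  because \<open>wpn\<close> does not record it.\<close>

lemma wpn_eq_nn_integral:
  "wpn Q D T cs F st =
     (\<integral>\<^sup>+ (cs', st', q'). (if cs' = [] then F st' else top) \<partial>measure_pmf (steps Q D T (cs, st, q)))"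
proof (induction Q D T cs F st arbitrary: q rule: wpn.induct)
  case (1 Q D T F st)
  show ?case by (simp add: steps_halted)
next
  case (5 Q D T v cs F st)
  show ?case
    using 5[of q] by (simp add: bind_map_pmf ennreal_half distrib_right divide_ennreal_def fun_upd_def)
qed (auto simp: bind_return_pmf)

lemma wpn_mono:
  assumes "\<And>st. F st \<le> G st"
  shows "wpn Q D T cs F st \<le> wpn Q D T cs G st"
  using assms
  by (induction Q D T cs F st rule: wpn.induct) (auto intro!: divide_right_mono_ennreal add_mono)

text \<open>Extra fuel can only replace \<open>top\<close> by something smaller; time bounds may
  thus be rounded up at will.\<close>

lemma wpn_antimono_Suc: "wpn Q D (Suc T) cs F st \<le> wpn Q D T cs F st"
proof (induction T arbitrary: cs st)
  case 0
  show ?case by (cases cs) auto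
next
  case (Suc T)
  show ?case
  proof (cases cs)
    case (Cons c cs')
    then show ?thesis using Suc
      by (cases c) (auto simp del: wpn.simps(2) intro!: divide_right_mono_ennreal add_mono)
  qed auto
qed

lemma wpn_antimono:
  assumes "T \<le> T'"
  shows "wpn Q D T' cs F st \<le> wpn Q D T cs F st"
  using lift_Suc_antimono_le[of "\<lambda>T. wpn Q D T cs F st", OF wpn_antimono_Suc assms] by simp

text \<open>Only an inequality: on the left, fuel not consumed by \<open>cs\<close> is still
  available to \<open>ds\<close>.\<close>

lemma wpn_append: "wpn Q D (T + T') (cs @ ds) F st \<le> wpn Q D T cs (wpn Q D T' ds F) st"
proof (induction T arbitrary: cs st)
  case 0
  show ?case by (cases cs) auto
next
  case (Suc T)
  show ?case
  proof (cases cs)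
    case Nil
    then show ?thesis using wpn_antimono[of T' "Suc T + T'"] by simp
  next
    case (Cons c cs')
    have *: "wpn Q D (T + T') (c # cs @ ds) F st \<le> wpn Q D T (c # cs) (wpn Q D T' ds F) st" for c cs st
      using Suc[of "c # cs"] by simp
    have **: "wpn Q D (T + T') (c # d # cs @ ds) F st \<le> wpn Q D T (c # d # cs) (wpn Q D T' ds F) st" for c d cs st
      using Suc[of "c # d # cs"] by simp
    show ?thesis using Suc Cons * **
      by (cases c) (auto intro!: divide_right_mono_ennreal add_mono)
  qed
qed

lemma wpn_Cons: "wpn Q D (T + T') (c # cs) F st \<le> wpn Q D T [c] (wpn Q D T' cs F) st"
  using wpn_append[of Q D T T' "[c]" cs] by simp

text \<open>Nonzero \<open>b\<close> matters when the fuel is exhausted, since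
  \<open>0 * top\<close> is 0 in \<open>ennreal\<close>. With \<open>b = 1\<close> this yields union
  bounds, with other factors the weights of the majority vote.\<close>

lemma wpn_affine:
  assumes "b \<noteq> 0"
  shows "wpn Q D T cs (\<lambda>st. a + b * F st) st \<le> a + b * wpn Q D T cs F st"
proof -
  have avg: "(x + y) / 2 \<le> a + b * ((u + v) / 2)"
    if "x \<le> a + b * u" "y \<le> a + b * v" for x y u v :: ennreal
  proof -
    have "(x + y) / 2 \<le> ((a + b * u) + (a + b * v)) / 2"
      using that by (intro divide_right_mono_ennreal add_mono)
    also have "\<dots> = ((a + a) + b * (u + v)) / 2"
      by (simp add: algebra_simps)
    also have "\<dots> = (a + a) / 2 + b * (u + v) / 2"
      by (simp add: add_divide_distrib_ennreal)
    also have "\<dots> = a + b * ((u + v) / 2)"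
      by (simp add: ennreal_half_double ennreal_times_divide)
    finally show ?thesis .
  qed
  show ?thesis
    using assms
    by (induction Q D T cs F st rule: wpn.induct) (auto intro!: avg simp: ennreal_mult_top)
qed


lemma halting_run_le:
  assumes "\<forall>(cs, st, q) \<in> set_pmf (steps Q D T (cs0, st0, q0)). cs = []"
    and "p \<le> measure_pmf.prob (steps Q D T (cs0, st0, q0)) {cfg. ok (result cfg)}" and "p \<le> 1"
  shows "wpn Q D T cs0 (\<lambda>st. if ok (st 0) then 0 else 1) st0 \<le> ennreal (1 - p)"
proof -
  let ?M = "steps Q D T (cs0, st0, q0)"
  let ?A = "{cfg. ok (result cfg)}"
  have "wpn Q D T cs0 (\<lambda>st. if ok (st 0) then 0 else 1) st0 =
    (\<integral>\<^sup>+ cfg. indicator (- ?A) cfg \<partial>measure_pmf ?M)"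
    unfolding wpn_eq_nn_integral[where q = q0]
    using assms(1) by (intro nn_integral_cong_AE) (auto simp: AE_measure_pmf_iff result_def)
  also have "\<dots> = ennreal (measure_pmf.prob ?M (- ?A))"
    by (simp add: measure_pmf.emeasure_eq_measure)
  also have "\<dots> \<le> ennreal (1 - p)"
    using assms(2) measure_pmf.prob_compl[of ?A ?M] by (intro ennreal_leI) (simp add: Compl_eq_Diff_UNIV)
  finally show ?thesis .
qed

lemma wpn_le_halting:
  assumes "wpn Q D T cs0 (\<lambda>st. if ok (st 0) then 0 else 1) st0 \<le> ennreal \<delta>"
  shows "\<forall>(cs, st, q) \<in> set_pmf (steps Q D T (cs0, st0, q0)). cs = []"
    and "0 \<le> \<delta> \<Longrightarrow> 1 - \<delta> \<le> measure_pmf.prob (steps Q D T (cs0, st0, q0)) {cfg. ok (result cfg)}"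
proof -
  let ?M = "steps Q D T (cs0, st0, q0)"
  let ?A = "{cfg. ok (result cfg)}"
  let ?F = "\<lambda>(cs', st', q'). (if cs' = [] then if ok (st' (0::nat)) then 0 else 1 else top) :: ennreal"
  have le: "(\<integral>\<^sup>+ cfg. ?F cfg \<partial>measure_pmf ?M) \<le> ennreal \<delta>"
    using assms unfolding wpn_eq_nn_integral[where q = q0] .
  have "(\<integral>\<^sup>+ cfg. ?F cfg \<partial>measure_pmf ?M) \<noteq> \<infinity>"
    using le by (auto simp: top_unique)
  \<comment> \<open>A single unhalted configuration has positive mass and would make the integral
    infinite.\<close>
  from nn_integral_PInf_AE[OF _ this] show "\<forall>(cs, st, q) \<in> set_pmf ?M. cs = []"
    by (auto simp: AE_measure_pmf_iff split: if_splits)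
  show "1 - \<delta> \<le> measure_pmf.prob ?M ?A" if "0 \<le> \<delta>"
  proof -
    have "ennreal (measure_pmf.prob ?M (- ?A)) = (\<integral>\<^sup>+ cfg. indicator (- ?A) cfg \<partial>measure_pmf ?M)"
      by (simp add: measure_pmf.emeasure_eq_measure)
    also have "\<dots> \<le> (\<integral>\<^sup>+ cfg. ?F cfg \<partial>measure_pmf ?M)"
      by (intro nn_integral_mono) (auto simp: result_def indicator_def)
    finally have "ennreal (measure_pmf.prob ?M (- ?A)) \<le> ennreal \<delta>"
      using le by order
    then show ?thesis
      using that measure_pmf.prob_compl[of ?A ?M] by (simp add: Compl_eq_Diff_UNIV)
  qed
qed

section \<open>Deterministic and probabilistic program specifications\<close>

notation Seq (infixr ";;" 60)

text \<open>Quantified over the continuation \<open>cs\<close>, the remaining fuel and the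
  postexpectation, so that sequencing is mere transitivity of the order.\<close>

definition runs :: "(data \<Rightarrow> bool) \<Rightarrow> (data \<Rightarrow> bool) \<Rightarrow> com \<Rightarrow> store \<Rightarrow> nat \<Rightarrow> store \<Rightarrow> bool" where
  "runs Q D c st t st' \<longleftrightarrow> (\<forall>F cs T. wpn Q D (t + T) (c # cs) F st \<le> wpn Q D T cs F st')"

lemma runsD: "runs Q D c st t st' \<Longrightarrow> wpn Q D (t + T) (c # cs) F st \<le> wpn Q D T cs F st'"
  by (simp add: runs_def)

lemma runs_weaken: "runs Q D c st t st' \<Longrightarrow> t \<le> t' \<Longrightarrow> runs Q D c st t' st'"
  unfolding runs_def by (meson add_le_mono1 order_trans wpn_antimono)

lemma runs_Skip: "runs Q D Skip st 1 st"
  and runs_Assign: "runs Q D (Assign v e) st 1 (st(v := expr_val e st))"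
  and runs_Query: "runs Q D (Query v e) st 1 (st(v := bool_data (Q (expr_val e st))))"
  and runs_Digit: "runs Q D (Digit v e) st 1 (st(v := bool_data (D (expr_val e st))))"
  by (simp_all add: runs_def)

lemma runs_Seq: "runs Q D c st t1 st1 \<Longrightarrow> runs Q D d st1 t2 st2 \<Longrightarrow> runs Q D (c ;; d) st (Suc (t1 + t2)) st2"
  unfolding runs_def by (simp add: add.assoc) (meson order_trans)

lemma runs_If:
  "runs Q D (if expr_val e st \<noteq> Empty then c else d) st t st' \<Longrightarrow> runs Q D (If e c d) st (Suc t) st'"
  unfolding runs_def by simp

lemma runs_While_Empty: "expr_val e st = Empty \<Longrightarrow> runs Q D (While e c) st 1 st"
  by (simp add: runs_def)

lemma runs_While_step:
  "expr_val e st \<noteq> Empty \<Longrightarrow> runs Q D c st t1 st1 \<Longrightarrow> runs Q D (While e c) st1 t2 st2 \<Longrightarrow>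
    runs Q D (While e c) st (Suc (t1 + t2)) st2"
  unfolding runs_def by (simp add: add.assoc) (meson order_trans)

section \<open>Symbolic execution of loop-free code\<close>

primrec straight :: "com \<Rightarrow> bool" where
  "straight Skip \<longleftrightarrow> True"
| "straight (Assign v e) \<longleftrightarrow> True"
| "straight (Coin v) \<longleftrightarrow> False"
| "straight (Query v e) \<longleftrightarrow> False"
| "straight (Digit v e) \<longleftrightarrow> False"
| "straight (Seq c d) \<longleftrightarrow> straight c \<and> straight d"
| "straight (If e c d) \<longleftrightarrow> straight c \<and> straight d"
| "straight (While e c) \<longleftrightarrow> False"

primrec straight_time :: "com \<Rightarrow> nat" where
  "straight_time Skip = 1"
| "straight_time (Assign v e) = 1"
| "straight_time (Coin v) = 0"
| "straight_time (Query v e) = 0"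
| "straight_time (Digit v e) = 0"
| "straight_time (Seq c d) = Suc (straight_time c + straight_time d)"
| "straight_time (If e c d) = Suc (max (straight_time c) (straight_time d))"
| "straight_time (While e c) = 0"

primrec straight_store :: "com \<Rightarrow> store \<Rightarrow> store" where
  "straight_store Skip st = st"
| "straight_store (Assign v e) st = st(v := expr_val e st)"
| "straight_store (Coin v) st = st"
| "straight_store (Query v e) st = st"
| "straight_store (Digit v e) st = st"
| "straight_store (Seq c d) st = straight_store d (straight_store c st)"
| "straight_store (If e c d) st =
     (if expr_val e st \<noteq> Empty then straight_store c st else straight_store d st)"
| "straight_store (While e c) st = st"

lemma runs_straight: "straight c \<Longrightarrow> runs Q D c st (straight_time c) (straight_store c st)"
proof (induction c arbitrary: st)
  case (If e c d)
  then show ?case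
    by (auto intro!: runs_If runs_weaken[OF If.IH(1)] runs_weaken[OF If.IH(2)])
qed (auto intro: runs_Seq runs_Skip runs_Assign simp flip: One_nat_def)

lemma runs_straightI:
  "straight c \<Longrightarrow> straight_time c \<le> t \<Longrightarrow> straight_store c st = st' \<Longrightarrow> runs Q D c st t st'"
  using runs_straight runs_weaken by blast

abbreviation outcome :: "(store \<Rightarrow> bool) \<Rightarrow> (store \<Rightarrow> bool) \<Rightarrow> store \<Rightarrow> ennreal" where
  "outcome S R \<equiv> \<lambda>st'. if S st' then if R st' then 0 else 1 else top"

text \<open>
  All runs end in \<open>S\<close> within \<open>t\<close> steps, and they violate \<open>R\<close> with probability at most \<open>\<delta>\<close>.
\<close>

definition triple :: "(data \<Rightarrow> bool) \<Rightarrow> (data \<Rightarrow> bool) \<Rightarrow> com \<Rightarrow> store \<Rightarrow> nat \<Rightarrow>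
    (store \<Rightarrow> bool) \<Rightarrow> ennreal \<Rightarrow> (store \<Rightarrow> bool) \<Rightarrow> bool" where
  "triple Q D c st t S \<delta> R \<longleftrightarrow>
     wpn Q D t [c] (outcome S R) st \<le> \<delta>"

lemma triple_weaken:
  assumes "triple Q D c st t S \<delta> R" "t \<le> t'" "\<delta> \<le> \<delta>'"
    and "\<And>st'. S st' \<Longrightarrow> S' st'" "\<And>st'. S st' \<Longrightarrow> R st' \<Longrightarrow> R' st'"
  shows "triple Q D c st t' S' \<delta>' R'"
proof -
  have "wpn Q D t' [c] (outcome S' R') st
     \<le> wpn Q D t' [c] (outcome S R) st"
    using assms(4,5) by (intro wpn_mono) auto
  also have "\<dots> \<le> wpn Q D t [c] (outcome S R) st"
    using assms(2) by (rule wpn_antimono)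
  also have "\<dots> \<le> \<delta>'"
    using assms(1,3) by (auto simp: triple_def)
  finally show ?thesis by (simp add: triple_def)
qed

lemma runs_triple:
  assumes "runs Q D c st t st'" "S st'" "R st'"
  shows "triple Q D c st t S 0 R"
  using runsD[OF assms(1), of 0 "[]" "outcome S R"] assms(2,3)
  by (simp add: triple_def)

text \<open>The union bound: a violation of \<open>R\<close> costs at most 1, and affinity of
  \<open>wpn\<close> turns this unit cost into the failure probability.\<close>

lemma triple_use:
  assumes "triple Q D c st t S \<delta> R"
    and "\<And>st'. S st' \<Longrightarrow> wpn Q D T cs F st' \<le> x + (if R st' then 0 else 1)"
  shows "wpn Q D (t + T) (c # cs) F st \<le> x + \<delta>"
proof -
  let ?H = "outcome S R"
  have "wpn Q D (t + T) (c # cs) F st \<le> wpn Q D t [c] (wpn Q D T cs F) st"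
    by (rule wpn_Cons)
  also have "\<dots> \<le> wpn Q D t [c] (\<lambda>st'. x + 1 * ?H st') st"
    using assms(2) by (intro wpn_mono) auto
  also have "\<dots> \<le> x + 1 * wpn Q D t [c] ?H st"
    by (intro wpn_affine) simp
  also have "\<dots> \<le> x + \<delta>"
    using assms(1) by (simp add: triple_def)
  finally show ?thesis .
qed

lemma triple_top: "triple Q D c st t S \<delta> (\<lambda>_. True) \<Longrightarrow>
   wpn Q D t [c] (outcome S R) st \<le> \<delta> + 1"
  using triple_use[of Q D c st t S \<delta> "\<lambda>_. True" 0 "[]" "outcome S R" 1]
  by (simp add: add.commute)

lemma triple_Seq:
  assumes "triple Q D c st t1 S1 \<delta>1 R1"
    and "\<And>st1. S1 st1 \<Longrightarrow> triple Q D d st1 t2 S \<delta>2 (\<lambda>st'. R1 st1 \<longrightarrow> R st')"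
  shows "triple Q D (c ;; d) st (Suc (t1 + t2)) S (\<delta>1 + \<delta>2) R"
proof -
  have "wpn Q D (t1 + t2) (c # [d]) (outcome S R) st \<le> \<delta>2 + \<delta>1"
  proof (rule triple_use[OF assms(1)])
    fix st1 assume "S1 st1"
    then have triple: "triple Q D d st1 t2 S \<delta>2 (\<lambda>st'. R1 st1 \<longrightarrow> R st')"
      by (rule assms(2))
    show "wpn Q D t2 [d] (outcome S R) st1
        \<le> \<delta>2 + (if R1 st1 then 0 else 1)"
    proof (cases "R1 st1")
      case True
      then show ?thesis using triple by (simp add: triple_def)
    next
      \<comment> \<open>After a failure of \<open>R1\<close> the second command still halts in
        \<open>S\<close>; its worthless result costs 1, which is charged to the first
        command.\<close>
      case False
      then show ?thesis using triple triple_top[of Q D d st1 t2 S \<delta>2 R] by simp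
    qed
  qed
  then show ?thesis by (simp add: triple_def add.commute)
qed

lemma runs_triple_Seq:
  assumes "runs Q D c st t1 st1" "triple Q D d st1 t2 S \<delta> R"
  shows "triple Q D (c ;; d) st (Suc (t1 + t2)) S \<delta> R"
  using runsD[OF assms(1), of t2 "[d]"] assms(2) unfolding triple_def by (auto intro: order_trans)

lemma triple_If:
  "triple Q D (if expr_val e st \<noteq> Empty then c else d) st t S \<delta> R \<Longrightarrow> triple Q D (If e c d) st (Suc t) S \<delta> R"
  by (simp add: triple_def)

text \<open>\<open>I\<close> holds surely and thereby secures the time bound; \<open>G\<close> is
  what each round preserves up to a failure of probability \<open>\<delta>\<close>. The counter
  \<open>k\<close> goes down to 0.\<close>

lemma triple_for:
  assumes nz: "\<And>k st. I k st \<Longrightarrow> expr_val e st \<noteq> Empty \<longleftrightarrow> k > 0"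
    and body: "\<And>k st. I (Suc k) st \<Longrightarrow> triple Q D c st t (I k) \<delta> (\<lambda>st'. G (Suc k) st \<longrightarrow> G k st')"
    and "I k st"
  shows "triple Q D (While e c) st (k * (t + 1) + 1) (I 0) (of_nat k * \<delta>) (\<lambda>st'. G k st \<longrightarrow> G 0 st')"
  using \<open>I k st\<close>
proof (induction k arbitrary: st)
  case 0
  then show ?case using nz[of 0 st] runs_triple[OF runs_While_Empty] by auto
next
  case (Suc k)
  have "triple Q D (c ;; While e c) st (Suc (t + (k * (t + 1) + 1))) (I 0) (\<delta> + of_nat k * \<delta>)
    (\<lambda>st'. G (Suc k) st \<longrightarrow> G 0 st')"
  proof (rule triple_Seq[OF body[OF Suc.prems]])
    fix st1 assume "I k st1"
    from Suc.IH[OF this] show "triple Q D (While e c) st1 (k * (t + 1) + 1) (I 0) (of_nat k * \<delta>)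
        (\<lambda>st'. (G (Suc k) st \<longrightarrow> G k st1) \<longrightarrow> G (Suc k) st \<longrightarrow> G 0 st')"
      by (rule triple_weaken) auto
  qed
  moreover have "expr_val e st \<noteq> Empty" using nz[OF Suc.prems] by simp
  ultimately show ?case
    by (simp add: triple_def distrib_right algebra_simps)
qed

section \<open>Restricting a point and reading digits\<close>

text \<open>
  Registers below 20 belong to the main program, those below 30 to the interface of the tester,
  those below 40 to the simulation of its oracles. The variables of the tester start at 40.
\<close>

abbreviation (input) rN :: nat where "rN \<equiv> 0"
abbreviation (input) rS :: nat where "rS \<equiv> 1"
abbreviation (input) rK :: nat where "rK \<equiv> 2"
abbreviation (input) rStack :: nat where "rStack \<equiv> 3"
abbreviation (input) rOut :: nat where "rOut \<equiv> 4"
abbreviation (input) rPath :: nat where "rPath \<equiv> 5"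
abbreviation (input) rFlags :: nat where "rFlags \<equiv> 6"
abbreviation (input) rSize :: nat where "rSize \<equiv> 7"
abbreviation (input) rDepth :: nat where "rDepth \<equiv> 8"
abbreviation (input) rDigits :: nat where "rDigits \<equiv> 9"
abbreviation (input) rRest :: nat where "rRest \<equiv> 10"
abbreviation (input) rI :: nat where "rI \<equiv> 11"
abbreviation (input) rA :: nat where "rA \<equiv> 12"
abbreviation (input) rB :: nat where "rB \<equiv> 13"
abbreviation (input) rFound :: nat where "rFound \<equiv> 14"
abbreviation (input) rX :: nat where "rX \<equiv> 15"
abbreviation (input) tPath :: nat where "tPath \<equiv> 20"
abbreviation (input) tSize :: nat where "tSize \<equiv> 21"
abbreviation (input) tDigits :: nat where "tDigits \<equiv> 22"
abbreviation (input) tRuns :: nat where "tRuns \<equiv> 23"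
abbreviation (input) tAcc :: nat where "tAcc \<equiv> 24"
abbreviation (input) tRej :: nat where "tRej \<equiv> 25"
abbreviation (input) uPoint :: nat where "uPoint \<equiv> 30"
abbreviation (input) uPath :: nat where "uPath \<equiv> 31"
abbreviation (input) uI :: nat where "uI \<equiv> 32"
abbreviation (input) uBit :: nat where "uBit \<equiv> 33"
abbreviation (input) uAcc :: nat where "uAcc \<equiv> 34"
abbreviation (input) uDigits :: nat where "uDigits \<equiv> 35"
abbreviation (input) uRes :: nat where "uRes \<equiv> 36"

abbreviation agree :: "nat \<Rightarrow> store \<Rightarrow> store \<Rightarrow> bool" where
  "agree N st \<tau> \<equiv> \<forall>v < N. st v = \<tau> v"

abbreviation (input) TrueE :: expr where "TrueE \<equiv> PairE EmptyE EmptyE"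

abbreviation (input) move_left_com :: com where
  "move_left_com \<equiv>
    While (Var uI)
       (Assign uAcc (PairE (Fst (Var uPoint)) (Var uAcc)) ;;
        Assign uPoint (Snd (Var uPoint)) ;;
        Assign uI (Snd (Var uI)))"

abbreviation (input) move_right_com :: com where
  "move_right_com \<equiv>
    While (Var uAcc)
       (Assign uPoint (PairE (Fst (Var uAcc)) (Var uPoint)) ;;
        Assign uAcc (Snd (Var uAcc)))"

text \<open>There is no assignment inside a list, so the first \<open>i\<close> entries are moved
  onto a stack, the head is replaced, and the stack is moved back, as with a zipper.\<close>

definition update_com :: com where
  "update_com =
     Assign uAcc EmptyE ;;
     move_left_com ;;
     Assign uPoint (PairE (Var uBit) (Snd (Var uPoint))) ;;
     move_right_com"

primrec data_update :: "nat \<Rightarrow> data \<Rightarrow> data \<Rightarrow> data" where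
  "data_update 0 b w = Pair b (snd_data w)"
| "data_update (Suc i) b w = Pair (fst_data w) (data_update i b (snd_data w))"

lemma data_point_update:
  "i < n \<Longrightarrow> data_point n (data_update i b w) = (data_point n w)[i := data_sign b]"
proof (induction n arbitrary: i w)
  case (Suc n)
  then show ?case by (cases i) auto
qed simp

primrec move_left :: "nat \<Rightarrow> data \<Rightarrow> data \<Rightarrow> data" where
  "move_left 0 w a = a"
| "move_left (Suc k) w a = move_left k (snd_data w) (Pair (fst_data w) a)"

fun move_right :: "data \<Rightarrow> data \<Rightarrow> data" where
  "move_right Empty w = w"
| "move_right (Pair h a) w = move_right a (Pair h w)"

lemma move_right_move_left:
  "move_right (move_left i w a) (Pair b (snd_data ((snd_data ^^ i) w))) = move_right a (data_update i b w)"
  by (induction i arbitrary: w a) (simp_all del: funpow.simps add: funpow_Suc_right)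

lemma data_nat_move_left [simp]: "data_nat (move_left k w a) = k + data_nat a"
  by (induction k arbitrary: w a) auto

lemma runs_move_left:
  "st uI = nat_data k \<Longrightarrow>
   runs Q D move_left_com st (6 * k + 1)
     (st(uAcc := move_left k (st uPoint) (st uAcc), uPoint := (snd_data ^^ k) (st uPoint), uI := Empty))"
proof (induction k arbitrary: st)
  case 0
  then have "(st(uAcc := move_left 0 (st uPoint) (st uAcc), uPoint := (snd_data ^^ 0) (st uPoint), uI := Empty)) = st"
    by (simp add: fun_eq_iff)
  then show ?case using runs_While_Empty[of "Var uI" st] 0 by simp
next
  case (Suc k)
  let ?st = "st(uAcc := Pair (fst_data (st uPoint)) (st uAcc), uPoint := snd_data (st uPoint), uI := nat_data k)"
  have fin: "(?st(uAcc := move_left k (?st uPoint) (?st uAcc), uPoint := (snd_data ^^ k) (?st uPoint), uI := Empty))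
    = st(uAcc := move_left (Suc k) (st uPoint) (st uAcc), uPoint := (snd_data ^^ (Suc k)) (st uPoint), uI := Empty)"
    by (simp add: fun_eq_iff funpow_swap1)
  show ?case
    apply (rule runs_weaken)
     apply (rule runs_While_step[where ?t1.0 = 5])
       apply (simp add: Suc.prems)
      apply (rule runs_straightI[where st' = ?st])
        apply (simp_all add: Suc.prems fun_eq_iff)[3]
     apply (rule Suc.IH[of ?st, unfolded fin])
     apply simp
    apply simp
    done
qed

lemma runs_move_right:
  "runs Q D move_right_com st (4 * data_nat (st uAcc) + 1)
     (st(uPoint := move_right (st uAcc) (st uPoint), uAcc := Empty))"
proof (induction "st uAcc" arbitrary: st)
  case Empty
  then have "(st(uPoint := move_right (st uAcc) (st uPoint), uAcc := Empty)) = st"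
    by (simp add: fun_eq_iff flip: Empty)
  then show ?case using runs_While_Empty[of "Var uAcc" st] Empty by (simp flip: Empty)
next
  case (Pair h a)
  let ?st = "st(uPoint := Pair h (st uPoint), uAcc := a)"
  have eq: "st uAcc = Pair h a" using Pair by simp
  have fin: "(?st(uPoint := move_right (?st uAcc) (?st uPoint), uAcc := Empty)) =
    st(uPoint := move_right (st uAcc) (st uPoint), uAcc := Empty)"
    by (simp add: fun_eq_iff eq)
  show ?case
    apply (rule runs_weaken)
     apply (rule runs_While_step[where ?t1.0 = 3])
       apply (simp add: eq)
      apply (rule runs_straightI[where st' = ?st])
        apply (simp_all add: eq fun_eq_iff)[3]
     apply (rule Pair(2)[of ?st, unfolded fin])
     apply simp
    apply (simp add: eq)
    done
qed

lemma runs_update: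
  assumes "st uI = nat_data i"
  shows "runs Q D update_com st (10 * i + 8)
    (st(uPoint := data_update i (st uBit) (st uPoint), uI := Empty, uAcc := Empty))"
proof -
  let ?st1 = "st(uAcc := Empty)"
  let ?st2 = "?st1(uAcc := move_left i (?st1 uPoint) (?st1 uAcc), uPoint := (snd_data ^^ i) (?st1 uPoint), uI := Empty)"
  let ?st3 = "?st2(uPoint := Pair (st uBit) (snd_data (?st2 uPoint)))"
  let ?st4 = "?st3(uPoint := move_right (?st3 uAcc) (?st3 uPoint), uAcc := Empty)"
  have "?st4 = st(uPoint := data_update i (st uBit) (st uPoint), uI := Empty, uAcc := Empty)"
    by (simp add: fun_eq_iff move_right_move_left)
  moreover have "runs Q D update_com st (10 * i + 8) ?st4"
    unfolding update_com_def
    apply (rule runs_weaken)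
     apply (rule runs_Seq[OF runs_straightI[where t = 1 and st' = ?st1]])
        apply (simp_all)[3]
     apply (rule runs_Seq[OF runs_move_left[where k = i]])
      apply (simp add: assms)
     apply (rule runs_Seq[OF runs_straightI[where t = 1 and st' = ?st3]])
        apply (simp_all)[3]
     apply (rule runs_move_right)
    apply simp
    done
  ultimately show ?thesis by simp
qed

section \<open>Paths and the restriction of a point\<close>

primrec path_data :: "(nat \<times> int) list \<Rightarrow> data" where
  "path_data [] = Empty"
| "path_data (a # \<rho>) = Pair (Pair (nat_data (fst a)) (sign_data (snd a))) (path_data \<rho>)"

primrec restrict_data :: "(nat \<times> int) list \<Rightarrow> data \<Rightarrow> data" where
  "restrict_data [] w = w"
| "restrict_data (a # \<rho>) w = restrict_data \<rho> (data_update (fst a) (sign_data (snd a)) w)"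

text \<open>The head of a path is its most recent restriction; older ones take precedence.\<close>

primrec restrict_point :: "(nat \<times> int) list \<Rightarrow> int list \<Rightarrow> int list" where
  "restrict_point [] x = x"
| "restrict_point (a # \<rho>) x = restrict_point \<rho> (x[fst a := snd a])"

text \<open>By the order of application in \<open>restrict_point\<close>, extending the path by
  \<open>(i, b)\<close> turns \<open>f\<close> into \<open>\<lambda>x. f (x[i := b])\<close>, the
  form in which \<open>near_size_split\<close> splits a function.\<close>

abbreviation restricted :: "(int list \<Rightarrow> int) \<Rightarrow> (nat \<times> int) list \<Rightarrow> int list \<Rightarrow> int" where
  "restricted g \<rho> \<equiv> \<lambda>x. g (restrict_point \<rho> x)"

definition path_ok :: "nat \<Rightarrow> (nat \<times> int) list \<Rightarrow> bool" where
  "path_ok n \<rho> \<longleftrightarrow> (\<forall>(i, b) \<in> set \<rho>. i < n \<and> b \<in> {-1, 1})"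

lemma data_sign_sign_data: "b \<in> {-1, 1} \<Longrightarrow> data_sign (sign_data b) = b"
  by (auto simp: data_sign_def sign_data_def bool_data_def)

lemma data_point_restrict:
  "path_ok n \<rho> \<Longrightarrow> data_point n (restrict_data \<rho> w) = restrict_point \<rho> (data_point n w)"
  by (induction \<rho> arbitrary: w) (auto simp: path_ok_def data_point_update data_sign_sign_data)

definition restrict_com :: com where
  "restrict_com =
     While (Var uPath)
       (Assign uI (Fst (Fst (Var uPath))) ;;
        Assign uBit (Snd (Fst (Var uPath))) ;;
        update_com ;;
        Assign uPath (Snd (Var uPath)))"

lemma runs_restrict:
  assumes "path_ok n \<rho>" "st uPath = path_data \<rho>"
  shows "\<exists>st'. runs Q D restrict_com st (length \<rho> * (10 * n + 20) + 1) st' \<and>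
    st' uPoint = restrict_data \<rho> (st uPoint) \<and> (\<forall>v. v \<notin> {uPoint, uPath, uI, uBit, uAcc} \<longrightarrow> st' v = st v)"
  using assms unfolding restrict_com_def
proof (induction \<rho> arbitrary: st)
  case Nil
  then show ?case using runs_While_Empty[of "Var uPath" st] by (intro exI[of _ st]) simp
next
  case (Cons a \<rho>)
  let ?w = "While (Var uPath)
       (Assign uI (Fst (Fst (Var uPath))) ;;
        Assign uBit (Snd (Fst (Var uPath))) ;;
        update_com ;;
        Assign uPath (Snd (Var uPath)))"
  let ?st0 = "st(uI := nat_data (fst a))"
  let ?st1 = "st(uI := nat_data (fst a), uBit := sign_data (snd a))"
  let ?st2 = "?st1(uPoint := data_update (fst a) (?st1 uBit) (?st1 uPoint), uI := Empty, uAcc := Empty)"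
  let ?st3 = "?st2(uPath := path_data \<rho>)"
  have "path_ok n \<rho>" and lt: "fst a < n" using Cons.prems by (auto simp: path_ok_def)
  have prem: "?st3 uPath = path_data \<rho>" by simp
  obtain st' where st': "runs Q D ?w ?st3 (length \<rho> * (10 * n + 20) + 1) st'"
    "st' uPoint = restrict_data \<rho> (?st3 uPoint)" "\<forall>v. v \<notin> {uPoint, uPath, uI, uBit, uAcc} \<longrightarrow> st' v = ?st3 v"
    using Cons.IH[OF \<open>path_ok n \<rho>\<close>, of ?st3, OF prem] by blast
  have "runs Q D ?w st (length (a # \<rho>) * (10 * n + 20) + 1) st'"
    apply (rule runs_weaken)
     apply (rule runs_While_step[OF _ _ st'(1)])
      apply (simp add: Cons.prems)
     apply (rule runs_Seq[OF runs_straightI[where t = 1 and st' = ?st0]])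
        apply (simp_all add: Cons.prems)[3]
     apply (rule runs_Seq[OF runs_straightI[where t = 1 and st' = ?st1]])
        apply (simp_all add: Cons.prems)[3]
     apply (rule runs_Seq[OF runs_update[where i = "fst a"]])
      apply simp
     apply (rule runs_straightI[where t = 1])
       apply (simp_all add: Cons.prems)[3]
    using lt apply simp
    done
  then show ?case using st'(2,3) by (intro exI[of _ st']) auto
qed

text \<open>The accuracy \<open>2^-m\<close> is held as the list of its binary digits.\<close>

primrec digits_data :: "nat \<Rightarrow> data" where
  "digits_data 0 = Pair (bool_data True) Empty"
| "digits_data (Suc m) = Pair (bool_data False) (digits_data m)"

text \<open>The floor is 0 before position \<open>m\<close>, and at position \<open>m + d\<close> it
  is \<open>2 ^ d\<close>, which is odd only for \<open>d = 0\<close>.\<close>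

lemma digit_oracle_power2: "digit_oracle (1 / 2 ^ m) v \<longleftrightarrow> data_nat v = m"
proof (cases "data_nat v < m")
  case True
  then have "(2::real) ^ data_nat v < 2 ^ m" by simp
  then have "\<lfloor>1 / 2 ^ m * 2 ^ data_nat v :: real\<rfloor> = 0"
    by (simp add: floor_eq_iff divide_simps)
  then show ?thesis using True by (simp add: digit_oracle_def)
next
  case False
  then obtain d where d: "data_nat v = m + d" using le_Suc_ex not_le by blast
  have "1 / 2 ^ m * 2 ^ data_nat v = real_of_int (2 ^ d)"
    by (simp add: d power_add)
  then have "\<lfloor>1 / 2 ^ m * 2 ^ data_nat v :: real\<rfloor> = 2 ^ d"
    by (metis floor_of_int)
  then show ?thesis using d by (auto simp: digit_oracle_def)
qed

abbreviation (input) digit_loop_com :: com where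
  "digit_loop_com \<equiv>
    While (Var uDigits)
       (If (Var uPoint)
          (Assign uPoint (Snd (Var uPoint)) ;; Assign uDigits (Snd (Var uDigits)))
          (Assign uRes (Fst (Var uDigits)) ;; Assign uDigits EmptyE))"

text \<open>Position and digit list are consumed in parallel; a position beyond the final 1 exhausts
  the list and leaves the answer 0.\<close>

definition digit_com :: com where
  "digit_com =
     Assign uRes EmptyE ;;
     digit_loop_com"

lemma runs_digit_loop:
  assumes "st uDigits = digits_data m" "st uRes = Empty"
  shows "\<exists>st'. runs Q D digit_loop_com st (5 * m + 6) st' \<and>
    st' uRes = bool_data (data_nat (st uPoint) = m) \<and> (\<forall>v. v \<notin> {uPoint, uDigits, uRes} \<longrightarrow> st' v = st v)"

  using assms
proof (induction m arbitrary: st)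
  case 0
  show ?case
  proof (cases "st uPoint")
    case Empty
    have "runs Q D digit_loop_com st (5 * 0 + 6) (st(uRes := bool_data True, uDigits := Empty))"
      apply (rule runs_weaken)
       apply (rule runs_While_step[where ?t1.0 = 4])
         apply (simp add: 0)
        apply (rule runs_straightI)
          apply (simp_all add: 0 Empty)[3]
       apply (rule runs_While_Empty)
       apply (simp_all add: 0 Empty)
      done
    then show ?thesis using Empty by (auto intro!: exI)
  next
    case (Pair a b)
    have "runs Q D digit_loop_com st (5 * 0 + 6) (st(uPoint := b, uDigits := Empty))"
      apply (rule runs_weaken)
       apply (rule runs_While_step[where ?t1.0 = 4])
         apply (simp add: 0)
        apply (rule runs_straightI)
          apply (simp_all add: 0 Pair)[3]
       apply (rule runs_While_Empty)
       apply (simp_all add: 0 Pair)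
      done
    then show ?thesis using Pair 0 by (auto intro!: exI simp: bool_data_def)
  qed
next
  case (Suc m)
  show ?case
  proof (cases "st uPoint")
    case Empty
    have "runs Q D digit_loop_com st (5 * Suc m + 6) (st(uRes := bool_data False, uDigits := Empty))"
      apply (rule runs_weaken)
       apply (rule runs_While_step[where ?t1.0 = 4])
         apply (simp add: Suc.prems)
        apply (rule runs_straightI)
          apply (simp_all add: Suc.prems Empty)[3]
       apply (rule runs_While_Empty)
       apply (simp_all add: Suc.prems Empty)
      done
    then show ?thesis using Empty by (auto intro!: exI)
  next
    case (Pair a b)
    let ?st = "st(uPoint := b, uDigits := digits_data m)"
    have prem: "?st uDigits = digits_data m" "?st uRes = Empty"
      using Suc.prems by simp_all
    obtain st' where st': "runs Q D digit_loop_com ?st (5 * m + 6) st'"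
      "st' uRes = bool_data (data_nat (?st uPoint) = m)" "\<forall>v. v \<notin> {uPoint, uDigits, uRes} \<longrightarrow> st' v = ?st v"
      using Suc.IH[OF prem] by blast
    have "runs Q D digit_loop_com st (5 * Suc m + 6) st'"
      apply (rule runs_weaken)
       apply (rule runs_While_step[where ?t1.0 = 4, OF _ _ st'(1)])
        apply (simp add: Suc.prems)
       apply (rule runs_straightI)
         apply (simp_all add: Suc.prems Pair)
      done
    then show ?thesis using Pair st'(2,3) by (intro exI[of _ st']) auto
  qed
qed

lemma runs_digit:
  assumes "st uDigits = digits_data m"
  shows "\<exists>st'. runs Q D digit_com st (5 * m + 8) st' \<and>
    st' uRes = bool_data (digit_oracle (1 / 2 ^ m) (st uPoint)) \<and>
    (\<forall>v. v \<notin> {uPoint, uDigits, uRes} \<longrightarrow> st' v = st v)"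
proof -
  obtain st' where st': "runs Q D digit_loop_com (st(uRes := Empty)) (5 * m + 6) st'"
    "st' uRes = bool_data (data_nat ((st(uRes := Empty)) uPoint) = m)"
    "\<forall>v. v \<notin> {uPoint, uDigits, uRes} \<longrightarrow> st' v = (st(uRes := Empty)) v"
    using runs_digit_loop[of "st(uRes := Empty)" m Q D] assms by auto
  have "runs Q D digit_com st (5 * m + 8) st'"
    unfolding digit_com_def
    by (rule runs_weaken, rule runs_Seq[OF runs_straightI[where t = 1] st'(1)]) simp_all
  then show ?thesis using st'(2,3) by (intro exI[of _ st']) (auto simp: digit_oracle_power2)
qed

section \<open>Running the tester on a restricted function\<close>

primrec shift_expr :: "expr \<Rightarrow> expr" where
  "shift_expr (Var v) = Var (v + 40)"
| "shift_expr EmptyE = EmptyE"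
| "shift_expr (PairE a b) = PairE (shift_expr a) (shift_expr b)"
| "shift_expr (Fst a) = Fst (shift_expr a)"
| "shift_expr (Snd a) = Snd (shift_expr a)"

text \<open>The tester is run against simulated oracles: a query is sent on with the path applied to
  its point, and a digit is looked up in \<open>tDigits\<close>. It thus sees a restricted function
  and a power of two, whatever the true digit oracle is.\<close>

primrec compile :: "com \<Rightarrow> com" where
  "compile Skip = Skip"
| "compile (Assign v e) = Assign (v + 40) (shift_expr e)"
| "compile (Coin v) = Coin (v + 40)"
| "compile (Query v e) =
     Assign uPoint (shift_expr e) ;; Assign uPath (Var tPath) ;; restrict_com ;; Query (v + 40) (Var uPoint)"
| "compile (Digit v e) =
     Assign uPoint (shift_expr e) ;; Assign uDigits (Var tDigits) ;; digit_com ;; Assign (v + 40) (Var uRes)"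
| "compile (Seq c d) = Seq (compile c) (compile d)"
| "compile (If e c d) = If (shift_expr e) (compile c) (compile d)"
| "compile (While e c) = While (shift_expr e) (compile c)"

primrec expr_vars :: "expr \<Rightarrow> nat set" where
  "expr_vars (Var v) = {v}"
| "expr_vars EmptyE = {}"
| "expr_vars (PairE a b) = expr_vars a \<union> expr_vars b"
| "expr_vars (Fst a) = expr_vars a"
| "expr_vars (Snd a) = expr_vars a"

primrec com_vars :: "com \<Rightarrow> nat set" where
  "com_vars Skip = {}"
| "com_vars (Assign v e) = insert v (expr_vars e)"
| "com_vars (Coin v) = {v}"
| "com_vars (Query v e) = insert v (expr_vars e)"
| "com_vars (Digit v e) = insert v (expr_vars e)"
| "com_vars (Seq c d) = com_vars c \<union> com_vars d"
| "com_vars (If e c d) = expr_vars e \<union> com_vars c \<union> com_vars d"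
| "com_vars (While e c) = expr_vars e \<union> com_vars c"

lemma finite_com_vars: "finite (com_vars c)"
proof -
  have "finite (expr_vars e)" for e by (induction e) auto
  then show ?thesis by (induction c) auto
qed

text \<open>Registers 30 to 39 are left free, being scratch space of the oracle simulation. The
  bound \<open>N\<close> makes the tester's part finite, so that it can be reset between
  trials.\<close>

definition simulates :: "nat \<Rightarrow> store \<Rightarrow> store \<Rightarrow> store \<Rightarrow> bool" where
  "simulates N \<tau> st st' \<longleftrightarrow> (\<forall>v<N. st' (v + 40) = st v) \<and> (\<forall>v<30. st' v = \<tau> v)"

lemma simulates_expr:
  "simulates N \<tau> st st' \<Longrightarrow> expr_vars e \<subseteq> {..<N} \<Longrightarrow> expr_val (shift_expr e) st' = expr_val e st"
  by (induction e) (auto simp: simulates_def)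

lemma simulates_upd: "simulates N \<tau> st st' \<Longrightarrow> simulates N \<tau> (st(v := x)) (st'(v + 40 := x))"
  by (auto simp: simulates_def)

lemma simulates_scratch:
  "simulates N \<tau> st st' \<Longrightarrow> (\<And>v. v < 30 \<or> 40 \<le> v \<Longrightarrow> st'' v = st' v) \<Longrightarrow> simulates N \<tau> st st''"
  by (auto simp: simulates_def)

text \<open>One bound for a simulated step of any kind, so that the slowdown of the whole simulation
  is a plain factor.\<close>

definition sim_cost :: "nat \<Rightarrow> (nat \<times> int) list \<Rightarrow> nat \<Rightarrow> nat" where
  "sim_cost n \<rho> m = length \<rho> * (10 * n + 20) + 5 * m + 20"

lemma runs_compile_Query:
  assumes "path_ok n \<rho>" "\<tau> tPath = path_data \<rho>"
    and sim: "simulates N \<tau> st st'" and "expr_vars e \<subseteq> {..<N}"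
  shows "\<exists>st''. runs (query_oracle n g) D (compile (Query v e)) st' (sim_cost n \<rho> m) st'' \<and>
    simulates N \<tau> (st(v := bool_data (query_oracle n (restricted g \<rho>) (expr_val e st)))) st''"
proof -
  let ?Q = "query_oracle n g"
  let ?st1 = "st'(uPoint := expr_val (shift_expr e) st')"
  let ?st2 = "?st1(uPath := st' tPath)"
  have "?st2 uPath = path_data \<rho>"
    using assms(2) sim by (simp add: simulates_def)
  from runs_restrict[where Q = ?Q and D = D, OF assms(1), of ?st2, OF this] obtain st3 where
    st3: "runs ?Q D restrict_com ?st2 (length \<rho> * (10 * n + 20) + 1) st3"
      "st3 uPoint = restrict_data \<rho> (?st2 uPoint)"
      "\<forall>v. v \<notin> {uPoint, uPath, uI, uBit, uAcc} \<longrightarrow> st3 v = ?st2 v"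
    by blast
  let ?st4 = "st3(v + 40 := bool_data (?Q (st3 uPoint)))"
  have "runs ?Q D (compile (Query v e)) st' (sim_cost n \<rho> m) ?st4"
    unfolding compile.simps
    apply (rule runs_weaken)
     apply (rule runs_Seq[OF runs_straightI[where t = 1 and st' = ?st1]])
        apply (simp_all)[3]
     apply (rule runs_Seq[OF runs_straightI[where t = 1 and st' = ?st2]])
        apply (simp_all)[3]
     apply (rule runs_Seq[OF st3(1)])
     apply (rule runs_Query[where e = "Var uPoint", unfolded expr_val.simps])
    apply (simp add: sim_cost_def)
    done
  moreover have "simulates N \<tau> (st(v := bool_data (?Q (st3 uPoint)))) ?st4"
    using st3(3) by (intro simulates_upd simulates_scratch[OF sim]) auto
  moreover have "?Q (st3 uPoint) = query_oracle n (restricted g \<rho>) (expr_val e st)"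
    using simulates_expr[OF sim assms(4)] assms(1) by (simp add: st3(2) query_oracle_def data_point_restrict)
  ultimately show ?thesis by auto
qed

lemma runs_compile_Digit:
  assumes "\<tau> tDigits = digits_data m"
    and sim: "simulates N \<tau> st st'" and "expr_vars e \<subseteq> {..<N}"
  shows "\<exists>st''. runs Q D (compile (Digit v e)) st' (sim_cost n \<rho> m) st'' \<and>
    simulates N \<tau> (st(v := bool_data (digit_oracle (1 / 2 ^ m) (expr_val e st)))) st''"
proof -
  let ?st1 = "st'(uPoint := expr_val (shift_expr e) st')"
  let ?st2 = "?st1(uDigits := st' tDigits)"
  have "?st2 uDigits = digits_data m"
    using assms(1) sim by (simp add: simulates_def)
  from runs_digit[where Q = Q and D = D, of ?st2, OF this] obtain st3 where
    st3: "runs Q D digit_com ?st2 (5 * m + 8) st3"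
      "st3 uRes = bool_data (digit_oracle (1 / 2 ^ m) (?st2 uPoint))"
      "\<forall>v. v \<notin> {uPoint, uDigits, uRes} \<longrightarrow> st3 v = ?st2 v"
    by blast
  let ?st4 = "st3(v + 40 := st3 uRes)"
  have "runs Q D (compile (Digit v e)) st' (sim_cost n \<rho> m) ?st4"
    unfolding compile.simps
    apply (rule runs_weaken)
     apply (rule runs_Seq[OF runs_straightI[where t = 1 and st' = ?st1]])
        apply (simp_all)[3]
     apply (rule runs_Seq[OF runs_straightI[where t = 1 and st' = ?st2]])
        apply (simp_all)[3]
     apply (rule runs_Seq[OF st3(1)])
     apply (rule runs_Assign[where e = "Var uRes", unfolded expr_val.simps])
    apply (simp add: sim_cost_def)
    done
  moreover have "simulates N \<tau> (st(v := st3 uRes)) ?st4"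
    using st3(3) by (intro simulates_upd simulates_scratch[OF sim]) auto
  moreover have "st3 uRes = bool_data (digit_oracle (1 / 2 ^ m) (expr_val e st))"
    using simulates_expr[OF sim assms(3)] by (simp add: st3(2))
  ultimately show ?thesis by auto
qed

lemma wpn_compile:
  assumes "path_ok n \<rho>" "\<tau> tPath = path_data \<rho>" "\<tau> tDigits = digits_data m"
    and FF': "\<And>st st'. simulates N \<tau> st st' \<Longrightarrow> F' st' \<le> F st"
  shows "simulates N \<tau> st st' \<Longrightarrow> \<forall>c \<in> set cs. com_vars c \<subseteq> {..<N} \<Longrightarrow>
    wpn (query_oracle n g) D (sim_cost n \<rho> m * T) (map compile cs) F' st' \<le>
    wpn (query_oracle n (restricted g \<rho>)) (digit_oracle (1 / 2 ^ m)) T cs F st"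
proof (induction T arbitrary: cs st st')
  case 0
  then show ?case by (cases cs) (auto intro: FF')
next
  case (Suc T)
  let ?Q = "query_oracle n g" and ?\<kappa> = "sim_cost n \<rho> m"
  let ?Q' = "query_oracle n (restricted g \<rho>)" and ?D' = "digit_oracle (1 / 2 ^ m)"
  obtain \<kappa>' where \<kappa>': "?\<kappa> = Suc \<kappa>'" by (simp add: sim_cost_def)
  \<comment> \<open>Commands other than oracle calls consume one step of their allotment; the rest
    is discarded.\<close>
  have drop: "wpn ?Q D (\<kappa>' + ?\<kappa> * T) cs F' st' \<le> wpn ?Q D (?\<kappa> * T) cs F' st'" for cs st'
    by (rule wpn_antimono) simp
  note IH = order_trans[OF drop Suc.IH]
  show ?case
  proof (cases cs)
    case Nil
    then show ?thesis using FF' Suc.prems by simp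
  next
    case (Cons c cs')
    have cs': "\<forall>c \<in> set cs'. com_vars c \<subseteq> {..<N}" and c: "com_vars c \<subseteq> {..<N}"
      using Suc.prems Cons by auto
    note ev = simulates_expr[OF Suc.prems(1)]
    show ?thesis
    proof (cases c)
      case Skip
      then show ?thesis using IH[OF Suc.prems(1) cs'] Cons by (simp add: \<kappa>')
    next
      case (Assign v e)
      then show ?thesis
        using IH[OF simulates_upd[OF Suc.prems(1), of v "expr_val e st"] cs'] Cons c
        by (simp add: \<kappa>' ev del: fun_upd_apply)
    next
      case (Coin v)
      then show ?thesis
        using IH[OF simulates_upd[OF Suc.prems(1), of v "bool_data True"] cs']
          IH[OF simulates_upd[OF Suc.prems(1), of v "bool_data False"] cs'] Cons c
        by (simp add: \<kappa>' divide_right_mono_ennreal add_mono del: fun_upd_apply)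
    next
      case (Query v e)
      then have "expr_vars e \<subseteq> {..<N}" using c by simp
      from runs_compile_Query[OF assms(1,2) Suc.prems(1) this]
      obtain st'' where st'': "runs ?Q D (compile (Query v e)) st' ?\<kappa> st''"
        "simulates N \<tau> (st(v := bool_data (?Q' (expr_val e st)))) st''" by blast
      show ?thesis
        using order_trans[OF runsD[OF st''(1), where T = "?\<kappa> * T"] Suc.IH[OF st''(2) cs']] Query Cons
        by (simp del: compile.simps fun_upd_apply)
    next
      case (Digit v e)
      then have "expr_vars e \<subseteq> {..<N}" using c by simp
      from runs_compile_Digit[OF assms(3) Suc.prems(1) this]
      obtain st'' where st'': "runs ?Q D (compile (Digit v e)) st' ?\<kappa> st''"
        "simulates N \<tau> (st(v := bool_data (?D' (expr_val e st)))) st''" by blast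
      show ?thesis
        using order_trans[OF runsD[OF st''(1), where T = "?\<kappa> * T"] Suc.IH[OF st''(2) cs']] Digit Cons
        by (simp del: compile.simps fun_upd_apply)
    next
      case (Seq c1 c2)
      then show ?thesis using IH[OF Suc.prems(1), of "c1 # c2 # cs'"] cs' Cons c
        by (simp add: \<kappa>')
    next
      case (If e c1 c2)
      then show ?thesis using IH[OF Suc.prems(1), of "(if expr_val e st \<noteq> Empty then c1 else c2) # cs'"] cs' Cons c
        by (auto simp: \<kappa>' ev)
    next
      case (While e c1)
      then show ?thesis
        using IH[OF Suc.prems(1), of "if expr_val e st \<noteq> Empty then c1 # While e c1 # cs' else cs'"] cs' Cons c
        by (auto simp: \<kappa>' ev)
    qed
  qed
qed

section \<open>Majority vote\<close>

primrec reset_com :: "nat \<Rightarrow> com" where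
  "reset_com 0 = Skip"
| "reset_com (Suc k) = reset_com k ;; Assign (k + 40) EmptyE"

lemma runs_reset:
  "runs Q D (reset_com k) st (2 * k + 1) (\<lambda>v. if 40 \<le> v \<and> v < k + 40 then Empty else st v)"
proof (induction k)
  case 0
  have "(\<lambda>v. if 40 \<le> v \<and> v < 0 + 40 then Empty else st v) = st" by (auto simp: fun_eq_iff)
  then show ?case using runs_Skip[of Q D st] by simp
next
  case (Suc k)
  have "runs Q D (reset_com (Suc k)) st (Suc (2 * k + 1 + 1))
    ((\<lambda>v. if 40 \<le> v \<and> v < k + 40 then Empty else st v)(k + 40 := Empty))"
    unfolding reset_com.simps by (rule runs_Seq[OF Suc runs_Assign[where e = EmptyE, unfolded expr_val.simps]])
  also have "(\<lambda>v. if 40 \<le> v \<and> v < k + 40 then Empty else st v)(k + 40 := Empty) =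
    (\<lambda>v. if 40 \<le> v \<and> v < Suc k + 40 then Empty else st v)"
    by (auto simp: fun_eq_iff)
  finally show ?case by simp
qed

text \<open>A previous trial leaves garbage behind, while the tester is specified on a clean store
  only. Registers 40 and 41 are its registers 0 and 1: its inputs, and in 40 later its
  answer.\<close>

definition trial_prepare :: "nat \<Rightarrow> com" where
  "trial_prepare N =
     Assign tRuns (Snd (Var tRuns)) ;; reset_com N ;; Assign 40 (Var rN) ;; Assign 41 (Var tSize)"

definition trial_record :: com where
  "trial_record =
     If (Var 40) (Assign tAcc (PairE EmptyE (Var tAcc))) (Assign tRej (PairE EmptyE (Var tRej)))"

definition trials_com :: "nat \<Rightarrow> com \<Rightarrow> com" where
  "trials_com N P = While (Var tRuns) (trial_prepare N ;; compile P ;; trial_record)"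

text \<open>Leaves the truncated difference of acceptances and rejections in \<open>tAcc\<close>,
  which is nonempty exactly for a strict majority of acceptances; a tie rejects.\<close>

definition compare_com :: com where
  "compare_com =
     While (Var tRej) (Assign tRej (Snd (Var tRej)) ;; Assign tAcc (Snd (Var tAcc)))"

definition test_com :: "nat \<Rightarrow> com \<Rightarrow> com" where
  "test_com N P =
     (Assign tRuns (Var rK) ;; Assign tAcc EmptyE ;; Assign tRej EmptyE) ;; trials_com N P ;; compare_com"

lemma runs_trial_prepare:
  assumes "st rN = nat_data n" "st tSize = nat_data s" "N \<ge> 2"
  shows "\<exists>st'. runs Q D (trial_prepare N) st (2 * N + 10) st' \<and>
    simulates N (st(tRuns := snd_data (st tRuns))) (init_store n s) st'"
proof -
  let ?st1 = "st(tRuns := snd_data (st tRuns))"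
  let ?st2 = "\<lambda>v. if 40 \<le> v \<and> v < N + 40 then Empty else ?st1 v"
  let ?st3 = "?st2(40 := nat_data n)"
  let ?st4 = "?st3(41 := nat_data s)"
  have "runs Q D (trial_prepare N) st (2 * N + 10) ?st4"
    unfolding trial_prepare_def
    apply (rule runs_weaken)
     apply (rule runs_Seq[OF runs_straightI[where t = 1 and st' = ?st1]])
        apply (simp_all)[3]
     apply (rule runs_Seq[OF runs_reset])
     apply (rule runs_straightI[where t = 3])
       apply (simp_all add: assms fun_eq_iff)
    done
  moreover have "simulates N ?st1 (init_store n s) ?st4"
    using assms by (auto simp: simulates_def init_store_def)
  ultimately show ?thesis by blast
qed

lemma snd_data_nat_data: "snd_data (nat_data k) = nat_data (k - 1)"
  by (cases k) auto

lemma nat_data_eq_Empty [simp]: "nat_data k = Empty \<longleftrightarrow> k = 0"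
  by (cases k) auto

lemma runs_compare:
  "st tAcc = nat_data a \<Longrightarrow> st tRej = nat_data r \<Longrightarrow>
    \<exists>st'. runs Q D compare_com st (5 * r + 1) st' \<and> st' tAcc = nat_data (a - r) \<and> (agree 23 st' st)"
  unfolding compare_com_def
proof (induction r arbitrary: a st)
  case 0
  then show ?case using runs_While_Empty[of "Var tRej" st] by (intro exI[of _ st]) simp
next
  case (Suc r)
  let ?w = "While (Var tRej) (Assign tRej (Snd (Var tRej)) ;; Assign tAcc (Snd (Var tAcc)))"
  let ?st = "st(tRej := nat_data r, tAcc := nat_data (a - 1))"
  have prem: "?st tAcc = nat_data (a - 1)" "?st tRej = nat_data r" by simp_all
  obtain st' where st': "runs Q D ?w ?st (5 * r + 1) st'" "st' tAcc = nat_data (a - 1 - r)" "agree 23 st' ?st"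
    using Suc.IH[OF prem] by blast
  have "runs Q D ?w st (5 * Suc r + 1) st'"
    apply (rule runs_weaken)
     apply (rule runs_While_step[OF _ runs_straightI[where t = 3] st'(1)])
        apply (simp_all add: Suc.prems snd_data_nat_data)
    done
  then show ?case using st'(2,3) by (intro exI[of _ st']) auto
qed

text \<open>
  Weighting a run by \<open>l ^ (wrong answers - right answers)\<close> turns the majority vote into a
  supermartingale argument: every trial multiplies the expected weight by at most
  \<open>(1 - p) * l + p / l\<close>, and a wrong majority has weight at least 1.
\<close>

definition vote_weight :: "real \<Rightarrow> (bool \<Rightarrow> bool) \<Rightarrow> nat \<Rightarrow> nat \<Rightarrow> real" where
  "vote_weight l ok a r = (if ok True then 1 / l else l) ^ a * (if ok False then 1 / l else l) ^ r"

lemma vote_weight_pos: "l > 0 \<Longrightarrow> vote_weight l ok a r > 0"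
  by (simp add: vote_weight_def)

lemma vote_weight_wrong:
  assumes "l > 1" "ok True \<or> ok False" "\<not> ok (a > r)"
  shows "vote_weight l ok a r \<ge> 1"
proof (cases "a > r")
  case True
  then have "vote_weight l ok a r = l ^ (a - r)"
    using assms by (simp add: vote_weight_def power_diff power_one_over)
  then show ?thesis using assms(1) by simp
next
  case False
  then have "vote_weight l ok a r = l ^ (r - a)"
    using assms by (simp add: vote_weight_def power_diff power_one_over)
  then show ?thesis using assms(1) by simp
qed

definition trial_cost :: "nat \<Rightarrow> (nat \<times> int) list \<Rightarrow> nat \<Rightarrow> nat \<Rightarrow> nat \<Rightarrow> nat" where
  "trial_cost n \<rho> m N t = sim_cost n \<rho> m * t + 2 * N + 20"

lemma wpn_trials:
  fixes p l :: real
  assumes "path_ok n \<rho>" and \<tau>: "\<tau> tPath = path_data \<rho>" "\<tau> tDigits = digits_data m"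
      "\<tau> rN = nat_data n" "\<tau> tSize = nat_data s"
    and N: "com_vars P \<subseteq> {..<N}" "N \<ge> 2"
    and tester: "wpn (query_oracle n (restricted g \<rho>)) (digit_oracle (1 / 2 ^ m)) t [P]
       (\<lambda>st. if ok (st 0 \<noteq> Empty) then 0 else 1) (init_store n s) \<le> ennreal (1 - p)"
    and p: "p \<le> 1" and l: "l > 1"
    and rest: "\<And>st a r. st tAcc = nat_data a \<Longrightarrow> st tRej = nat_data r \<Longrightarrow> a + r \<le> K \<Longrightarrow> agree 23 st \<tau> \<Longrightarrow>
      wpn (query_oracle n g) D T cs F st \<le> ennreal (vote_weight l ok a r)"
  shows "st tRuns = nat_data k \<Longrightarrow> st tAcc = nat_data a \<Longrightarrow> st tRej = nat_data r \<Longrightarrow> a + r + k \<le> K \<Longrightarrow>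
    agree 23 st \<tau> \<Longrightarrow>
    wpn (query_oracle n g) D (k * trial_cost n \<rho> m N t + 1 + T) (trials_com N P # cs) F st \<le>
      ennreal (vote_weight l ok a r * ((1 - p) * l + p / l) ^ k)"
proof (induction k arbitrary: st a r)
  case 0
  then show ?case using rest[OF 0(2,3) _ 0(5)] by (simp add: trials_com_def)
next
  case (Suc k)
  let ?Q = "query_oracle n g" and ?c = "trial_cost n \<rho> m N t" and ?\<kappa> = "sim_cost n \<rho> m"
  let ?\<theta> = "(1 - p) * l + p / l"
  let ?T = "k * ?c + 1 + T"
  let ?cs = "trial_record # trials_com N P # cs"
  have \<theta>: "?\<theta> > 0"
  proof -
    have "?\<theta> = 1 / l + (1 - p) * (l - 1 / l)"
      by (simp add: algebra_simps diff_divide_distrib)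
    moreover have "l - 1 / l > 0" using l by (simp add: field_simps) (metis less_1_mult mult.commute)
    ultimately show ?thesis using p l by (simp add: add_pos_nonneg)
  qed
  have "st rN = nat_data n" "st tSize = nat_data s"
    using Suc.prems(5) \<tau>(3,4) by simp_all
  from runs_trial_prepare[where Q = ?Q and D = D, OF this N(2)] obtain st1 where
    st1: "runs ?Q D (trial_prepare N) st (2 * N + 10) st1"
      "simulates N (st(tRuns := snd_data (st tRuns))) (init_store n s) st1" by blast
  define \<tau>1 where "\<tau>1 = st(tRuns := snd_data (st tRuns))"
  define w where "w = vote_weight l ok a r * ?\<theta> ^ k"
  have w: "w > 0" using vote_weight_pos[of l ok a r] \<theta> l by (simp add: w_def)
  have bracket: "l - 1 / l > 0" using l by (simp add: field_simps) (metis less_1_mult mult.commute)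
  \<comment> \<open>The weight becomes \<open>w / l\<close> after a right answer and
    \<open>w * l\<close> after a wrong one. Written as an affine function of the indicator of a
    wrong answer, its expectation follows from the tester's failure bound by
    \<open>wpn_affine\<close>.\<close>
  define F1 where "F1 = (\<lambda>st :: store. ennreal (w / l) + ennreal (w * (l - 1 / l)) * (if ok (st 0 \<noteq> Empty) then 0 else 1) :: ennreal)"
  have F1: "wpn ?Q D (3 + ?T) ?cs F st2' \<le> F1 st2" if sim: "simulates N \<tau>1 st2 st2'" for st2 st2' :: store
  proof -
    have st2': "st2' 40 = st2 0"
      using sim N(2) unfolding simulates_def by (metis add_0 numeral_2_eq_2 zero_less_Suc less_le_trans)
    have eq: "st2' v = \<tau>1 v" if "v < 30" for v
      using sim that by (simp add: simulates_def)
    show ?thesis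
    proof (cases "st2 0 = Empty")
      case False
      let ?st = "st2'(tAcc := nat_data (Suc a))"
      have "runs ?Q D trial_record st2' 3 ?st"
        using False Suc.prems(2) by (intro runs_straightI) (simp_all add: trial_record_def st2' eq \<tau>1_def)
      then have "wpn ?Q D (3 + ?T) ?cs F st2' \<le> wpn ?Q D ?T (trials_com N P # cs) F ?st"
        by (rule runsD)
      also have "\<dots> \<le> ennreal (vote_weight l ok (Suc a) r * ?\<theta> ^ k)"
        using Suc.prems by (intro Suc.IH) (auto simp: eq \<tau>1_def)
      also have "vote_weight l ok (Suc a) r * ?\<theta> ^ k = w * (if ok True then 1 / l else l)"
        by (simp add: vote_weight_def w_def)
      also have "ennreal \<dots> = F1 st2"
        using False w l bracket by (simp add: F1_def flip: ennreal_plus) (simp add: field_simps)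
      finally show ?thesis .
    next
      case True
      let ?st = "st2'(tRej := nat_data (Suc r))"
      have "runs ?Q D trial_record st2' 3 ?st"
        using True Suc.prems(3) by (intro runs_straightI) (simp_all add: trial_record_def st2' eq \<tau>1_def)
      then have "wpn ?Q D (3 + ?T) ?cs F st2' \<le> wpn ?Q D ?T (trials_com N P # cs) F ?st"
        by (rule runsD)
      also have "\<dots> \<le> ennreal (vote_weight l ok a (Suc r) * ?\<theta> ^ k)"
        using Suc.prems by (intro Suc.IH) (auto simp: eq \<tau>1_def)
      also have "vote_weight l ok a (Suc r) * ?\<theta> ^ k = w * (if ok False then 1 / l else l)"
        by (simp add: vote_weight_def w_def)
      also have "ennreal \<dots> = F1 st2"
        using True w l bracket by (simp add: F1_def flip: ennreal_plus) (simp add: field_simps)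
      finally show ?thesis .
    qed
  qed
  have \<tau>1: "\<tau>1 tPath = path_data \<rho>" "\<tau>1 tDigits = digits_data m"
    using Suc.prems(5) \<tau>(1,2) by (simp_all add: \<tau>1_def)
  have "wpn ?Q D (Suc k * ?c + 1 + T) (trials_com N P # cs) F st \<le>
    wpn ?Q D ((2 * N + 10) + (3 + (?\<kappa> * t + (3 + ?T)))) (trials_com N P # cs) F st"
    by (rule wpn_antimono) (simp add: trial_cost_def)
  also have "\<dots> = wpn ?Q D ((2 * N + 10) + (1 + (?\<kappa> * t + (3 + ?T))))
      (trial_prepare N # (compile P ;; trial_record) # trials_com N P # cs) F st"
    using Suc.prems(1) by (simp add: trials_com_def numeral_eq_Suc)
  also have "\<dots> \<le> wpn ?Q D (1 + (?\<kappa> * t + (3 + ?T))) ((compile P ;; trial_record) # trials_com N P # cs) F st1"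
    by (rule runsD[OF st1(1)])
  also have "\<dots> = wpn ?Q D (?\<kappa> * t + (3 + ?T)) (compile P # ?cs) F st1"
    by (simp only: plus_1_eq_Suc wpn.simps)
  also have "\<dots> \<le> wpn ?Q D (?\<kappa> * t) [compile P] (wpn ?Q D (3 + ?T) ?cs F) st1"
    by (rule wpn_Cons)
  also have "\<dots> \<le> wpn (query_oracle n (restricted g \<rho>)) (digit_oracle (1 / 2 ^ m)) t [P] F1 (init_store n s)"
    using wpn_compile[where cs = "[P]" and F' = "wpn ?Q D (3 + ?T) ?cs F" and F = F1, OF assms(1) \<tau>1 F1 st1(2)[folded \<tau>1_def]] N(1)
    by simp
  also have "\<dots> \<le> ennreal (w / l) + ennreal (w * (l - 1 / l)) *
     wpn (query_oracle n (restricted g \<rho>)) (digit_oracle (1 / 2 ^ m)) t [P]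
       (\<lambda>st. if ok (st 0 \<noteq> Empty) then 0 else 1) (init_store n s)"
    unfolding F1_def using w bracket by (intro wpn_affine) simp
  also have "\<dots> \<le> ennreal (w / l) + ennreal (w * (l - 1 / l)) * ennreal (1 - p)"
    by (intro add_left_mono mult_left_mono tester) simp
  also have "\<dots> = ennreal (w * ?\<theta>)"
    using w l bracket p by (simp flip: ennreal_mult ennreal_plus) (simp add: field_simps)
  also have "w * ?\<theta> = vote_weight l ok a r * ?\<theta> ^ Suc k"
    by (simp add: w_def)
  finally show ?case .
qed

lemma triple_test:
  fixes p l :: real
  assumes "path_ok n \<rho>" "st tPath = path_data \<rho>" "st tDigits = digits_data m"
      "st rN = nat_data n" "st tSize = nat_data s" "st rK = nat_data k"
    and "com_vars P \<subseteq> {..<N}" "N \<ge> 2"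
    and "wpn (query_oracle n (restricted g \<rho>)) (digit_oracle (1 / 2 ^ m)) t [P]
       (\<lambda>st. if ok (st 0 \<noteq> Empty) then 0 else 1) (init_store n s) \<le> ennreal (1 - p)"
    and ok: "ok True \<or> ok False" and "p \<le> 1" and l: "l > 1"
  shows "triple (query_oracle n g) D (test_com N P) st (k * trial_cost n \<rho> m N t + 5 * k + 20)
     (\<lambda>st'. agree 23 st' st) (ennreal (((1 - p) * l + p / l) ^ k)) (\<lambda>st'. ok (st' tAcc \<noteq> Empty))"
proof -
  let ?Q = "query_oracle n g" and ?c = "trial_cost n \<rho> m N t"
  let ?F = "\<lambda>st'. if agree 23 st' st then if ok (st' tAcc \<noteq> Empty) then 0 else 1 else (top :: ennreal)"
  let ?st1 = "st(tRuns := nat_data k, tAcc := Empty, tRej := Empty)"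
  let ?init = "Assign tRuns (Var rK) ;; Assign tAcc EmptyE ;; Assign tRej EmptyE"
  have fin: "wpn ?Q D (5 * k + 1) [compare_com] ?F st' \<le> ennreal (vote_weight l ok a r)"
    if "st' tAcc = nat_data a" "st' tRej = nat_data r" "a + r \<le> k" "agree 23 st' st" for st' a r
  proof -
    from runs_compare[OF that(1,2)] obtain st2 where st2: "runs ?Q D compare_com st' (5 * r + 1) st2"
      "st2 tAcc = nat_data (a - r)" "agree 23 st2 st'" by blast
    have "runs ?Q D compare_com st' (5 * k + 1) st2"
      using st2(1) that(3) by (elim runs_weaken) simp
    then have "wpn ?Q D (5 * k + 1) [compare_com] ?F st' \<le> ?F st2"
      using runsD[of ?Q D compare_com st' "5 * k + 1" st2 0 "[]" ?F] by simp
    also have "\<dots> = (if ok (a > r) then 0 else 1)"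
      using st2(2,3) that(4) by (simp add: not_le)
    also have "\<dots> \<le> ennreal (vote_weight l ok a r)"
      using vote_weight_wrong[OF l ok, where a = a and r = r] by auto
    finally show ?thesis .
  qed
  have "wpn ?Q D (k * ?c + 5 * k + 20) [test_com N P] ?F st \<le>
    wpn ?Q D (2 + (5 + (1 + (k * ?c + 1 + (5 * k + 1))))) [test_com N P] ?F st"
    by (rule wpn_antimono) simp
  also have "\<dots> = wpn ?Q D (6 + (1 + (k * ?c + 1 + (5 * k + 1)))) [?init, trials_com N P ;; compare_com] ?F st"
    by (simp add: test_com_def numeral_eq_Suc)
  also have "\<dots> \<le> wpn ?Q D (1 + (k * ?c + 1 + (5 * k + 1))) [trials_com N P ;; compare_com] ?F ?st1"
    by (rule runsD, rule runs_straightI) (simp_all add: assms)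
  also have "\<dots> = wpn ?Q D (k * ?c + 1 + (5 * k + 1)) [trials_com N P, compare_com] ?F ?st1"
    by simp
  also have "\<dots> \<le> ennreal (vote_weight l ok 0 0 * ((1 - p) * l + p / l) ^ k)"
    by (rule wpn_trials[where \<tau> = st and K = k]) (use assms fin in \<open>auto\<close>)
  finally show ?thesis by (simp add: triple_def vote_weight_def)
qed

section \<open>Decision trees on the cube\<close>

definition cube_prob :: "nat \<Rightarrow> (int list \<Rightarrow> bool) \<Rightarrow> real" where
  "cube_prob n P = real (card {x \<in> cube n. P x}) / 2 ^ n"

lemma finite_cube [simp]: "finite (cube n)"
  and card_cube: "card (cube n) = 2 ^ n"
proof -
  have eq: "cube n = {xs. set xs \<subseteq> {-1, 1} \<and> length xs = n}" by (auto simp: cube_def)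
  show "finite (cube n)" "card (cube n) = 2 ^ n"
    unfolding eq using finite_lists_length_eq[of "{-1, 1::int}" n] card_lists_length_eq[of "{-1, 1::int}" n]
    by (simp_all add: card_insert_if numeral_2_eq_2)
qed

lemma cube_nonempty [simp]: "cube n \<noteq> {}"
  using card_cube[of n] by auto

lemma cube_update: "x \<in> cube n \<Longrightarrow> b \<in> {-1, 1} \<Longrightarrow> x[i := b] \<in> cube n"
  using set_update_subset_insert[of x i b] by (auto simp: cube_def)

lemma cube_length: "x \<in> cube n \<Longrightarrow> length x = n"
  by (simp add: cube_def)

lemma cube_nth: "x \<in> cube n \<Longrightarrow> i < n \<Longrightarrow> x ! i = -1 \<or> x ! i = 1"
proof -
  assume "x \<in> cube n" "i < n"
  then have "x ! i \<in> {-1, 1}"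
    using subsetD[of "set x" "{-1, 1}" "x ! i"] nth_mem[of i x] unfolding cube_def by simp
  then show ?thesis by simp
qed

lemma disagreement_eq: "disagreement n f g = cube_prob n (\<lambda>x. f x \<noteq> g x)"
proof -
  have "cube n \<inter> {x. f x \<noteq> g x} = {x \<in> cube n. f x \<noteq> g x}" by auto
  then show ?thesis
    by (simp add: disagreement_def cube_prob_def measure_pmf_of_set card_cube)
qed

lemma cube_prob_nonneg [simp]: "0 \<le> cube_prob n P"
  by (simp add: cube_prob_def)

lemma cube_prob_le_1: "cube_prob n P \<le> 1"
proof -
  have "card {x \<in> cube n. P x} \<le> card (cube n)"
    by (intro card_mono) auto
  then have "real (card {x \<in> cube n. P x}) \<le> 2 ^ n"
    unfolding card_cube using of_nat_mono by fastforce
  then show ?thesis by (simp add: cube_prob_def)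
qed

lemma cube_prob_cong: "(\<And>x. x \<in> cube n \<Longrightarrow> P x \<longleftrightarrow> Q x) \<Longrightarrow> cube_prob n P = cube_prob n Q"
  unfolding cube_prob_def by (metis (mono_tags, lifting) Collect_cong)

text \<open>Conditioning on coordinate \<open>i\<close> is expressed by overwriting it, so that
  restricted functions stay functions on all of \<open>cube n\<close> and no reindexing
  occurs.\<close>

lemma cube_prob_split:
  assumes "i < n"
  shows "cube_prob n P = (cube_prob n (\<lambda>x. P (x[i := -1])) + cube_prob n (\<lambda>x. P (x[i := 1]))) / 2"
proof -
  define A where "A b = {x \<in> cube n. x ! i = b \<and> P x}" for b
  \<comment> \<open>Overwriting coordinate \<open>i\<close> by \<open>b\<close> is two-to-one: a
    point of \<open>A b\<close> comes from itself and from its neighbour across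
    \<open>i\<close>.\<close>
  have double: "card {x \<in> cube n. P (x[i := b])} = 2 * card (A b)" if b: "b \<in> {-1, 1}" for b
  proof -
    define B where "B = {x \<in> cube n. x ! i = - b \<and> P (x[i := b])}"
    have same: "x[i := b] = x" if "x ! i = b" for x
      using that by auto
    have "{x \<in> cube n. P (x[i := b])} = A b \<union> B"
    proof (intro set_eqI iffI)
      fix x assume x: "x \<in> {x \<in> cube n. P (x[i := b])}"
      then have "x ! i = -1 \<or> x ! i = 1" using cube_nth[OF _ assms] by simp
      then have "x ! i = b \<or> x ! i = - b" using b by force
      then show "x \<in> A b \<union> B" using x same[of x] by (auto simp: A_def B_def)
    qed (use same in \<open>auto simp: A_def B_def\<close>)
    moreover have "A b \<inter> B = {}"
      using b by (auto simp: A_def B_def)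
    moreover have "finite (A b)" "finite B"
      by (simp_all add: A_def B_def)
    moreover have "bij_betw (\<lambda>x. x[i := b]) B (A b)"
    proof (rule bij_betw_byWitness[where f' = "\<lambda>x. x[i := - b]"])
      show "\<forall>x\<in>B. x[i := b, i := - b] = x"
        by (metis (mono_tags, lifting) B_def list_update_id list_update_overwrite mem_Collect_eq)
      show "\<forall>x\<in>A b. x[i := - b, i := b] = x"
        using same by (simp add: A_def)
      show "(\<lambda>x. x[i := b]) ` B \<subseteq> A b"
        using assms b by (auto simp: A_def B_def cube_length cube_update)
      show "(\<lambda>x. x[i := - b]) ` A b \<subseteq> B"
        using assms b same by (auto simp: A_def B_def cube_length cube_update)
    qed
    then have "card B = card (A b)" by (rule bij_betw_same_card)
    ultimately show ?thesis by (simp add: card_Un_disjoint)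
  qed
  have "{x \<in> cube n. P x} = A (-1) \<union> A 1"
    using cube_nth[OF _ assms] by (auto simp: A_def)
  moreover have "A (-1) \<inter> A 1 = {}" "finite (A (-1))" "finite (A 1)"
    by (auto simp: A_def)
  ultimately have "card {x \<in> cube n. P x} = card (A (-1)) + card (A 1)"
    by (simp add: card_Un_disjoint)
  then show ?thesis
    using double[of "-1"] double[of 1] by (simp add: cube_prob_def field_simps)
qed

section \<open>Restricted trees and closeness to trees of bounded size\<close>

primrec dt_restrict :: "nat \<Rightarrow> int \<Rightarrow> dtree \<Rightarrow> dtree" where
  "dt_restrict i b (Leaf c) = Leaf c"
| "dt_restrict i b (Node j l r) =
     (if j = i then if b = -1 then dt_restrict i b l else dt_restrict i b r
      else Node j (dt_restrict i b l) (dt_restrict i b r))"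

lemma dt_eval_restrict: "i < length x \<Longrightarrow> dt_eval (dt_restrict i b T) x = dt_eval T (x[i := b])"
  by (induction T) auto

lemma leaves_restrict: "leaves (dt_restrict i b T) \<le> leaves T"
  by (induction T) auto

lemma dt_wf_restrict: "dt_wf n T \<Longrightarrow> dt_wf n (dt_restrict i b T)"
  by (induction T) auto

lemma leaves_pos: "leaves T \<ge> 1"
  by (induction T) auto

definition near_size :: "nat \<Rightarrow> nat \<Rightarrow> real \<Rightarrow> (int list \<Rightarrow> int) \<Rightarrow> bool" where
  "near_size n s e f \<longleftrightarrow> (\<exists>T \<in> size_dtrees n s. close n e f (dt_eval T))"

lemma near_sizeI:
  "dt_wf n T \<Longrightarrow> leaves T \<le> s \<Longrightarrow> cube_prob n (\<lambda>x. f x \<noteq> dt_eval T x) \<le> e \<Longrightarrow> near_size n s e f"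
  by (auto simp: near_size_def size_dtrees_def close_def disagreement_eq)

text \<open>A subtree may query \<open>i\<close> again; restricting it makes its value at
  \<open>x\<close> equal to its value at \<open>x[i := b]\<close>.\<close>

lemma dt_eval_Node_update:
  assumes "i < n" "b \<in> {-1, 1}"
  shows "cube_prob n (\<lambda>x. f (x[i := b]) \<noteq> dt_eval (Node i l r) (x[i := b])) =
    cube_prob n (\<lambda>x. f (x[i := b]) \<noteq> dt_eval (dt_restrict i b (if b = -1 then l else r)) x)"
  using assms by (intro cube_prob_cong) (auto simp: cube_length dt_eval_restrict)

text \<open>
  If \<open>f\<close> ignores the variable at the root of an approximating tree, one of the two subtrees
  approximates \<open>f\<close> at least as well, so a root variable can be chosen that \<open>f\<close> does not ignore.
\<close>

lemma near_size_split:
  assumes indep: "\<And>i b x. i \<in> U \<Longrightarrow> f (x[i := b]) = f x"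
    and "near_size n s e f"
  shows "(\<exists>c \<in> {-1, 1}. cube_prob n (\<lambda>x. f x \<noteq> c) \<le> e) \<or>
    (\<exists>i a. i < n \<and> i \<notin> U \<and> 1 \<le> a \<and> a < s \<and>
       near_size n a (2 * e) (\<lambda>x. f (x[i := -1])) \<and> near_size n (s - a) (2 * e) (\<lambda>x. f (x[i := 1])))"
proof -
  have "dt_wf n T \<Longrightarrow> leaves T \<le> s \<Longrightarrow> cube_prob n (\<lambda>x. f x \<noteq> dt_eval T x) \<le> e \<Longrightarrow> ?thesis" for T
  proof (induction "leaves T" arbitrary: T rule: less_induct)
    case less
    show ?case
    proof (cases T)
      case (Leaf c)
      then show ?thesis using less.prems by auto
    next
      case (Node i l r)
      let ?l = "dt_restrict i (-1) l" and ?r = "dt_restrict i 1 r"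
      have i: "i < n" and wf: "dt_wf n ?l" "dt_wf n ?r"
        using less.prems(1) Node by (auto intro: dt_wf_restrict)
      have lv: "leaves ?l \<le> leaves l" "leaves ?r \<le> leaves r" "1 \<le> leaves l" "1 \<le> leaves r"
        by (rule leaves_restrict leaves_pos)+
      \<comment> \<open>The two errors average to that of \<open>T\<close>. So each is at most
        \<open>2 * e\<close>, which serves a useful root, and the smaller one is at most
        \<open>e\<close>, which serves an ignored root.\<close>
      have sum: "cube_prob n (\<lambda>x. f (x[i := -1]) \<noteq> dt_eval ?l x) +
        cube_prob n (\<lambda>x. f (x[i := 1]) \<noteq> dt_eval ?r x) \<le> 2 * e"
        using less.prems(3) dt_eval_Node_update[OF i, of "-1" f l r] dt_eval_Node_update[OF i, of 1 f l r]
        unfolding Node cube_prob_split[OF i, of "\<lambda>x. f x \<noteq> dt_eval (Node i l r) x"] by simp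
      show ?thesis
      proof (cases "i \<in> U")
        case True
        then have "cube_prob n (\<lambda>x. f x \<noteq> dt_eval ?l x) + cube_prob n (\<lambda>x. f x \<noteq> dt_eval ?r x) \<le> 2 * e"
          using sum indep by simp
        then consider "cube_prob n (\<lambda>x. f x \<noteq> dt_eval ?l x) \<le> e" | "cube_prob n (\<lambda>x. f x \<noteq> dt_eval ?r x) \<le> e"
          by linarith
        then show ?thesis
        proof cases
          case 1
          then show ?thesis using less.hyps[of ?l] less.prems(2) wf lv Node by simp
        next
          case 2
          then show ?thesis using less.hyps[of ?r] less.prems(2) wf lv Node by simp
        qed
      next
        case False
        have "cube_prob n (\<lambda>x. f (x[i := -1]) \<noteq> dt_eval ?l x) \<le> 2 * e"
          "cube_prob n (\<lambda>x. f (x[i := 1]) \<noteq> dt_eval ?r x) \<le> 2 * e"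
          using sum cube_prob_nonneg[of n "\<lambda>x. f (x[i := -1]) \<noteq> dt_eval ?l x"]
            cube_prob_nonneg[of n "\<lambda>x. f (x[i := 1]) \<noteq> dt_eval ?r x"] by linarith+
        \<comment> \<open>The right half receives all of \<open>s\<close> that the left subtree
          leaves over, so that the two sizes add up to \<open>s\<close> exactly.\<close>
        then have "near_size n (leaves l) (2 * e) (\<lambda>x. f (x[i := -1]))"
          "near_size n (s - leaves l) (2 * e) (\<lambda>x. f (x[i := 1]))"
          using near_sizeI[OF wf(1)] near_sizeI[OF wf(2)] lv less.prems(2) Node by simp_all
        then show ?thesis using i False lv less.prems(2) Node
          by (intro disjI2 exI[of _ i] exI[of _ "leaves l"]) auto
      qed
    qed
  qed
  then show ?thesis
    using assms(2) by (auto simp: near_size_def size_dtrees_def close_def disagreement_eq)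
qed

section \<open>Errors along a path\<close>

lemma length_restrict_point [simp]: "length (restrict_point \<rho> x) = length x"
  by (induction \<rho> arbitrary: x) auto

lemma restrict_point_cube: "path_ok n \<rho> \<Longrightarrow> x \<in> cube n \<Longrightarrow> restrict_point \<rho> x \<in> cube n"
proof (induction \<rho> arbitrary: x)
  case (Cons a \<rho>)
  then show ?case by (cases a) (auto simp: path_ok_def intro: cube_update)
qed simp

lemma restrict_point_nth: "i \<notin> fst ` set \<rho> \<Longrightarrow> restrict_point \<rho> x ! i = x ! i"
  by (induction \<rho> arbitrary: x) auto

text \<open>Older restrictions are applied last and overwrite whatever was put at
  \<open>i\<close>.\<close>

lemma restrict_point_ignores: "i \<in> fst ` set \<rho> \<Longrightarrow> restrict_point \<rho> (x[i := b]) = restrict_point \<rho> x"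
proof (induction \<rho> arbitrary: x)
  case (Cons a \<rho>)
  show ?case
  proof (cases "i = fst a")
    case False
    then have "i \<in> fst ` set \<rho>" using Cons.prems by auto
    then show ?thesis using Cons.IH False by (simp add: list_update_swap[of i "fst a"])
  qed simp
qed simp

text \<open>The error conditioned on the subcube of the path. In contrast to
  \<open>near_size\<close>, the tree too is evaluated at the restricted point, so that the trees of
  two children can be joined unchanged.\<close>

definition path_error :: "nat \<Rightarrow> (int list \<Rightarrow> int) \<Rightarrow> (nat \<times> int) list \<Rightarrow> dtree \<Rightarrow> real" where
  "path_error n g \<rho> T =
     cube_prob n (\<lambda>x. dt_eval T (restrict_point \<rho> x) \<noteq> g (restrict_point \<rho> x))"

text \<open>Since \<open>i\<close> is fresh, the older restrictions keep the value just put at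
  \<open>i\<close>: each child is reached with probability one half.\<close>

lemma path_error_Node:
  assumes "i < n" "i \<notin> fst ` set \<rho>"
  shows "path_error n g \<rho> (Node i l r) = (path_error n g ((i, -1) # \<rho>) l + path_error n g ((i, 1) # \<rho>) r) / 2"
proof -
  have "restrict_point \<rho> (x[i := b]) ! i = b" if "x \<in> cube n" for x b
    using that assms by (simp add: restrict_point_nth cube_length)
  then have "cube_prob n (\<lambda>x. dt_eval (Node i l r) (restrict_point \<rho> (x[i := b])) \<noteq> g (restrict_point \<rho> (x[i := b])))
    = path_error n g ((i, b) # \<rho>) (if b = -1 then l else r)" for b
    unfolding path_error_def by (intro cube_prob_cong) auto
  from this[of "-1"] this[of 1] show ?thesis
    unfolding path_error_def[of n g \<rho>] by (subst cube_prob_split[OF assms(1)]) simp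
qed

section \<open>Searching for a split\<close>

definition split_next :: com where
  "split_next = Assign rA (Snd (Var rA)) ;; Assign rB (PairE EmptyE (Var rB))"

text \<open>Dropping one digit doubles the accuracy, as \<open>near_size_split\<close> demands. A
  success overwrites any earlier one; all candidates are tried, so the number of rounds does not
  depend on the answers.\<close>

definition split_com :: "nat \<Rightarrow> com \<Rightarrow> com" where
  "split_com N P =
     (Assign tDigits (Snd (Var rDigits)) ;; Assign tSize (Var rA) ;;
      Assign tPath (PairE (PairE (Var rI) EmptyE) (Var rPath))) ;;
     test_com N P ;;
     If (Var tAcc)
       ((Assign tSize (Var rB) ;; Assign tPath (PairE (PairE (Var rI) TrueE) (Var rPath))) ;;
        test_com N P ;;
        If (Var tAcc)
          (Assign rFound (PairE (Var rI) (PairE (Var rA) (Var rB))) ;; split_next)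
          split_next)
       split_next"

definition search_next :: com where
  "search_next = Assign rRest (Snd (Var rRest)) ;; Assign rI (PairE EmptyE (Var rI))"

text \<open>\<open>rA\<close> runs down from \<open>s - 1\<close> while \<open>rB\<close> runs up
  from 1, which keeps their sum at \<open>s\<close> without a subtraction.\<close>

definition search_var_com :: "nat \<Rightarrow> com \<Rightarrow> com" where
  "search_var_com N P =
     If (Fst (Var rRest)) search_next
       ((Assign rA (Snd (Var rSize)) ;; Assign rB TrueE) ;;
        While (Var rA) (split_com N P) ;; search_next)"

definition search_com :: "nat \<Rightarrow> com \<Rightarrow> com" where
  "search_com N P =
     Assign rFound EmptyE ;;
     If (Var rDepth)
       ((Assign rRest (Var rFlags) ;; Assign rI EmptyE) ;; While (Var rRest) (search_var_com N P))
       Skip"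

text \<open>
  The flags mark the variables already queried on the path. They are skipped, so that the two
  children of a node always have half its weight.
\<close>

primrec flags_data :: "nat set \<Rightarrow> nat \<Rightarrow> nat \<Rightarrow> data" where
  "flags_data U i 0 = Empty"
| "flags_data U i (Suc k) = Pair (bool_data (i \<in> U)) (flags_data U (Suc i) k)"

lemma flags_data_empty: "flags_data {} i k = nat_data k"
  by (induction k arbitrary: i) (auto simp: bool_data_def)

lemma flags_data_cong: "(\<And>j. i \<le> j \<Longrightarrow> j \<in> U \<longleftrightarrow> j \<in> V) \<Longrightarrow> flags_data U i k = flags_data V i k"
  by (induction k arbitrary: i) auto

text \<open>Marking a variable reuses the update of a point, as both are lists along the right
  spine.\<close>

lemma data_update_flags:
  "j < k \<Longrightarrow> data_update j (bool_data True) (flags_data U i k) = flags_data (insert (i + j) U) i k"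
proof (induction k arbitrary: i j)
  case (Suc k)
  show ?case
  proof (cases j)
    case 0
    then show ?thesis using flags_data_cong[of "Suc i" U "insert i U" k] by simp
  next
    case (Suc j')
    then show ?thesis using Suc.IH[of j' "Suc i"] Suc.prems by simp
  qed
qed simp

fun found_data :: "(nat \<times> nat \<times> nat) option \<Rightarrow> data" where
  "found_data None = Empty"
| "found_data (Some (i, a, b)) = Pair (nat_data i) (Pair (nat_data a) (nat_data b))"

text \<open>
  \<open>B\<close> is the initial depth budget, \<open>2 ^ c\<close> bounds the loss of accuracy per level, \<open>k\<close> is the
  number of repetitions of the tester, \<open>tb\<close> its time bound, \<open>s0\<close> the size of the unknown tree.
\<close>

locale learner =
  fixes n :: nat and g :: "int list \<Rightarrow> int" and D :: "data \<Rightarrow> bool"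
    and P :: com and N tb k c B s0 :: nat and p l C :: real
  assumes C: "C \<ge> 1" "2 * C \<le> 2 ^ c" and p: "p \<le> 1" and l: "l > 1" and B: "B \<ge> 2"
    and N: "com_vars P \<subseteq> {..<N}" "N \<ge> 2"
    and tester: "\<And>\<rho> m s ok. path_ok n \<rho> \<Longrightarrow> 1 \<le> m \<Longrightarrow> m \<le> (c + 1) * B \<Longrightarrow> s \<le> s0 \<Longrightarrow>
      ok = (\<lambda>b. if b then near_size n s (C / 2 ^ m) (restricted g \<rho>)
                 else \<not> near_size n s (1 / 2 ^ m) (restricted g \<rho>)) \<Longrightarrow>
      wpn (query_oracle n (restricted g \<rho>)) (digit_oracle (1 / 2 ^ m)) tb [P]
        (\<lambda>st. if ok (st 0 \<noteq> Empty) then 0 else 1) (init_store n s) \<le> ennreal (1 - p)"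
begin

abbreviation Q :: "data \<Rightarrow> bool" where "Q \<equiv> query_oracle n g"

abbreviation near :: "nat \<Rightarrow> real \<Rightarrow> (nat \<times> int) list \<Rightarrow> bool" where
  "near s e \<rho> \<equiv> near_size n s e (restricted g \<rho>)"

definition test_cost :: nat where
  "test_cost = k * ((B * (10 * n + 20) + 5 * ((c + 1) * B) + 20) * tb + 2 * N + 20) + 5 * k + 20"

definition test_fail :: ennreal where
  "test_fail = ennreal (((1 - p) * l + p / l) ^ k)"

lemma near_mono: "near s e \<rho> \<Longrightarrow> e \<le> e' \<Longrightarrow> near s e' \<rho>"
  unfolding near_size_def close_def by (meson order_trans)

lemma triple_test_bounded:
  assumes "path_ok n \<rho>" "length \<rho> \<le> B" "1 \<le> m" "m \<le> (c + 1) * B" "s \<le> s0"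
    and "st tPath = path_data \<rho>" "st tDigits = digits_data m" "st rN = nat_data n"
      "st tSize = nat_data s" "st rK = nat_data k"
  shows "triple Q D (test_com N P) st test_cost (\<lambda>st'. agree 23 st' st) test_fail
    (\<lambda>st'. if st' tAcc \<noteq> Empty then near s (C / 2 ^ m) \<rho> else \<not> near s (1 / 2 ^ m) \<rho>)"
proof -
  let ?ok = "\<lambda>b. if b then near s (C / 2 ^ m) \<rho> else \<not> near s (1 / 2 ^ m) \<rho>"
  have "triple Q D (test_com N P) st (k * trial_cost n \<rho> m N tb + 5 * k + 20)
     (\<lambda>st'. agree 23 st' st) (ennreal (((1 - p) * l + p / l) ^ k)) (\<lambda>st'. ?ok (st' tAcc \<noteq> Empty))"
  proof (rule triple_test)
    \<comment> \<open>In the gap between the two accuracies both answers count as right;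
      \<open>C \<ge> 1\<close> excludes that both are wrong.\<close>
    show "?ok True \<or> ?ok False"
      using near_mono[of s "1 / 2 ^ m" \<rho> "C / 2 ^ m"] C(1) by (auto simp: divide_right_mono)
  qed (use assms N p l tester[OF assms(1,3-5)] in simp_all)
  then show ?thesis
  proof (rule triple_weaken)
    show "k * trial_cost n \<rho> m N tb + 5 * k + 20 \<le> test_cost"
      unfolding test_cost_def trial_cost_def sim_cost_def
      by (intro add_mono mult_mono order_refl) (use assms in auto)
  qed (auto simp: test_fail_def)
qed

end

locale learner_node = learner +
  fixes \<rho> :: "(nat \<times> int) list" and s e :: nat and \<tau> :: store
  assumes path: "path_ok n \<rho>" "length \<rho> + e \<le> B" and s: "1 \<le> s" "s \<le> s0"
    and \<tau>: "\<tau> rN = nat_data n" "\<tau> rK = nat_data k" "\<tau> rPath = path_data \<rho>"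
      "\<tau> rFlags = flags_data (fst ` set \<rho>) 0 n" "\<tau> rSize = nat_data s" "\<tau> rDepth = nat_data e"
      "\<tau> rDigits = digits_data (B + c * e)"
begin

text \<open>One digit fewer than at the node itself: the tests run at the doubled accuracy.\<close>

definition acc :: nat where "acc = B + c * e - 1"

text \<open>The sure part: it holds of a stored split however the tests answer, and it alone bounds
  the number of nodes.\<close>

definition found_ok :: "(nat \<times> nat \<times> nat) option \<Rightarrow> bool" where
  "found_ok fo \<longleftrightarrow> (\<forall>i a b. fo = Some (i, a, b) \<longrightarrow>
     i < n \<and> i \<notin> fst ` set \<rho> \<and> 1 \<le> a \<and> 1 \<le> b \<and> a + b = s)"

text \<open>Soundness of the stored split, and completeness of the search so far. Its position is
  given by \<open>i0\<close> and \<open>k0\<close>: smaller variables are finished, and for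
  \<open>i0\<close> the sizes above \<open>k0\<close>, since sizes are tried downwards.\<close>

definition found_good :: "nat \<Rightarrow> nat \<Rightarrow> (nat \<times> nat \<times> nat) option \<Rightarrow> bool" where
  "found_good i0 k0 fo \<longleftrightarrow>
     (\<forall>i a b. fo = Some (i, a, b) \<longrightarrow>
        near a (C / 2 ^ acc) ((i, -1) # \<rho>) \<and> near b (C / 2 ^ acc) ((i, 1) # \<rho>)) \<and>
     (\<forall>i a. i \<notin> fst ` set \<rho> \<and> 1 \<le> a \<and> a < s \<and> (i < i0 \<or> i = i0 \<and> k0 < a) \<and>
        near a (1 / 2 ^ acc) ((i, -1) # \<rho>) \<and> near (s - a) (1 / 2 ^ acc) ((i, 1) # \<rho>) \<longrightarrow> fo \<noteq> None)"

definition split_inv :: "nat \<Rightarrow> data \<Rightarrow> nat \<Rightarrow> store \<Rightarrow> bool" where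
  "split_inv i r j st \<longleftrightarrow> agree 10 st \<tau> \<and> st rI = nat_data i \<and> st rRest = r \<and>
     st rA = nat_data j \<and> st rB = nat_data (s - j) \<and> j < s \<and>
     (\<exists>fo. st rFound = found_data fo \<and> found_ok fo)"

definition found_inv :: "nat \<Rightarrow> nat \<Rightarrow> store \<Rightarrow> bool" where
  "found_inv i j st \<longleftrightarrow> (\<exists>fo. st rFound = found_data fo \<and> found_ok fo \<and> found_good i j fo)"

lemma triple_split:
  assumes "e \<ge> 1" "i < n" "i \<notin> fst ` set \<rho>" and inv: "split_inv i r (Suc j) st"
  shows "triple Q D (split_com N P) st (2 * test_cost + 30) (split_inv i r j) (2 * test_fail)
    (\<lambda>st'. found_inv i (Suc j) st \<longrightarrow> found_inv i j st')"
proof -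
  let ?G = "\<lambda>st'. found_inv i (Suc j) st \<longrightarrow> found_inv i j st'"
  let ?near1 = "\<lambda>x. near (Suc j) (x / 2 ^ acc) ((i, -1) # \<rho>)"
  let ?near2 = "\<lambda>x. near (s - Suc j) (x / 2 ^ acc) ((i, 1) # \<rho>)"
  let ?t2 = "Suc (3 + Suc (test_cost + 7))"
  have "c * e \<le> c * B" using path(2) by (intro mult_le_mono2) simp
  then have acc: "1 \<le> acc" "acc \<le> (c + 1) * B" "B + c * e = Suc acc"
    using B unfolding acc_def distrib_right by linarith+
  have path': "path_ok n ((i, b) # \<rho>)" "length ((i, b) # \<rho>) \<le> B" if "b \<in> {-1, 1}" for b
    using path assms(1,2) that by (auto simp: path_ok_def)
  have st: "st v = \<tau> v" if "v < 10" for v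
    using inv that by (simp add: split_inv_def)
  have st': "st rI = nat_data i" "st rRest = r" "st rA = nat_data (Suc j)" "st rB = nat_data (s - Suc j)" "Suc j < s"
    using inv by (simp_all add: split_inv_def)
  obtain fo where fo: "st rFound = found_data fo" "found_ok fo" "found_inv i (Suc j) st \<longrightarrow> found_good i (Suc j) fo"
    using inv unfolding split_inv_def found_inv_def by blast
  have sj: "Pair Empty (nat_data (s - Suc j)) = nat_data (s - j)"
    using st'(5) by (metis Suc_diff_Suc Suc_lessD nat_data.simps(2))
  let ?st1 = "st(tDigits := digits_data acc, tSize := nat_data (Suc j), tPath := path_data ((i, -1) # \<rho>))"
  \<comment> \<open>A correct rejection shows that the pair of size \<open>Suc j\<close> was no
    candidate, so completeness extends to the next position.\<close>
  have reject: "found_good i j fo"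
    if "found_good i (Suc j) fo"
      "\<not> ?near1 1 \<or> \<not> ?near2 1"
    using that unfolding found_good_def by (metis Suc_lessI)
  have skip: "triple Q D split_next st2 4 (split_inv i r j) 0 (\<lambda>st'. found_inv i (Suc j) st \<longrightarrow> G \<longrightarrow> found_inv i j st')"
    if "agree 20 st2 st"
      "G \<Longrightarrow> \<not> ?near1 1 \<or> \<not> ?near2 1" for st2 G
  proof (rule runs_triple)
    show "runs Q D split_next st2 4 (st2(rA := nat_data j, rB := nat_data (s - j)))"
      by (rule runs_straightI) (use that(1) st' sj in \<open>simp_all add: split_next_def\<close>)
    show "split_inv i r j (st2(rA := nat_data j, rB := nat_data (s - j)))"
      unfolding split_inv_def using that(1) st' st fo(1,2) by auto
    show "found_inv i (Suc j) st \<longrightarrow> G \<longrightarrow> found_inv i j (st2(rA := nat_data j, rB := nat_data (s - j)))"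
      unfolding found_inv_def using fo reject that by (auto simp: found_inv_def)
  qed
  have found: "triple Q D (Assign rFound (PairE (Var rI) (PairE (Var rA) (Var rB))) ;; split_next) st2 6 (split_inv i r j) 0
      (\<lambda>st'. G \<longrightarrow> found_inv i j st')"
    if "agree 20 st2 st"
      "G \<Longrightarrow> ?near1 C \<and> ?near2 C" for st2 G
  proof (rule runs_triple)
    let ?fo = "Some (i, Suc j, s - Suc j)"
    let ?st = "st2(rFound := found_data ?fo, rA := nat_data j, rB := nat_data (s - j))"
    show "runs Q D (Assign rFound (PairE (Var rI) (PairE (Var rA) (Var rB))) ;; split_next) st2 6 ?st"
      by (rule runs_straightI) (use that(1) st' sj in \<open>simp_all add: split_next_def\<close>)
    have ok: "found_ok ?fo"
      using assms(2,3) st'(5) by (simp add: found_ok_def)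
    then show "split_inv i r j ?st"
      unfolding split_inv_def using that(1) st' st by (auto intro!: exI[of _ ?fo])
    show "G \<longrightarrow> found_inv i j ?st"
      unfolding found_inv_def using ok that(2) by (auto simp: found_good_def intro!: exI[of _ ?fo])
  qed
  have skip': "triple Q D c st 6 S 0 (\<lambda>st'. R2 \<longrightarrow> R1 \<longrightarrow> Y \<longrightarrow> X st')"
    if "triple Q D c st 4 S 0 (\<lambda>st'. Y \<longrightarrow> R2 \<longrightarrow> X st')" for c st S R1 R2 Y X
    using that by (rule triple_weaken) auto
  have found': "triple Q D c st 6 S 0 (\<lambda>st'. R2 \<longrightarrow> R1 \<longrightarrow> Y \<longrightarrow> X st')"
    if "triple Q D c st 6 S 0 (\<lambda>st'. R1 \<and> R2 \<longrightarrow> X st')" for c st S R1 R2 Y X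
    using that by (rule triple_weaken) auto
  have r1: "runs Q D (Assign tDigits (Snd (Var rDigits)) ;; Assign tSize (Var rA) ;;
      Assign tPath (PairE (PairE (Var rI) EmptyE) (Var rPath))) st 5 ?st1"
    by (rule runs_straightI) (use st \<tau>(3,7) st' acc(3) in \<open>simp_all add: sign_data_def bool_data_def\<close>)
  have "triple Q D (split_com N P) st (Suc (5 + Suc (test_cost + Suc (?t2))))
    (split_inv i r j) (test_fail + (test_fail + 0))
    (\<lambda>st'. ?G st')"
    unfolding split_com_def
  proof (rule runs_triple_Seq[OF r1], rule triple_Seq)
    show "triple Q D (test_com N P) ?st1 test_cost (\<lambda>st'. agree 23 st' ?st1) test_fail
      (\<lambda>st'. if st' tAcc \<noteq> Empty then ?near1 C
             else \<not> ?near1 1)"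
      by (rule triple_test_bounded[OF path'[of "-1"] acc(1,2)]) (use st \<tau> st' s in auto)
  next
    fix st2 assume fr: "agree 23 st2 ?st1"
    let ?R1 = "if st2 tAcc \<noteq> Empty then ?near1 C
      else \<not> ?near1 1"
    have fr20: "agree 20 st2 st" using fr by simp
    let ?second = "Assign tSize (Var rB) ;; Assign tPath (PairE (PairE (Var rI) TrueE) (Var rPath))"
    let ?fin = "com.If (Var tAcc)
          (Assign rFound (PairE (Var rI) (PairE (Var rA) (Var rB))) ;; split_next) split_next"
    show "triple Q D (com.If (Var tAcc) (?second ;; test_com N P ;; ?fin) split_next) st2
         (Suc (?t2))
         (split_inv i r j) (test_fail + 0) (\<lambda>st'. ?R1 \<longrightarrow> ?G st')"
    proof (rule triple_If, cases "st2 tAcc = Empty")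
      case True
      then have "triple Q D split_next st2 (?t2)
         (split_inv i r j) (test_fail + 0) (\<lambda>st'. ?R1 \<longrightarrow> ?G st')"
        by (intro triple_weaken[OF skip[OF fr20, of ?R1]]) auto
      then show "triple Q D (if expr_val (Var tAcc) st2 \<noteq> Empty then ?second ;; test_com N P ;; ?fin else split_next) st2
         (?t2)
         (split_inv i r j) (test_fail + 0) (\<lambda>st'. ?R1 \<longrightarrow> ?G st')"
        using True by simp
    next
      case False
      let ?st3 = "st2(tSize := nat_data (s - Suc j), tPath := path_data ((i, 1) # \<rho>))"
      have r2: "runs Q D ?second st2 3 ?st3"
        by (rule runs_straightI) (use fr20 st \<tau>(3) st' in \<open>simp_all add: sign_data_def bool_data_def\<close>)
      have "triple Q D (?second ;; test_com N P ;; ?fin) st2 (?t2)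
         (split_inv i r j) (test_fail + 0) (\<lambda>st'. ?R1 \<longrightarrow> ?G st')"
      proof (rule runs_triple_Seq[OF r2], rule triple_Seq)
        show "triple Q D (test_com N P) ?st3 test_cost (\<lambda>st'. agree 23 st' ?st3) test_fail
          (\<lambda>st'. if st' tAcc \<noteq> Empty then ?near2 C
                 else \<not> ?near2 1)"
          by (rule triple_test_bounded[OF path'[of 1] acc(1,2)]) (use fr st \<tau> st' s in auto)
      next
        fix st4 assume fr4: "agree 23 st4 ?st3"
        let ?R2 = "if st4 tAcc \<noteq> Empty then ?near2 C
          else \<not> ?near2 1"
        have fr420: "agree 20 st4 st" using fr20 fr4 by simp
        have "triple Q D (if expr_val (Var tAcc) st4 \<noteq> Empty
            then Assign rFound (PairE (Var rI) (PairE (Var rA) (Var rB))) ;; split_next else split_next) st4 6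
            (split_inv i r j) 0 (\<lambda>st'. ?R2 \<longrightarrow> ?R1 \<longrightarrow> ?G st')"
        proof (cases "st4 tAcc = Empty")
          case True
          have "triple Q D split_next st4 6
            (split_inv i r j) 0 (\<lambda>st'. ?R2 \<longrightarrow> ?R1 \<longrightarrow> ?G st')"
          proof (rule skip'[OF skip[OF fr420, of ?R2]])
            show "?R2 \<Longrightarrow> \<not> ?near1 1 \<or>
              \<not> ?near2 1"
              using True by simp
          qed
          then show ?thesis using True by simp
        next
          case F: False
          have "triple Q D (Assign rFound (PairE (Var rI) (PairE (Var rA) (Var rB))) ;; split_next) st4 6
            (split_inv i r j) 0 (\<lambda>st'. ?R2 \<longrightarrow> ?R1 \<longrightarrow> ?G st')"
          proof (rule found'[OF found[OF fr420, of "?R1 \<and> ?R2"]])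
            show "?R1 \<and> ?R2 \<Longrightarrow> ?near1 C \<and>
              ?near2 C"
              using F False by simp
          qed
          then show ?thesis using F by simp
        qed
        from triple_If[OF this] show "triple Q D ?fin st4 7 (split_inv i r j) 0
          (\<lambda>st'. ?R2 \<longrightarrow> ?R1 \<longrightarrow> ?G st')"
          by simp
      qed
      then show "triple Q D (if expr_val (Var tAcc) st2 \<noteq> Empty then ?second ;; test_com N P ;; ?fin else split_next) st2
         (?t2)
         (split_inv i r j) (test_fail + 0) (\<lambda>st'. ?R1 \<longrightarrow> ?G st')"
        using False by simp
    qed
  qed
  then show ?thesis
  proof (rule triple_weaken)
    show "test_fail + (test_fail + 0) \<le> 2 * test_fail"
      by (simp add: mult_2)
  qed (assumption | simp)+
qed

end

context learner_node
begin

text \<open>\<open>j\<close> counts the variables still to be tried, since \<open>triple_for\<close>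
  counts down; the current one is \<open>n - j\<close>.\<close>

definition search_inv :: "nat \<Rightarrow> store \<Rightarrow> bool" where
  "search_inv j st \<longleftrightarrow> agree 10 st \<tau> \<and> st rI = nat_data (n - j) \<and>
     st rRest = flags_data (fst ` set \<rho>) (n - j) j \<and> j \<le> n \<and>
     (\<exists>fo. st rFound = found_data fo \<and> found_ok fo)"

lemma found_inv_mono:
  assumes "found_inv i j st" "st' rFound = st rFound"
    and "\<And>i' a. i' \<notin> fst ` set \<rho> \<Longrightarrow> 1 \<le> a \<Longrightarrow> a < s \<Longrightarrow> i' < i2 \<or> i' = i2 \<and> j2 < a \<Longrightarrow> i' < i \<or> i' = i \<and> j < a"
  shows "found_inv i2 j2 st'"
  using assms unfolding found_inv_def found_good_def by metis

lemma triple_search_var: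
  assumes "e \<ge> 1" and inv: "search_inv (Suc j) st"
  shows "triple Q D (search_var_com N P) st (s0 * (2 * test_cost + 31) + 20) (search_inv j)
    (of_nat s0 * (2 * test_fail)) (\<lambda>st'. found_inv (n - Suc j) s st \<longrightarrow> found_inv (n - j) s st')"
proof -
  define i where "i = n - Suc j"
  let ?U = "fst ` set \<rho>"
  have i: "i < n" "n - j = Suc i" "j \<le> n"
    using inv by (auto simp: i_def search_inv_def)
  define r where "r = flags_data ?U i (Suc j)"
  have st: "\<And>v. v < 10 \<Longrightarrow> st v = \<tau> v" "st rI = nat_data i" "st rRest = r" "\<exists>fo. st rFound = found_data fo \<and> found_ok fo"
    using inv by (simp_all add: search_inv_def i_def r_def)
  have final: "runs Q D search_next st' 3 (st'(rRest := flags_data ?U (Suc i) j, rI := nat_data (Suc i)))"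
    and final_inv: "search_inv j (st'(rRest := flags_data ?U (Suc i) j, rI := nat_data (Suc i)))"
    if "agree 10 st' \<tau>" "st' rI = nat_data i" "st' rRest = r" "\<exists>fo. st' rFound = found_data fo \<and> found_ok fo" for st'
  proof -
    show "runs Q D search_next st' 3 (st'(rRest := flags_data ?U (Suc i) j, rI := nat_data (Suc i)))"
      by (rule runs_straightI) (simp_all add: search_next_def that r_def)
    show "search_inv j (st'(rRest := flags_data ?U (Suc i) j, rI := nat_data (Suc i)))"
      using that(1,4) i by (simp add: search_inv_def)
  qed
  show ?thesis
  proof (cases "i \<in> ?U")
    case True
    have "triple Q D search_next st 3 (search_inv j) 0 (\<lambda>st'. found_inv i s st \<longrightarrow> found_inv (Suc i) s st')"
    proof (rule runs_triple[OF final])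
      show "found_inv i s st \<longrightarrow> found_inv (Suc i) s (st(rRest := flags_data ?U (Suc i) j, rI := nat_data (Suc i)))"
      proof
        assume "found_inv i s st"
        then show "found_inv (Suc i) s (st(rRest := flags_data ?U (Suc i) j, rI := nat_data (Suc i)))"
        proof (rule found_inv_mono)
          show "i' < i \<or> i' = i \<and> s < a"
            if "i' \<notin> ?U" "a < s" "i' < Suc i \<or> i' = Suc i \<and> s < a" for i' a
            using that True by (metis less_Suc_eq not_less_iff_gr_or_eq)
        qed simp
      qed
    qed (use st final_inv[of st] in simp_all)
    then have "triple Q D (search_var_com N P) st 4 (search_inv j) 0 (\<lambda>st'. found_inv i s st \<longrightarrow> found_inv (Suc i) s st')"
      unfolding search_var_com_def using triple_If[where t = 3] True st(3) by (simp add: r_def bool_data_def)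
    then show ?thesis
      unfolding i(2) i_def[symmetric] by (rule triple_weaken) simp_all
  next
    case False
    let ?pre = "Assign rA (Snd (Var rSize)) ;; Assign rB TrueE"
    let ?st1 = "st(rA := nat_data (s - 1), rB := nat_data 1)"
    have r1: "runs Q D ?pre st 3 ?st1"
      by (rule runs_straightI) (simp_all add: st(1) \<tau>(5) snd_data_nat_data)
    have start: "split_inv i r (s - 1) ?st1"
      using st s by (auto simp: split_inv_def)
    have t1: "triple Q D (While (Var rA) (split_com N P)) ?st1 ((s - 1) * (2 * test_cost + 30 + 1) + 1) (split_inv i r 0)
        (of_nat (s - 1) * (2 * test_fail)) (\<lambda>st'. found_inv i (s - 1) ?st1 \<longrightarrow> found_inv i 0 st')"
    proof (rule triple_for[where G = "found_inv i" and I = "split_inv i r"])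
      show "expr_val (Var rA) st' \<noteq> Empty \<longleftrightarrow> j' > 0" if "split_inv i r j' st'" for j' st'
        using that by (simp add: split_inv_def)
    qed (rule triple_split[OF assms(1) i(1) False] start; assumption?)+
    have "triple Q D (?pre ;; While (Var rA) (split_com N P) ;; search_next) st
      (Suc (3 + Suc (((s - 1) * (2 * test_cost + 30 + 1) + 1) + 3))) (search_inv j)
      (of_nat (s - 1) * (2 * test_fail) + 0) (\<lambda>st'. found_inv i s st \<longrightarrow> found_inv (Suc i) s st')"
    proof (rule runs_triple_Seq[OF r1], rule triple_Seq[OF t1])
      fix st2 assume inv2: "split_inv i r 0 st2"
      \<comment> \<open>Moving from \<open>(i, s)\<close> to \<open>(i, s - 1)\<close>, and from
        \<open>(i, 0)\<close> to \<open>(Suc i, s)\<close>, passes no size between 1 and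
        \<open>s - 1\<close>, so the position may be renamed at both ends of the loop.\<close>
      have a: "found_inv i (s - 1) ?st1" if "found_inv i s st"
        using that by (rule found_inv_mono) auto
      have b: "found_inv (Suc i) s (st2(rRest := flags_data ?U (Suc i) j, rI := nat_data (Suc i)))" if "found_inv i 0 st2"
        using that by (rule found_inv_mono) auto
      show "triple Q D search_next st2 3 (search_inv j) 0
        (\<lambda>st'. (found_inv i (s - 1) ?st1 \<longrightarrow> found_inv i 0 st2) \<longrightarrow> found_inv i s st \<longrightarrow> found_inv (Suc i) s st')"
      proof (rule runs_triple[OF final])
        show "(found_inv i (s - 1) ?st1 \<longrightarrow> found_inv i 0 st2) \<longrightarrow> found_inv i s st \<longrightarrow>
            found_inv (Suc i) s (st2(rRest := flags_data ?U (Suc i) j, rI := nat_data (Suc i)))"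
          using a b by blast
      qed (use inv2 final_inv[of st2] in \<open>simp_all add: split_inv_def\<close>)
    qed
    note triple = this
    have unused: "\<not> expr_val (Fst (Var rRest)) st \<noteq> Empty"
      using False st(3) by (simp add: r_def bool_data_def)
    have "triple Q D (search_var_com N P) st
      (Suc (Suc (3 + Suc (((s - 1) * (2 * test_cost + 30 + 1) + 1) + 3)))) (search_inv j)
      (of_nat (s - 1) * (2 * test_fail) + 0) (\<lambda>st'. found_inv i s st \<longrightarrow> found_inv (Suc i) s st')"
      unfolding search_var_com_def by (rule triple_If, subst if_not_P[OF unused], rule triple)
    then show ?thesis
      unfolding i(2) i_def[symmetric]
    proof (rule triple_weaken)
      have thirty: "2 * test_cost + 30 + 1 = 2 * test_cost + 31" by simp
      have "(s - 1) * (2 * test_cost + 31) \<le> s0 * (2 * test_cost + 31)"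
        using s by (intro mult_right_mono) auto
      then show "Suc (Suc (3 + Suc (((s - 1) * (2 * test_cost + 30 + 1) + 1) + 3))) \<le> s0 * (2 * test_cost + 31) + 20"
        unfolding thirty by linarith
      have "(of_nat (s - 1) :: ennreal) \<le> of_nat s0"
        using s by (intro of_nat_mono) simp
      then show "of_nat (s - 1) * (2 * test_fail) + 0 \<le> of_nat s0 * (2 * test_fail)"
        by (simp add: mult_right_mono)
    qed assumption
  qed
qed

definition search_cost :: nat where
  "search_cost = n * (s0 * (2 * test_cost + 31) + 21) + 20"

definition search_fail :: ennreal where
  "search_fail = of_nat n * (of_nat s0 * (2 * test_fail))"

lemma triple_search:
  assumes "agree 10 st \<tau>"
  shows "triple Q D (search_com N P) st search_cost
    (\<lambda>st'. agree 10 st' \<tau> \<and> (\<exists>fo. st' rFound = found_data fo \<and> found_ok fo \<and> (e = 0 \<longrightarrow> fo = None)))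
    search_fail
    (\<lambda>st'. e \<ge> 1 \<longrightarrow> found_inv n s st')"
proof -
  let ?S = "\<lambda>st'. agree 10 st' \<tau> \<and> (\<exists>fo. st' rFound = found_data fo \<and> found_ok fo \<and> (e = 0 \<longrightarrow> fo = None))"
  let ?R = "\<lambda>st'. e \<ge> 1 \<longrightarrow> found_inv n s st'"
  let ?st1 = "st(rFound := Empty)"
  have r1: "runs Q D (Assign rFound EmptyE) st 1 ?st1"
    by (rule runs_straightI) simp_all
  have ok: "found_ok None" by (simp add: found_ok_def)
  show ?thesis
  proof (cases "e = 0")
    case True
    have "triple Q D Skip ?st1 1 ?S 0 ?R"
      by (rule runs_triple[OF runs_Skip]) (use True assms ok in \<open>auto intro!: exI[of _ None]\<close>)
    then have "triple Q D (search_com N P) st (Suc (1 + Suc 1)) ?S 0 ?R"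
      unfolding search_com_def using assms True \<tau>(6)
      by (intro runs_triple_Seq[OF r1] triple_If) simp
    then show ?thesis by (rule triple_weaken) (auto simp: search_cost_def)
  next
    case False
    let ?pre = "Assign rRest (Var rFlags) ;; Assign rI EmptyE"
    let ?st2 = "?st1(rRest := flags_data (fst ` set \<rho>) 0 n, rI := Empty)"
    have r2: "runs Q D ?pre ?st1 3 ?st2"
      by (rule runs_straightI) (simp_all add: assms \<tau>(4))
    have inv: "search_inv n ?st2"
      using assms ok by (auto simp: search_inv_def intro!: exI[of _ None])
    have "found_good 0 s None"
      by (simp add: found_good_def)
    then have start: "found_inv 0 s ?st2"
      using ok unfolding found_inv_def by (intro exI[of _ None]) simp
    have "triple Q D (While (Var rRest) (search_var_com N P)) ?st2 (n * (s0 * (2 * test_cost + 31) + 20 + 1) + 1)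
      (search_inv 0) (of_nat n * (of_nat s0 * (2 * test_fail))) (\<lambda>st'. found_inv (n - n) s ?st2 \<longrightarrow> found_inv (n - 0) s st')"
    proof (rule triple_for[where G = "\<lambda>j. found_inv (n - j) s" and I = search_inv])
      show "expr_val (Var rRest) st \<noteq> Empty \<longleftrightarrow> k > 0" if "search_inv k st" for k st
        using that by (cases k) (auto simp: search_inv_def)
    qed (use triple_search_var False inv in simp_all)
    then have "triple Q D (While (Var rRest) (search_var_com N P)) ?st2 (n * (s0 * (2 * test_cost + 31) + 20 + 1) + 1)
      ?S search_fail ?R"
      by (rule triple_weaken) (use start False in \<open>auto simp: search_inv_def search_fail_def\<close>)
    from runs_triple_Seq[OF r2 this]
    have "triple Q D (search_com N P) st (Suc (1 + Suc (Suc (3 + (n * (s0 * (2 * test_cost + 31) + 20 + 1) + 1))))) ?S search_fail ?R"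
      unfolding search_com_def using assms False \<tau>(6)
      by (intro runs_triple_Seq[OF r1] triple_If) simp
    then show ?thesis by (rule triple_weaken) (auto simp: search_cost_def algebra_simps)
  qed
qed

end

section \<open>Random leaves\<close>

definition random_com :: com where
  "random_com =
     While (Var rI)
       (Coin rX ;; Assign uPoint (PairE (Var rX) (Var uPoint)) ;; Assign rI (Snd (Var rI)))"

definition leaf_com :: com where
  "leaf_com =
     (Assign uPoint EmptyE ;; Assign rI (Var rN)) ;; random_com ;; Assign uPath (Var rPath) ;;
     restrict_com ;; Query rX (Var uPoint) ;;
     Assign rOut (PairE (PairE EmptyE (Var rX)) (Var rOut))"

primrec point_data :: "int list \<Rightarrow> data \<Rightarrow> data" where
  "point_data [] w = w"
| "point_data (b # x) w = Pair (sign_data b) (point_data x w)"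

lemma point_data_snoc: "point_data (x @ [b]) w = point_data x (Pair (sign_data b) w)"
  by (induction x) auto

lemma data_point_point_data: "x \<in> cube n \<Longrightarrow> data_point n (point_data x w) = x"
proof (induction n arbitrary: x)
  case (Suc n)
  then show ?case by (cases x) (auto simp: cube_def data_sign_sign_data)
qed (simp add: cube_def)

text \<open>Split at the last coordinate because \<open>random_com\<close> pushes each new
  coordinate in front: the first toss decides the last coordinate.\<close>

lemma sum_cube_Suc:
  fixes H :: "int list \<Rightarrow> ennreal"
  shows "(\<Sum>x \<in> cube (Suc k). H x) = (\<Sum>x \<in> cube k. H (x @ [1])) + (\<Sum>x \<in> cube k. H (x @ [-1]))"
proof -
  have "cube (Suc k) = (\<lambda>x. x @ [1]) ` cube k \<union> (\<lambda>x. x @ [-1]) ` cube k" (is "_ = ?A \<union> ?B")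
  proof (intro set_eqI iffI)
    fix x assume x: "x \<in> cube (Suc k)"
    then obtain y b where "x = y @ [b]" by (cases x rule: rev_cases) (auto simp: cube_def)
    then show "x \<in> ?A \<union> ?B" using x by (auto simp: cube_def)
  qed (auto simp: cube_def)
  then show ?thesis
    by (subst \<open>cube (Suc k) = _\<close>, subst sum.union_disjoint) (auto simp: sum.reindex inj_on_def)
qed

lemma wpn_random:
  assumes "\<And>x st'. x \<in> cube k \<Longrightarrow> st' uPoint = point_data x (st uPoint) \<Longrightarrow>
      \<forall>v. v \<notin> {uPoint, rX, rI} \<longrightarrow> st' v = st v \<Longrightarrow> wpn Q D T cs F st' \<le> H x"
    and "st rI = nat_data k"
  shows "wpn Q D (k * 6 + 1 + T) (random_com # cs) F st \<le> (\<Sum>x \<in> cube k. H x) / 2 ^ k"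
  using assms
proof (induction k arbitrary: st H)
  case 0
  have "cube 0 = {[]}" by (auto simp: cube_def)
  then show ?case using 0(1)[of "[]" st] 0(2) by (simp add: random_com_def divide_ennreal_def)
next
  case (Suc k)
  let ?st = "\<lambda>b. st(rX := sign_data b, uPoint := Pair (sign_data b) (st uPoint), rI := nat_data k)"
  have IH: "wpn Q D (k * 6 + 1 + T) (random_com # cs) F (?st b) \<le> (\<Sum>x \<in> cube k. H (x @ [b])) / 2 ^ k"
    if b: "b \<in> {-1, 1}" for b
  proof (rule Suc.IH)
    fix x st' assume x: "x \<in> cube k" "st' uPoint = point_data x (?st b uPoint)"
      "\<forall>v. v \<notin> {uPoint, rX, rI} \<longrightarrow> st' v = ?st b v"
    show "wpn Q D T cs F st' \<le> H (x @ [b])"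
    proof (rule Suc.prems(1))
      show "x @ [b] \<in> cube (Suc k)" using x(1) b by (auto simp: cube_def)
      show "st' uPoint = point_data (x @ [b]) (st uPoint)" using x(2) by (simp add: point_data_snoc)
      show "\<forall>v. v \<notin> {uPoint, rX, rI} \<longrightarrow> st' v = st v" using x(3) by auto
    qed
  qed simp
  have "wpn Q D (Suc k * 6 + 1 + T) (random_com # cs) F st =
    (wpn Q D (k * 6 + 1 + T) (random_com # cs) F (?st 1) + wpn Q D (k * 6 + 1 + T) (random_com # cs) F (?st (-1))) / 2"
    using Suc.prems(2) by (simp add: random_com_def numeral_eq_Suc sign_data_def fun_upd_def)
  also have "\<dots> \<le> ((\<Sum>x \<in> cube k. H (x @ [1])) / 2 ^ k + (\<Sum>x \<in> cube k. H (x @ [-1])) / 2 ^ k) / 2"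
    by (intro divide_right_mono_ennreal add_mono IH) auto
  also have "\<dots> = (\<Sum>x \<in> cube (Suc k). H x) / 2 ^ Suc k"
    unfolding divide_ennreal_def ennreal_inverse_power sum_cube_Suc by (simp add: algebra_simps)
  finally show ?case .
qed

lemma ennreal_cube_prob:
  "(\<Sum>x \<in> cube n. if P x then 1 else 0 :: ennreal) / 2 ^ n = ennreal (cube_prob n P)"
proof -
  have Int: "cube n \<inter> {x. P x} = {x \<in> cube n. P x}" by auto
  have "(\<Sum>x \<in> cube n. if P x then 1 else 0 :: ennreal) = of_nat (card {x \<in> cube n. P x})"
    by (simp add: sum.If_cases Int)
  also have "\<dots> = ennreal (real (card {x \<in> cube n. P x}))"
    by (simp add: ennreal_of_nat_eq_real_of_nat)
  finally show ?thesis
    by (simp add: cube_prob_def divide_ennreal ennreal_power flip: ennreal_numeral)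
qed

text \<open>The label is the value of \<open>g\<close> at a uniform point of the subcube, so it
  falls into \<open>Bad\<close> exactly with the mass of \<open>Bad\<close>. Which labels are bad is
  decided by the caller.\<close>

lemma triple_leaf:
  assumes "g \<in> bool_funs n" "path_ok n \<rho>" "st rPath = path_data \<rho>" "st rN = nat_data n"
  shows "triple (query_oracle n g) D leaf_com st (n * 6 + length \<rho> * (10 * n + 20) + 20)
    (\<lambda>st'. agree 4 st' st \<and> (\<exists>b \<in> {-1, 1}. st' rOut = Pair (dtree_data (Leaf b)) (st rOut)))
    (ennreal (cube_prob n (\<lambda>x. g (restrict_point \<rho> x) \<in> Bad)))
    (\<lambda>st'. \<exists>b \<in> {-1, 1} - Bad. st' rOut = Pair (dtree_data (Leaf b)) (st rOut))"
proof -
  let ?Q = "query_oracle n g"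
  let ?S = "\<lambda>st'. agree 4 st' st \<and> (\<exists>b \<in> {-1, 1}. st' rOut = Pair (dtree_data (Leaf b)) (st rOut))"
  let ?R = "\<lambda>st'. \<exists>b \<in> {-1, 1} - Bad. st' rOut = Pair (dtree_data (Leaf b)) (st rOut)"
  let ?F = "outcome ?S ?R"
  let ?ask = "Assign uPath (Var rPath) ;; restrict_com ;; Query rX (Var uPoint) ;;
     Assign rOut (PairE (PairE EmptyE (Var rX)) (Var rOut))"
  let ?st1 = "st(uPoint := Empty, rI := nat_data n)"
  let ?t = "length \<rho> * (10 * n + 20) + 10"
  have ask: "wpn ?Q D ?t [?ask] ?F st2 \<le> (if g (restrict_point \<rho> x) \<in> Bad then 1 else 0)"
    if x: "x \<in> cube n" "st2 uPoint = point_data x (?st1 uPoint)"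
      and fr: "\<forall>v. v \<notin> {uPoint, rX, rI} \<longrightarrow> st2 v = ?st1 v" for x st2
  proof -
    let ?b = "g (restrict_point \<rho> x)"
    let ?st3 = "st2(uPath := path_data \<rho>)"
    have "?st3 uPath = path_data \<rho>" by simp
    from runs_restrict[where Q = ?Q and D = D, OF assms(2), of ?st3, OF this] obtain st4 where
      st4: "runs ?Q D restrict_com ?st3 (length \<rho> * (10 * n + 20) + 1) st4"
        "st4 uPoint = restrict_data \<rho> (?st3 uPoint)"
        "\<forall>v. v \<notin> {uPoint, uPath, uI, uBit, uAcc} \<longrightarrow> st4 v = ?st3 v" by blast
    let ?st5 = "st4(rX := bool_data (?Q (st4 uPoint)))"
    let ?st6 = "?st5(rOut := Pair (Pair Empty (?st5 rX)) (?st5 rOut))"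
    have "runs ?Q D ?ask st2 ?t ?st6"
      apply (rule runs_weaken)
       apply (rule runs_Seq[OF runs_straightI[where t = 1 and st' = ?st3]])
          apply (use fr assms(3) in simp_all)[3]
       apply (rule runs_Seq[OF st4(1)])
       apply (rule runs_Seq[OF runs_Query[where e = "Var uPoint", unfolded expr_val.simps]])
       apply (rule runs_straightI[where t = 1])
         apply simp_all
      done
    then have "wpn ?Q D (?t + 0) [?ask] ?F st2 \<le> wpn ?Q D 0 [] ?F ?st6"
      by (rule runsD)
    moreover have "?b \<in> {-1, 1}"
      using assms(1) restrict_point_cube[OF assms(2) x(1)] by (auto simp: bool_funs_def)
    moreover have "?Q (st4 uPoint) \<longleftrightarrow> ?b = 1"
      using x by (simp add: query_oracle_def st4(2) data_point_restrict[OF assms(2)] data_point_point_data)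
    then have "?st6 rOut = Pair (dtree_data (Leaf ?b)) (st rOut)"
      using fr st4(3) by (simp add: sign_data_def)
    moreover have "agree 4 ?st6 st"
      using fr st4(3) by simp
    ultimately show ?thesis by (auto split: if_splits)
  qed
  have "wpn ?Q D (n * 6 + length \<rho> * (10 * n + 20) + 20) [leaf_com] ?F st \<le>
    wpn ?Q D (1 + (3 + (1 + (n * 6 + 1 + ?t)))) [leaf_com] ?F st"
    by (rule wpn_antimono) simp
  also have "\<dots> = wpn ?Q D (3 + (1 + (n * 6 + 1 + ?t))) [Assign uPoint EmptyE ;; Assign rI (Var rN), random_com ;; ?ask] ?F st"
    unfolding leaf_com_def by (simp only: plus_1_eq_Suc wpn.simps)
  also have "\<dots> \<le> wpn ?Q D (1 + (n * 6 + 1 + ?t)) [random_com ;; ?ask] ?F ?st1"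
    by (rule runsD, rule runs_straightI) (simp_all add: assms)
  also have "\<dots> = wpn ?Q D (n * 6 + 1 + ?t) [random_com, ?ask] ?F ?st1"
    by (simp only: plus_1_eq_Suc wpn.simps)
  also have "\<dots> \<le> (\<Sum>x \<in> cube n. if g (restrict_point \<rho> x) \<in> Bad then 1 else 0) / 2 ^ n"
    by (rule wpn_random[OF ask]) simp_all
  also have "\<dots> = ennreal (cube_prob n (\<lambda>x. g (restrict_point \<rho> x) \<in> Bad))"
    by (rule ennreal_cube_prob)
  finally show ?thesis unfolding triple_def .
qed

section \<open>Expanding a node\<close>

text \<open>
  The stack holds two kinds of tasks: expanding a node, and joining the two topmost trees of
  \<open>rOut\<close> below a variable. The accuracy \<open>2^-(B + c * e)\<close> at remaining depth \<open>e\<close> leaves \<open>2^-B\<close> for \<open>e = 0\<close>.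
\<close>

definition node_data :: "nat \<Rightarrow> nat \<Rightarrow> nat \<Rightarrow> (nat \<times> int) list \<Rightarrow> nat \<Rightarrow> nat \<Rightarrow> data" where
  "node_data n B c \<rho> s e =
     Pair Empty (Pair (path_data \<rho>) (Pair (flags_data (fst ` set \<rho>) 0 n)
       (Pair (nat_data s) (Pair (nat_data e) (digits_data (B + c * e))))))"

definition combine_data :: "nat \<Rightarrow> data" where
  "combine_data i = Pair (Pair Empty Empty) (nat_data i)"

definition node_expr :: "expr \<Rightarrow> expr \<Rightarrow> expr" where
  "node_expr b s =
     PairE EmptyE (PairE (PairE (PairE (Fst (Var rFound)) b) (Var rPath)) (PairE (Var uPoint)
       (PairE s (PairE (Var rDepth) (Var rDigits)))))"

text \<open>The flags are put into \<open>uPoint\<close> because \<open>update_com\<close> works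
  there; both children share the result. Dropping \<open>c\<close> digits multiplies the accuracy by
  \<open>2 ^ c\<close>.\<close>

definition branch_com :: "nat \<Rightarrow> com" where
  "branch_com c =
     (Assign uPoint (Var rFlags) ;; Assign uI (Fst (Var rFound)) ;; Assign uBit TrueE) ;;
     update_com ;;
     Assign rDepth (Snd (Var rDepth)) ;; Assign rDigits ((Snd ^^ c) (Var rDigits)) ;;
     Assign rStack
       (PairE (node_expr EmptyE (Fst (Snd (Var rFound))))
         (PairE (node_expr TrueE (Snd (Snd (Var rFound))))
           (PairE (PairE TrueE (Fst (Var rFound))) (Var rStack))))"

definition expand_com :: "nat \<Rightarrow> com \<Rightarrow> nat \<Rightarrow> com" where
  "expand_com N P c = search_com N P ;; If (Var rFound) (branch_com c) leaf_com"

definition unpack_com :: com where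
  "unpack_com =
     Assign rX (Snd (Var rX)) ;;
     Assign rPath (Fst (Var rX)) ;; Assign rX (Snd (Var rX)) ;;
     Assign rFlags (Fst (Var rX)) ;; Assign rX (Snd (Var rX)) ;;
     Assign rSize (Fst (Var rX)) ;; Assign rX (Snd (Var rX)) ;;
     Assign rDepth (Fst (Var rX)) ;; Assign rDigits (Snd (Var rX))"

text \<open>The left child is expanded first, so its tree lies below the right one on
  \<open>rOut\<close>.\<close>

definition combine_com :: com where
  "combine_com =
     Assign rOut (PairE (PairE TrueE (PairE (Snd (Var rX)) (PairE (Fst (Snd (Var rOut))) (Fst (Var rOut)))))
       (Snd (Snd (Var rOut))))"

definition main_body :: "nat \<Rightarrow> com \<Rightarrow> nat \<Rightarrow> com" where
  "main_body N P c =
     (Assign rX (Fst (Var rStack)) ;; Assign rStack (Snd (Var rStack))) ;;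
     If (Fst (Var rX)) combine_com (unpack_com ;; expand_com N P c)"

definition main_com :: "nat \<Rightarrow> com \<Rightarrow> nat \<Rightarrow> com" where
  "main_com N P c = While (Var rStack) (main_body N P c)"

lemma expr_val_Snd_power: "expr_val ((Snd ^^ c) e) st = (snd_data ^^ c) (expr_val e st)"
  by (induction c) auto

lemma snd_data_power_digits: "(snd_data ^^ c) (digits_data (c + m)) = digits_data m"
  by (induction c) (simp_all del: funpow.simps add: funpow_Suc_right)

lemma found_data_None: "found_data fo = Empty \<longleftrightarrow> fo = None"
  by (cases fo) auto

locale learner_main = learner +
  assumes g: "g \<in> bool_funs n"
begin

definition children_pushed :: "(nat \<times> int) list \<Rightarrow> nat \<Rightarrow> nat \<Rightarrow> data \<Rightarrow> data \<Rightarrow> nat \<Rightarrow> nat \<Rightarrow> nat \<Rightarrow> store \<Rightarrow> bool" where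
  "children_pushed \<rho> s e stk out i a b st \<longleftrightarrow>
     e \<ge> 1 \<and> i < n \<and> i \<notin> fst ` set \<rho> \<and> 1 \<le> a \<and> 1 \<le> b \<and> a + b = s \<and> st rOut = out \<and>
     st rStack = Pair (node_data n B c ((i, -1) # \<rho>) a (e - 1))
       (Pair (node_data n B c ((i, 1) # \<rho>) b (e - 1)) (Pair (combine_data i) stk))"

definition leaf_pushed :: "data \<Rightarrow> data \<Rightarrow> int \<Rightarrow> store \<Rightarrow> bool" where
  "leaf_pushed stk out v st \<longleftrightarrow> v \<in> {-1, 1} \<and> st rStack = stk \<and> st rOut = Pair (dtree_data (Leaf v)) out"

text \<open>
  The first summand pays for the nodes cut off below, the second for the error of sampled leaves.
\<close>

definition good_error :: "(nat \<times> int) list \<Rightarrow> nat \<Rightarrow> nat \<Rightarrow> dtree \<Rightarrow> bool" where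
  "good_error \<rho> s e T \<longleftrightarrow> path_error n g \<rho> T \<le> real s / 2 ^ e + 1 / 2 ^ B"

definition expand_safe :: "(nat \<times> int) list \<Rightarrow> nat \<Rightarrow> nat \<Rightarrow> data \<Rightarrow> data \<Rightarrow> store \<Rightarrow> bool" where
  "expand_safe \<rho> s e stk out st \<longleftrightarrow> st rN = nat_data n \<and> st rK = nat_data k \<and>
     ((\<exists>i a b. children_pushed \<rho> s e stk out i a b st) \<or> (\<exists>v. leaf_pushed stk out v st))"

text \<open>Conditional on the node being close to a tree of its size: if an earlier step has
  failed, the failure is already paid for and nothing is promised.\<close>

definition expand_good :: "(nat \<times> int) list \<Rightarrow> nat \<Rightarrow> nat \<Rightarrow> data \<Rightarrow> data \<Rightarrow> store \<Rightarrow> bool" where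
  "expand_good \<rho> s e stk out st \<longleftrightarrow> (near s (1 / 2 ^ (B + c * e)) \<rho> \<longrightarrow>
     ((\<exists>i a b. children_pushed \<rho> s e stk out i a b st \<and>
         near a (1 / 2 ^ (B + c * (e - 1))) ((i, -1) # \<rho>) \<and>
         near b (1 / 2 ^ (B + c * (e - 1))) ((i, 1) # \<rho>)) \<or>
      (\<exists>v. leaf_pushed stk out v st \<and> good_error \<rho> s e (Leaf v))))"

definition expand_cost :: nat where
  "expand_cost = n * (s0 * (2 * test_cost + 31) + 21) + 20 + (16 * n + B * (10 * n + 20) + 60)"

text \<open>Two tests for each variable and each size, and one random sample.\<close>

definition node_fail :: ennreal where
  "node_fail = of_nat n * (of_nat s0 * (2 * test_fail)) + ennreal (1 / 2 ^ B)"

lemma runs_branch: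
  assumes "path_ok n \<rho>" and e: "e \<ge> 1" and fo: "st rFound = found_data (Some (i, a, b))" "i < n" "i \<notin> fst ` set \<rho>"
      "1 \<le> a" "1 \<le> b" "a + b = s"
    and st: "st rPath = path_data \<rho>" "st rFlags = flags_data (fst ` set \<rho>) 0 n" "st rDepth = nat_data e"
      "st rDigits = digits_data (B + c * e)" "st rStack = stk" "st rOut = out"
  shows "\<exists>st'. runs Q D (branch_com c) st (10 * n + 30) st' \<and> children_pushed \<rho> s e stk out i a b st' \<and> (agree 3 st' st)"
proof -
  let ?st1 = "st(uPoint := flags_data (fst ` set \<rho>) 0 n, uI := nat_data i, uBit := bool_data True)"
  let ?st2 = "?st1(uPoint := data_update i (?st1 uBit) (?st1 uPoint), uI := Empty, uAcc := Empty)"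
  let ?fl = "flags_data (insert i (fst ` set \<rho>)) 0 n"
  have fl: "data_update i (bool_data True) (flags_data (fst ` set \<rho>) 0 n) = ?fl"
    using data_update_flags[OF fo(2), of "fst ` set \<rho>" 0] by simp
  have "c * e = c + c * (e - 1)" using e by (cases e) auto
  then have dig: "(snd_data ^^ c) (digits_data (B + c * e)) = digits_data (B + c * (e - 1))"
    using snd_data_power_digits[of c "B + c * (e - 1)"] by (simp add: add.left_commute)
  let ?stack = "Pair (node_data n B c ((i, -1) # \<rho>) a (e - 1))
       (Pair (node_data n B c ((i, 1) # \<rho>) b (e - 1)) (Pair (combine_data i) stk))"
  let ?st3 = "?st2(rDepth := nat_data (e - 1), rDigits := digits_data (B + c * (e - 1)), rStack := ?stack)"
  have "runs Q D (branch_com c) st (Suc (5 + Suc (10 * i + 8 + 5))) ?st3"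
    unfolding branch_com_def
  proof (rule runs_Seq[OF runs_straightI runs_Seq[OF runs_update runs_straightI]])
    show "straight_store (Assign uPoint (Var rFlags) ;; Assign uI (Fst (Var rFound)) ;; Assign uBit TrueE) st = ?st1"
      using st fo(1) by (simp add: bool_data_def)
    show "straight_store (Assign rDepth (Snd (Var rDepth)) ;; Assign rDigits ((Snd ^^ c) (Var rDigits)) ;;
     Assign rStack
       (PairE (node_expr EmptyE (Fst (Snd (Var rFound))))
         (PairE (node_expr TrueE (Snd (Snd (Var rFound))))
           (PairE (PairE TrueE (Fst (Var rFound))) (Var rStack))))) ?st2 = ?st3"
      using st fo(1)
      by (simp add: expr_val_Snd_power snd_data_nat_data dig fl node_expr_def node_data_def combine_data_def
          sign_data_def bool_data_def fl[unfolded bool_data_def, simplified])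
  qed simp_all
  then have "runs Q D (branch_com c) st (10 * n + 30) ?st3"
    by (rule runs_weaken) (use fo(2) in simp)
  moreover have "children_pushed \<rho> s e stk out i a b ?st3"
    using e fo(2-6) st(6) by (simp add: children_pushed_def)
  ultimately show ?thesis by (intro exI[of _ ?st3]) simp
qed

lemma path_error_le_1: "path_error n g \<rho> T \<le> 1"
  unfolding path_error_def by (rule cube_prob_le_1)

lemma triple_expand:
  assumes path: "path_ok n \<rho>" "length \<rho> + e \<le> B" and s: "1 \<le> s" "s \<le> s0"
    and \<tau>: "\<tau> rN = nat_data n" "\<tau> rK = nat_data k" "\<tau> rPath = path_data \<rho>"
      "\<tau> rFlags = flags_data (fst ` set \<rho>) 0 n" "\<tau> rSize = nat_data s" "\<tau> rDepth = nat_data e"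
      "\<tau> rDigits = digits_data (B + c * e)" "\<tau> rStack = stk" "\<tau> rOut = out"
  shows "triple Q D (expand_com N P c) \<tau> expand_cost (expand_safe \<rho> s e stk out) node_fail
     (expand_good \<rho> s e stk out)"
proof -
  interpret node: learner_node n g D P N tb k c B s0 p l C \<rho> s e \<tau>
    using path s \<tau> by unfold_locales auto
  let ?safe = "expand_safe \<rho> s e stk out" and ?good = "expand_good \<rho> s e stk out"
  let ?U = "fst ` set \<rho>"
  let ?t = "16 * n + B * (10 * n + 20) + 50"
  have triple: "triple Q D (com.If (Var rFound) (branch_com c) leaf_com) st (Suc ?t) ?safe (ennreal (1 / 2 ^ B))
     (\<lambda>st'. (e \<ge> 1 \<longrightarrow> node.found_inv n s st) \<longrightarrow> ?good st')"
    if fr: "agree 10 st \<tau>" and fo: "st rFound = found_data fo" "node.found_ok fo" "e = 0 \<longrightarrow> fo = None" for st fo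
  proof (rule triple_If)
    show "triple Q D (if expr_val (Var rFound) st \<noteq> Empty then branch_com c else leaf_com) st ?t ?safe
       (ennreal (1 / 2 ^ B)) (\<lambda>st'. (e \<ge> 1 \<longrightarrow> node.found_inv n s st) \<longrightarrow> ?good st')"
    proof (cases fo)
      case (Some iab)
      define e1 where "e1 = (e \<ge> 1 \<longrightarrow> node.found_inv n s st)"
      have e: "e \<ge> 1" using fo(3) Some by (cases e) auto
      have "\<exists>i a b. st rFound = found_data (Some (i, a, b)) \<and> i < n \<and> i \<notin> ?U \<and> 1 \<le> a \<and> 1 \<le> b \<and> a + b = s \<and>
        (e1 \<longrightarrow> near a (C / 2 ^ node.acc) ((i, -1) # \<rho>) \<and> near b (C / 2 ^ node.acc) ((i, 1) # \<rho>))"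
      proof (cases e1)
        case True
        \<comment> \<open>The split is taken from \<open>fo'\<close>, which carries the soundness;
          that it need not be \<open>fo\<close> is harmless, as both encode the content of
          \<open>rFound\<close>.\<close>
        then obtain fo' where fo': "st rFound = found_data fo'" "node.found_ok fo'" "node.found_good n s fo'"
          using e unfolding e1_def node.found_inv_def by blast
        then have "fo' \<noteq> None" using fo(1) Some found_data_None by (metis option.distinct(1))
        then obtain i a b where "fo' = Some (i, a, b)" by (cases fo') auto
        then show ?thesis
          using fo' unfolding node.found_ok_def node.found_good_def by blast
      next
        case False
        obtain i a b where "fo = Some (i, a, b)" using Some by (cases iab) auto
        then show ?thesis
          using fo(1,2) False unfolding node.found_ok_def by blast
      qed
      then obtain i a b where iab: "st rFound = found_data (Some (i, a, b))" "i < n" "i \<notin> ?U" "1 \<le> a" "1 \<le> b" "a + b = s"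
        and nr: "e1 \<Longrightarrow> near a (C / 2 ^ node.acc) ((i, -1) # \<rho>) \<and> near b (C / 2 ^ node.acc) ((i, 1) # \<rho>)"
        by blast
      have state: "st rPath = path_data \<rho>" "st rFlags = flags_data ?U 0 n" "st rDepth = nat_data e"
        "st rDigits = digits_data (B + c * e)" "st rStack = stk" "st rOut = out"
        using fr \<tau> by simp_all
      obtain st' where st': "runs Q D (branch_com c) st (10 * n + 30) st'" "children_pushed \<rho> s e stk out i a b st'" "agree 3 st' st"
        using runs_branch[where st = st, OF path(1) e iab state] by blast
      have safe: "?safe st'"
        using st'(2,3) fr \<tau>(1,2) unfolding expand_safe_def by auto
      \<comment> \<open>Accepted halves are certified only up to \<open>C / 2 ^ acc\<close>. The
        next level has \<open>c\<close> digits less, and \<open>2 * C \<le> 2 ^ c\<close> absorbs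
        both \<open>C\<close> and the doubling.\<close>
      have "C / 2 ^ node.acc \<le> 1 / 2 ^ (B + c * (e - 1))"
      proof -
        have "B + c * e = c + (B + c * (e - 1))" using e by (cases e) auto
        then have acc: "Suc node.acc = c + (B + c * (e - 1))"
          using B by (simp add: node.acc_def)
        have "C / 2 ^ node.acc = 2 * C / 2 ^ Suc node.acc" by simp
        also have "\<dots> \<le> 2 ^ c / 2 ^ Suc node.acc" using C(2) by (intro divide_right_mono) auto
        also have "\<dots> = 1 / 2 ^ (B + c * (e - 1))" unfolding acc by (simp add: power_add)
        finally show ?thesis .
      qed
      then have good: "?good st'" if e1
        using nr[OF that] st'(2) near_mono unfolding expand_good_def by blast
      have "triple Q D (branch_com c) st (10 * n + 30) ?safe 0 (\<lambda>st'. e1 \<longrightarrow> ?good st')"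
        by (rule runs_triple[where S = "?safe", OF st'(1) safe]) (use good in simp)
      then have "triple Q D (branch_com c) st ?t ?safe (ennreal (1 / 2 ^ B)) (\<lambda>st'. e1 \<longrightarrow> ?good st')"
        by (rule triple_weaken) auto
      then show ?thesis using iab(1) by (simp add: e1_def)
    next
      case None
      \<comment> \<open>If a constant is within \<open>1 / 2 ^ B\<close>, the opposite label is bad
        and is sampled with at most that probability. Otherwise no label is bad: at
        \<open>e = 0\<close> the allowed error \<open>s / 2 ^ 0\<close> is at least 1, and for
        \<open>e \<ge> 1\<close> a complete search without success would by
        \<open>near_size_split\<close> yield a close constant.\<close>
      obtain Bad where Bad: "cube_prob n (\<lambda>x. g (restrict_point \<rho> x) \<in> Bad) \<le> 1 / 2 ^ B"
        "\<And>v. v \<in> {-1, 1} \<Longrightarrow> v \<notin> Bad \<Longrightarrow> near s (1 / 2 ^ (B + c * e)) \<rho> \<Longrightarrow>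
           (e \<ge> 1 \<Longrightarrow> node.found_inv n s st) \<Longrightarrow> good_error \<rho> s e (Leaf v)"
      proof (cases "\<exists>c0 \<in> {-1, 1}. cube_prob n (\<lambda>x. g (restrict_point \<rho> x) \<noteq> c0) \<le> 1 / 2 ^ B")
        case True
        then obtain c0 where c0: "c0 \<in> {-1, 1}" "cube_prob n (\<lambda>x. g (restrict_point \<rho> x) \<noteq> c0) \<le> 1 / 2 ^ B"
          by blast
        have val: "g (restrict_point \<rho> x) \<in> {-1, 1}" if "x \<in> cube n" for x
          using g restrict_point_cube[OF path(1) that] by (auto simp: bool_funs_def)
        have eq: "cube_prob n (\<lambda>x. g (restrict_point \<rho> x) \<in> {- c0}) = cube_prob n (\<lambda>x. g (restrict_point \<rho> x) \<noteq> c0)"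
          using c0(1) val by (intro cube_prob_cong) force
        have "path_error n g \<rho> (Leaf c0) = cube_prob n (\<lambda>x. g (restrict_point \<rho> x) \<noteq> c0)"
          unfolding path_error_def by (intro cube_prob_cong) auto
        also have "\<dots> \<le> real s / 2 ^ e + 1 / 2 ^ B"
          using c0(2) by (rule add_increasing[rotated]) simp
        finally have "good_error \<rho> s e (Leaf c0)"
          by (simp add: good_error_def)
        then show ?thesis using eq c0 by (intro that[of "{- c0}"]) auto
      next
        case False
        show ?thesis
        proof (rule that[of "{}"])
          fix v :: int
          assume near: "near s (1 / 2 ^ (B + c * e)) \<rho>" and inv: "e \<ge> 1 \<Longrightarrow> node.found_inv n s st"
          show "good_error \<rho> s e (Leaf v)"
          proof (cases "e = 0")
            case True
            have "path_error n g \<rho> (Leaf v) \<le> real s / 2 ^ e"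
              using path_error_le_1[of \<rho> "Leaf v"] s(1) True by simp
            then show ?thesis unfolding good_error_def by (rule add_increasing2[rotated]) simp
          next
            case e: False
            then obtain fo' where fo': "st rFound = found_data fo'" "node.found_good n s fo'"
              using inv unfolding node.found_inv_def by auto
            then have "fo' = None" using fo(1) None found_data_None by metis
            then have no: "\<not> (near a (1 / 2 ^ node.acc) ((i, -1) # \<rho>) \<and> near (s - a) (1 / 2 ^ node.acc) ((i, 1) # \<rho>))"
              if "i < n" "i \<notin> ?U" "1 \<le> a" "a < s" for i a
              using that fo'(2) unfolding node.found_good_def by blast
            have "2 * (1 / 2 ^ (B + c * e)) = (1 / 2 ^ node.acc :: real)"
              using B by (simp add: node.acc_def power_diff)
            with near_size_split[of ?U, OF _ near] no
            have "\<exists>c0 \<in> {-1, 1}. cube_prob n (\<lambda>x. g (restrict_point \<rho> x) \<noteq> c0) \<le> 1 / 2 ^ (B + c * e)"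
              by (auto simp: restrict_point_ignores)
            moreover have "1 / 2 ^ (B + c * e) \<le> (1 / 2 ^ B :: real)"
              by (simp add: divide_simps)
            ultimately show ?thesis using False by (meson order_trans)
          qed
        qed (simp add: cube_prob_def)
      qed
      have "st rPath = path_data \<rho>" "st rN = nat_data n" using fr \<tau> by simp_all
      from triple_leaf[OF g path(1) this, of D Bad]
      have "triple Q D leaf_com st ?t ?safe (ennreal (1 / 2 ^ B))
         (\<lambda>st'. (e \<ge> 1 \<longrightarrow> node.found_inv n s st) \<longrightarrow> ?good st')"
      proof (rule triple_weaken)
        have "length \<rho> * (10 * n + 20) \<le> B * (10 * n + 20)"
          using path(2) by (intro mult_right_mono) auto
        then show "n * 6 + length \<rho> * (10 * n + 20) + 20 \<le> ?t" by linarith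
        show "ennreal (cube_prob n (\<lambda>x. g (restrict_point \<rho> x) \<in> Bad)) \<le> ennreal (1 / 2 ^ B)"
          using Bad(1) by (rule ennreal_leI)
      next
        fix st'
        assume "agree 4 st' st \<and> (\<exists>b \<in> {-1, 1}. st' rOut = Pair (dtree_data (Leaf b)) (st rOut))"
        then have *: "st' rStack = stk" "st' rN = nat_data n" "st' rK = nat_data k" "\<exists>b \<in> {-1, 1}. st' rOut = Pair (dtree_data (Leaf b)) out"
          using fr \<tau> by auto
        then show "?safe st'"
          unfolding expand_safe_def leaf_pushed_def by blast
        assume "\<exists>b \<in> {-1, 1} - Bad. st' rOut = Pair (dtree_data (Leaf b)) (st rOut)"
        then obtain b where "b \<in> {-1, 1}" "b \<notin> Bad" "st' rOut = Pair (dtree_data (Leaf b)) out"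
          using fr \<tau>(9) by auto
        then show "(e \<ge> 1 \<longrightarrow> node.found_inv n s st) \<longrightarrow> ?good st'"
          using Bad(2)[of b] *(1) unfolding expand_good_def leaf_pushed_def by blast
      qed
      then show ?thesis using None fo(1) by simp
    qed
  qed
  have "triple Q D (expand_com N P c) \<tau> (Suc (node.search_cost + Suc ?t)) ?safe
    (node.search_fail + ennreal (1 / 2 ^ B)) ?good"
    unfolding expand_com_def
  proof (rule triple_Seq[OF node.triple_search])
    fix st1 assume "agree 10 st1 \<tau> \<and> (\<exists>fo. st1 rFound = found_data fo \<and> node.found_ok fo \<and> (e = 0 \<longrightarrow> fo = None))"
    then show "triple Q D (com.If (Var rFound) (branch_com c) leaf_com) st1 (Suc ?t) ?safe (ennreal (1 / 2 ^ B))
     (\<lambda>st'. (1 \<le> e \<longrightarrow> node.found_inv n s st1) \<longrightarrow> ?good st')"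
      using triple by blast
  qed simp
  then show ?thesis
    by (rule triple_weaken) (simp_all add: node.search_cost_def node.search_fail_def expand_cost_def node_fail_def)
qed

end

section \<open>The recursion\<close>

context learner_main
begin

lemma triple_main_body:
  assumes "path_ok n \<rho>" "length \<rho> + e \<le> B" "1 \<le> s" "s \<le> s0"
    and st: "st rN = nat_data n" "st rK = nat_data k" "st rStack = Pair (node_data n B c \<rho> s e) stk" "st rOut = out"
  shows "triple Q D (main_body N P c) st (expand_cost + 23) (expand_safe \<rho> s e stk out) node_fail
     (expand_good \<rho> s e stk out)"
proof -
  let ?st1 = "st(rX := node_data n B c \<rho> s e, rStack := stk)"
  let ?st2 = "straight_store unpack_com ?st1"
  have pop: "runs Q D (Assign rX (Fst (Var rStack)) ;; Assign rStack (Snd (Var rStack))) st 3 ?st1"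
    by (rule runs_straightI) (simp_all add: st)
  have unpack: "runs Q D unpack_com ?st1 17 ?st2"
    by (rule runs_straightI) (simp_all add: unpack_com_def)
  have expand: "triple Q D (expand_com N P c) ?st2 expand_cost (expand_safe \<rho> s e stk out) node_fail (expand_good \<rho> s e stk out)"
    by (rule triple_expand[OF assms(1-4)]) (simp_all add: unpack_com_def node_data_def st)
  have "triple Q D (if expr_val (Fst (Var rX)) ?st1 \<noteq> Empty then combine_com else unpack_com ;; expand_com N P c) ?st1
    (Suc (17 + expand_cost)) (expand_safe \<rho> s e stk out) node_fail (expand_good \<rho> s e stk out)"
    using runs_triple_Seq[OF unpack expand] by (simp add: node_data_def)
  from runs_triple_Seq[OF pop triple_If[OF this]] show ?thesis
    unfolding main_body_def by (rule triple_weaken) auto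
qed

lemma runs_combine:
  assumes "st rStack = Pair (combine_data i) stk" "st rOut = Pair (dtree_data r) (Pair (dtree_data l') out)"
  shows "runs Q D (main_body N P c) st 6
    (st(rX := combine_data i, rStack := stk, rOut := Pair (dtree_data (Node i l' r)) out))"
proof -
  let ?st1 = "st(rX := combine_data i, rStack := stk)"
  let ?st2 = "?st1(rOut := Pair (dtree_data (Node i l' r)) out)"
  have pop: "runs Q D (Assign rX (Fst (Var rStack)) ;; Assign rStack (Snd (Var rStack))) st 3 ?st1"
    by (rule runs_straightI) (simp_all add: assms)
  have "runs Q D combine_com ?st1 1 ?st2"
    by (rule runs_straightI) (simp_all add: combine_com_def combine_data_def assms)
  then have "runs Q D (if expr_val (Fst (Var rX)) ?st1 \<noteq> Empty then combine_com else unpack_com ;; expand_com N P c) ?st1 1 ?st2"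
    by (simp add: combine_data_def)
  from runs_Seq[OF pop runs_If[OF this]] show ?thesis
    unfolding main_body_def by (rule runs_weaken) simp
qed

text \<open>The cut-off terms add up over the sizes and are halved, whereas averaging reproduces
  \<open>1 / 2 ^ B\<close>; the sampling error therefore does not grow with the depth.\<close>

lemma good_error_Node:
  assumes "i < n" "i \<notin> fst ` set \<rho>" "a + b = s" "e \<ge> 1"
    and "good_error ((i, -1) # \<rho>) a (e - 1) l'" "good_error ((i, 1) # \<rho>) b (e - 1) r"
  shows "good_error \<rho> s e (Node i l' r)"
proof -
  have "path_error n g \<rho> (Node i l' r) \<le>
      ((real a / 2 ^ (e - 1) + 1 / 2 ^ B) + (real b / 2 ^ (e - 1) + 1 / 2 ^ B)) / 2"
    using assms(5,6) unfolding good_error_def path_error_Node[OF assms(1,2)]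
    by (intro divide_right_mono add_mono) auto
  also have "\<dots> = real s / 2 ^ e + 1 / 2 ^ B"
    using assms(3,4) by (cases e) (auto simp: field_simps)
  finally show ?thesis by (simp add: good_error_def)
qed

definition node_cost :: nat where "node_cost = expand_cost + 60"

text \<open>The last premise is the continuation: a tree is delivered on \<open>rOut\<close>, at the
  price of 1 if its error is too large although the node was close to a tree of its size. Sizes
  \<open>a\<close> and \<open>b\<close> give
  \<open>1 + (2 * a - 1) + (2 * b - 1) = 2 * s - 1\<close> nodes whatever the tests answer.\<close>

lemma wpn_main:
  assumes "path_ok n \<rho>" "length \<rho> + e \<le> B" "1 \<le> s" "s \<le> s0"
    and "st rN = nat_data n" "st rK = nat_data k" "st rStack = Pair (node_data n B c \<rho> s e) stk" "st rOut = out"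
    and "\<And>T st'. dt_wf n T \<Longrightarrow> leaves T \<le> s \<Longrightarrow> st' rN = nat_data n \<Longrightarrow> st' rK = nat_data k \<Longrightarrow>
      st' rStack = stk \<Longrightarrow> st' rOut = Pair (dtree_data T) out \<Longrightarrow>
      wpn Q D t (main_com N P c # cs) F st' \<le>
        x + (if near s (1 / 2 ^ (B + c * e)) \<rho> \<longrightarrow> good_error \<rho> s e T then 0 else 1)"
  shows "wpn Q D (t + (2 * s - 1) * node_cost) (main_com N P c # cs) F st \<le> x + of_nat (2 * s - 1) * node_fail"
  using assms
proof (induction e arbitrary: \<rho> s st stk out t x rule: less_induct)
  case (less e)
  note fin = less.prems(9)
  let ?main = "main_com N P c # cs"
  let ?prom = "near s (1 / 2 ^ (B + c * e)) \<rho>"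
  let ?x = "x + of_nat (2 * s - 2) * node_fail"
  \<comment> \<open>What is left after the expansion of the root. \<open>node_cost\<close> exceeds
    \<open>expand_cost\<close> by 60, which covers fetching the task and the 30 steps reserved for
    the join.\<close>
  let ?T = "t + 30 + (2 * s - 2) * node_cost"
  let ?R = "expand_good \<rho> s e stk out"
  have step: "wpn Q D ?T ?main F st' \<le> ?x + (if ?R st' then 0 else 1)"
    if S: "expand_safe \<rho> s e stk out st'" for st'
  proof -
    have keep: "st' rN = nat_data n" "st' rK = nat_data k"
      using S by (auto simp: expand_safe_def)
    have "(\<exists>i a b. children_pushed \<rho> s e stk out i a b st' \<and> (?R st' \<and> ?prom \<longrightarrow>
         near a (1 / 2 ^ (B + c * (e - 1))) ((i, -1) # \<rho>) \<and> near b (1 / 2 ^ (B + c * (e - 1))) ((i, 1) # \<rho>))) \<or>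
      (\<exists>v. leaf_pushed stk out v st' \<and> (?R st' \<and> ?prom \<longrightarrow> good_error \<rho> s e (Leaf v)))"
    proof (cases "?R st' \<and> ?prom")
      case True
      then show ?thesis unfolding expand_good_def by blast
    next
      case False
      then show ?thesis using S unfolding expand_safe_def by blast
    qed
    then show ?thesis
    proof (elim disjE exE conjE)
      fix v assume v: "leaf_pushed stk out v st'" "?R st' \<and> ?prom \<longrightarrow> good_error \<rho> s e (Leaf v)"
      have "wpn Q D ?T ?main F st' \<le> wpn Q D t ?main F st'"
        by (rule wpn_antimono) simp
      also have "\<dots> \<le> x + (if ?prom \<longrightarrow> good_error \<rho> s e (Leaf v) then 0 else 1)"
        using v(1) keep less.prems(3) by (intro fin) (auto simp: leaf_pushed_def)
      also have "\<dots> \<le> x + (if ?R st' then 0 else 1)"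
        using v(2) by (intro add_left_mono) auto
      also have "\<dots> \<le> ?x + (if ?R st' then 0 else 1)"
        by (intro add_right_mono) simp
      finally show ?thesis .
    next
      fix i a b assume br: "children_pushed \<rho> s e stk out i a b st'"
        and nr: "?R st' \<and> ?prom \<longrightarrow>
         near a (1 / 2 ^ (B + c * (e - 1))) ((i, -1) # \<rho>) \<and> near b (1 / 2 ^ (B + c * (e - 1))) ((i, 1) # \<rho>)"
      note br' = br[unfolded children_pushed_def]
      let ?\<rho>1 = "(i, -1) # \<rho>" and ?\<rho>2 = "(i, 1) # \<rho>"
      have e: "e - 1 < e" using br' by simp
      have ok: "path_ok n ?\<rho>1" "path_ok n ?\<rho>2" "length ?\<rho>1 + (e - 1) \<le> B" "length ?\<rho>2 + (e - 1) \<le> B"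
        using less.prems(1,2) br' by (auto simp: path_ok_def)
      have ab: "1 \<le> a" "a \<le> s0" "1 \<le> b" "b \<le> s0" "a + b = s"
        using br' less.prems(4) by auto
      \<comment> \<open>Three events can spoil the joined tree: a failure at the root, in the left
        or in the right subtree. Each is charged 1; if none occurs, \<open>good_error_Node\<close>
        applies.\<close>
      let ?z = "x + (if ?R st' then 0 else 1)"
      let ?L = "\<lambda>T. near a (1 / 2 ^ (B + c * (e - 1))) ?\<rho>1 \<longrightarrow> good_error ?\<rho>1 a (e - 1) T"
      let ?M = "\<lambda>T. near b (1 / 2 ^ (B + c * (e - 1))) ?\<rho>2 \<longrightarrow> good_error ?\<rho>2 b (e - 1) T"
      let ?stk2 = "Pair (combine_data i) stk"
      let ?stk1 = "Pair (node_data n B c ?\<rho>2 b (e - 1)) ?stk2"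
      have "wpn Q D ((t + 30 + (2 * b - 1) * node_cost) + (2 * a - 1) * node_cost) ?main F st' \<le>
        (?z + of_nat (2 * b - 1) * node_fail) + of_nat (2 * a - 1) * node_fail"
      proof (rule less.IH[OF e ok(1,3) ab(1,2) keep, of ?stk1 out])
        fix Tl st1
        assume Tl: "dt_wf n Tl" "leaves Tl \<le> a" and st1: "st1 rN = nat_data n" "st1 rK = nat_data k"
          "st1 rStack = ?stk1" "st1 rOut = Pair (dtree_data Tl) out"
        let ?y = "?z + (if ?L Tl then 0 else 1)"
        have "wpn Q D ((t + 30) + (2 * b - 1) * node_cost) ?main F st1 \<le> ?y + of_nat (2 * b - 1) * node_fail"
        proof (rule less.IH[OF e ok(2,4) ab(3,4) st1])
          fix Tr st2
          assume Tr: "dt_wf n Tr" "leaves Tr \<le> b" and st2: "st2 rN = nat_data n" "st2 rK = nat_data k"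
            "st2 rStack = ?stk2" "st2 rOut = Pair (dtree_data Tr) (Pair (dtree_data Tl) out)"
          let ?st3 = "st2(rX := combine_data i, rStack := stk, rOut := Pair (dtree_data (Node i Tl Tr)) out)"
          have "wpn Q D (t + 30) ?main F st2 \<le> wpn Q D (Suc (6 + t)) ?main F st2"
            by (rule wpn_antimono) simp
          also have "\<dots> = wpn Q D (6 + t) (main_body N P c # ?main) F st2"
            using st2(3) unfolding main_com_def wpn.simps by simp
          also have "\<dots> \<le> wpn Q D t ?main F ?st3"
            by (rule runsD[OF runs_combine[OF st2(3,4)]])
          also have "\<dots> \<le> x + (if ?prom \<longrightarrow> good_error \<rho> s e (Node i Tl Tr) then 0 else 1)"
            using st2 Tl Tr br' by (intro fin) auto
          also have "\<dots> \<le> ?y + (if ?M Tr then 0 else 1)"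
          proof (cases "?R st' \<and> ?L Tl \<and> ?M Tr")
            case True
            then have "?prom \<longrightarrow> good_error \<rho> s e (Node i Tl Tr)"
              using nr good_error_Node[of i \<rho> a b s e Tl Tr] br' by blast
            then show ?thesis using True by simp
          next
            case False
            have "x + (if ?prom \<longrightarrow> good_error \<rho> s e (Node i Tl Tr) then 0 else 1) \<le> x + 1"
              by (intro add_left_mono) simp
            also have "\<dots> \<le> x + ((if ?R st' then 0 else 1) + (if ?L Tl then 0 else 1) + (if ?M Tr then 0 else 1))"
              using False by (intro add_left_mono) auto
            finally show ?thesis by (simp only: add.assoc)
          qed
          finally show "wpn Q D (t + 30) ?main F st2 \<le> ?y + (if ?M Tr then 0 else 1)" .
        qed
        then show "wpn Q D (t + 30 + (2 * b - 1) * node_cost) ?main F st1 \<le>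
            ?z + of_nat (2 * b - 1) * node_fail + (if ?L Tl then 0 else 1)"
          by (simp only: add_ac)
      qed (use br' in auto)
      moreover have "(2 * b - 1) + (2 * a - 1) = 2 * s - 2" using ab by simp
      then have "(t + 30 + (2 * b - 1) * node_cost) + (2 * a - 1) * node_cost = ?T"
        "(of_nat (2 * b - 1) :: ennreal) * node_fail + of_nat (2 * a - 1) * node_fail = of_nat (2 * s - 2) * node_fail"
        by (metis add.assoc distrib_right, metis distrib_right of_nat_add)
      ultimately show ?thesis by (simp only: add_ac)
    qed
  qed
  have "wpn Q D (t + (2 * s - 1) * node_cost) ?main F st \<le> wpn Q D (Suc ((expand_cost + 23) + ?T)) ?main F st"
  proof (rule wpn_antimono)
    have "(2 * s - 1) * node_cost = node_cost + (2 * s - 2) * node_cost"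
      using less.prems(3) by (cases s) auto
    then show "Suc ((expand_cost + 23) + ?T) \<le> t + (2 * s - 1) * node_cost"
      unfolding node_cost_def by simp
  qed
  also have "\<dots> = wpn Q D ((expand_cost + 23) + ?T) (main_body N P c # ?main) F st"
    using less.prems(7) unfolding main_com_def wpn.simps by simp
  also have "\<dots> \<le> ?x + node_fail"
    by (rule triple_use[OF triple_main_body[OF less.prems(1-8)] step])
  also have "\<dots> = x + of_nat (2 * s - 1) * node_fail"
  proof -
    have "2 * s - 1 = Suc (2 * s - 2)" using less.prems(3) by simp
    then show ?thesis by (simp only: of_nat_Suc distrib_right mult_1 add_ac)
  qed
  finally show ?case .
qed

end

section \<open>Computing the parameters\<close>

text \<open>Multiplication by the constant \<open>A\<close>; on a digit list it appends leading
  zeros, since \<open>Empty\<close> is the digit 0.\<close>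

definition pad_com :: "nat \<Rightarrow> nat \<Rightarrow> com" where
  "pad_com v A =
     While (Var rI) (Assign v ((PairE EmptyE ^^ A) (Var v)) ;; Assign rI (Snd (Var rI)))"

text \<open>The first nonzero digit locates the accuracy up to a factor 2. Nowhere else is the given
  accuracy read.\<close>

definition first_digit_com :: com where
  "first_digit_com =
     While (Var rX)
       (Digit rA (Var rDepth) ;;
        If (Var rA) (Assign rX EmptyE) (Assign rDepth (PairE EmptyE (Var rDepth))))"

definition half_com :: com where
  "half_com =
     While (Var rA) (Assign rI (PairE EmptyE (Var rI)) ;; Assign rA (Snd (Snd (Var rA))))"

text \<open>\<open>half_com\<close> rounds up; one unit is taken off beforehand, so that each round
  maps \<open>m\<close> to \<open>m div 2\<close>.\<close>

definition log_com :: com where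
  "log_com =
     While (Var rI)
       ((Assign rDepth (PairE EmptyE (Var rDepth)) ;; Assign rA (Snd (Var rI)) ;; Assign rI EmptyE) ;;
        half_com)"

text \<open>Size 0, which no tree has, is replaced by 1. The unary \<open>n\<close> doubles as a
  list of \<open>n\<close> cleared flags. The \<open>(c + 1) * B\<close> leading zeros are the
  accuracy \<open>B + c * e\<close> at the root, where \<open>e = B\<close>.\<close>

definition init_com :: "nat \<Rightarrow> nat \<Rightarrow> nat \<Rightarrow> com" where
  "init_com A c0 c =
     (If (Var rS) Skip (Assign rS TrueE) ;; Assign rK EmptyE ;; Assign rI (Var rN)) ;; pad_com rK A ;;
     Assign rI (Var rS) ;; pad_com rK A ;;
     (Assign rDepth EmptyE ;; Assign rX TrueE) ;; first_digit_com ;;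
     Assign rI (Var rS) ;; log_com ;;
     (Assign rDepth ((PairE EmptyE ^^ c0) (Var rDepth)) ;;
      Assign rDigits (PairE TrueE EmptyE) ;; Assign rI (Var rDepth)) ;; pad_com rDigits (c + 1) ;;
     (Assign rOut EmptyE ;;
      Assign rStack (PairE (PairE EmptyE (PairE EmptyE (PairE (Var rN) (PairE (Var rS)
        (PairE (Var rDepth) (Var rDigits)))))) EmptyE))"

lemma expr_val_PairE_power: "expr_val ((PairE EmptyE ^^ A) e) st = (Pair Empty ^^ A) (expr_val e st)"
  by (induction A) auto

lemma pad_nat_data: "(Pair Empty ^^ A) (nat_data k) = nat_data (A + k)"
  by (induction A) auto

lemma pad_digits_data: "(Pair Empty ^^ A) (digits_data k) = digits_data (A + k)"
  by (induction A) (auto simp: bool_data_def)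

lemma runs_pad:
  assumes "v \<noteq> rI"
  shows "st rI = nat_data k \<Longrightarrow>
    runs Q D (pad_com v A) st (4 * k + 1) (st(v := (Pair Empty ^^ (A * k)) (st v), rI := Empty))"
  unfolding pad_com_def
proof (induction k arbitrary: st)
  case 0
  then have "st(v := (Pair Empty ^^ (A * 0)) (st v), rI := Empty) = st"
    by (auto simp: fun_eq_iff)
  then show ?case using runs_While_Empty[of "Var rI" st] 0 by simp
next
  case (Suc k)
  let ?st = "st(v := (Pair Empty ^^ A) (st v), rI := nat_data k)"
  have "(Pair Empty ^^ (A * k)) ((Pair Empty ^^ A) d) = (Pair Empty ^^ (A * Suc k)) d" for d
    by (metis add.commute funpow_add mult_Suc_right o_apply)
  then have fin: "?st(v := (Pair Empty ^^ (A * k)) (?st v), rI := Empty) =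
      st(v := (Pair Empty ^^ (A * Suc k)) (st v), rI := Empty)"
    using assms by (simp add: fun_eq_iff del: mult_Suc_right)
  have "runs Q D (While (Var rI) (Assign v ((PairE EmptyE ^^ A) (Var v)) ;; Assign rI (Snd (Var rI)))) st
    (Suc (3 + (4 * k + 1))) (?st(v := (Pair Empty ^^ (A * k)) (?st v), rI := Empty))"
  proof (rule runs_While_step[OF _ _ Suc.IH])
    show "runs Q D (Assign v ((PairE EmptyE ^^ A) (Var v)) ;; Assign rI (Snd (Var rI))) st 3 ?st"
      by (rule runs_straightI) (use assms Suc.prems in \<open>simp_all add: expr_val_PairE_power\<close>)
  qed (use Suc.prems in simp_all)
  then show ?case unfolding fin by (rule runs_weaken) simp
qed

lemma data_nat_nat_data [simp]: "data_nat (nat_data k) = k"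
  by (induction k) auto

lemma runs_first_digit:
  assumes "\<And>j. j < k0 \<Longrightarrow> \<not> D (nat_data j)" "D (nat_data k0)"
  shows "st rDepth = nat_data j \<Longrightarrow> j \<le> k0 \<Longrightarrow> st rX \<noteq> Empty \<Longrightarrow>
    runs Q D first_digit_com st (5 * (k0 - j) + 6)
      (st(rDepth := nat_data k0, rX := Empty, rA := bool_data True))"
  unfolding first_digit_com_def
proof (induction "k0 - j" arbitrary: j st)
  case 0
  then have j: "st rDepth = nat_data k0" by simp
  let ?w = "While (Var rX)
       (Digit rA (Var rDepth) ;;
        If (Var rA) (Assign rX EmptyE) (Assign rDepth (PairE EmptyE (Var rDepth))))"
  let ?st1 = "st(rA := bool_data True)"
  have "runs Q D ?w st (Suc (Suc (1 + 2) + 1)) (?st1(rX := Empty))"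
  proof (rule runs_While_step[OF _ runs_Seq])
    show "runs Q D (Digit rA (Var rDepth)) st 1 ?st1"
      using runs_Digit[of Q D rA "Var rDepth" st] assms(2) j by simp
    show "runs Q D (com.If (Var rA) (Assign rX EmptyE) (Assign rDepth (PairE EmptyE (Var rDepth)))) ?st1 2 (?st1(rX := Empty))"
      by (rule runs_straightI) (simp_all add: bool_data_def)
    show "runs Q D ?w (?st1(rX := Empty)) 1 (?st1(rX := Empty))"
      by (rule runs_While_Empty) simp
  qed (use 0 in simp)
  moreover have "?st1(rX := Empty) = st(rDepth := nat_data k0, rX := Empty, rA := bool_data True)"
    using j by (auto simp: fun_eq_iff)
  ultimately show ?case by (simp only: runs_weaken[of Q D ?w st _ _ "5 * (k0 - j) + 6"])
next
  case (Suc d)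
  let ?w = "While (Var rX)
       (Digit rA (Var rDepth) ;;
        If (Var rA) (Assign rX EmptyE) (Assign rDepth (PairE EmptyE (Var rDepth))))"
  let ?st1 = "st(rA := bool_data False)"
  let ?st2 = "?st1(rDepth := nat_data (Suc j))"
  have j: "j < k0" "d = k0 - Suc j" using Suc(2) by simp_all
  have IH: "runs Q D ?w ?st2 (5 * (k0 - Suc j) + 6) (?st2(rDepth := nat_data k0, rX := Empty, rA := bool_data True))"
    by (rule Suc(1)[OF j(2)]) (use j Suc.prems in simp_all)
  have "runs Q D ?w st (Suc (Suc (1 + 2) + (5 * (k0 - Suc j) + 6))) (?st2(rDepth := nat_data k0, rX := Empty, rA := bool_data True))"
  proof (rule runs_While_step[OF _ runs_Seq IH])
    show "runs Q D (Digit rA (Var rDepth)) st 1 ?st1"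
      using runs_Digit[of Q D rA "Var rDepth" st] assms(1)[OF j(1)] Suc.prems by simp
    show "runs Q D (com.If (Var rA) (Assign rX EmptyE) (Assign rDepth (PairE EmptyE (Var rDepth)))) ?st1 2 ?st2"
      by (rule runs_straightI) (use Suc.prems in \<open>simp_all add: bool_data_def\<close>)
  qed (use Suc.prems in simp)
  moreover have "?st2(rDepth := nat_data k0, rX := Empty, rA := bool_data True) =
      st(rDepth := nat_data k0, rX := Empty, rA := bool_data True)"
    by (auto simp: fun_eq_iff)
  moreover have "Suc (Suc (1 + 2) + (5 * (k0 - Suc j) + 6)) = 5 * (k0 - j) + 6"
    using j by simp
  ultimately show ?case by (simp only:)
qed

lemma runs_half:
  "st rA = nat_data m \<Longrightarrow> st rI = nat_data q \<Longrightarrow>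
    runs Q D half_com st (4 * m + 1) (st(rI := nat_data (q + (m + 1) div 2), rA := Empty))"
  unfolding half_com_def
proof (induction m arbitrary: q st rule: less_induct)
  case (less m)
  let ?w = "While (Var rA) (Assign rI (PairE EmptyE (Var rI)) ;; Assign rA (Snd (Snd (Var rA))))"
  show ?case
  proof (cases "m = 0")
    case True
    then have "st(rI := nat_data (q + (m + 1) div 2), rA := Empty) = st"
      using less.prems by (auto simp: fun_eq_iff)
    then show ?thesis
      by (simp only:) (rule runs_weaken[OF runs_While_Empty], use less.prems True in simp_all)
  next
    case False
    let ?st = "st(rI := nat_data (Suc q), rA := nat_data (m - 2))"
    have IH: "runs Q D ?w ?st (4 * (m - 2) + 1) (?st(rI := nat_data (Suc q + (m - 2 + 1) div 2), rA := Empty))"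
      using False by (intro less.IH) auto
    have r: "runs Q D ?w st (Suc (3 + (4 * (m - 2) + 1))) (?st(rI := nat_data (Suc q + (m - 2 + 1) div 2), rA := Empty))"
    proof (rule runs_While_step[OF _ _ IH])
      show "runs Q D (Assign rI (PairE EmptyE (Var rI)) ;; Assign rA (Snd (Snd (Var rA)))) st 3 ?st"
        by (rule runs_straightI) (use less.prems in \<open>simp_all add: snd_data_nat_data numeral_2_eq_2\<close>)
    qed (use less.prems False in simp)
    have "Suc q + (m - 2 + 1) div 2 = q + (m + 1) div 2"
      using False by (cases "m = 1") (auto simp: div_add1_eq le_div_geq)
    then have eq: "?st(rI := nat_data (Suc q + (m - 2 + 1) div 2), rA := Empty) =
        st(rI := nat_data (q + (m + 1) div 2), rA := Empty)"
      by (simp only:) (auto simp: fun_eq_iff)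
    from r[unfolded eq] show ?thesis
      by (rule runs_weaken) (use False in simp)
  qed
qed

fun bit_length :: "nat \<Rightarrow> nat" where
  "bit_length m = (if m = 0 then 0 else Suc (bit_length (m div 2)))"

declare bit_length.simps [simp del]

lemma bit_length_0 [simp]: "bit_length 0 = 0"
  by (simp add: bit_length.simps)

lemma bit_length_pos: "m > 0 \<Longrightarrow> bit_length m = Suc (bit_length (m div 2))"
  by (simp add: bit_length.simps)

lemma less_power_bit_length: "m < 2 ^ bit_length m"
proof (induction m rule: less_induct)
  case (less m)
  show ?case
  proof (cases "m = 0")
    case False
    then have "m div 2 < 2 ^ bit_length (m div 2)" using less by simp
    then show ?thesis using False by (simp add: bit_length_pos)
  qed simp
qed

lemma power_bit_length_le: "m > 0 \<Longrightarrow> 2 ^ bit_length m \<le> 2 * m"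
proof (induction m rule: less_induct)
  case (less m)
  show ?case
  proof (cases "m = 1")
    case False
    then have "2 ^ bit_length (m div 2) \<le> 2 * (m div 2)" using less by (intro less.IH) auto
    then show ?thesis using less.prems by (simp add: bit_length_pos)
  qed (simp add: bit_length_pos)
qed

lemma runs_log:
  "st rI = nat_data m \<Longrightarrow> st rDepth = nat_data q \<Longrightarrow> m \<le> m0 \<Longrightarrow>
    \<exists>st'. runs Q D log_com st ((4 * m0 + 12) * bit_length m + 1) st' \<and>
      st' rDepth = nat_data (q + bit_length m) \<and> (\<forall>v. v \<notin> {rI, rA, rDepth} \<longrightarrow> st' v = st v)"
  unfolding log_com_def
proof (induction m arbitrary: q st rule: less_induct)
  case (less m)
  let ?pre = "Assign rDepth (PairE EmptyE (Var rDepth)) ;; Assign rA (Snd (Var rI)) ;; Assign rI EmptyE"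
  let ?w = "While (Var rI) (?pre ;; half_com)"
  show ?case
  proof (cases "m = 0")
    case True
    then show ?thesis using runs_While_Empty[of "Var rI" st] less.prems by (intro exI[of _ st]) simp
  next
    case False
    let ?st1 = "st(rDepth := nat_data (Suc q), rA := nat_data (m - 1), rI := nat_data 0)"
    let ?st2 = "?st1(rI := nat_data (0 + (m - 1 + 1) div 2), rA := Empty)"
    have "?st2 rI = nat_data (m div 2)" "?st2 rDepth = nat_data (Suc q)" "m div 2 \<le> m0" "m div 2 < m"
      using False less.prems(3) by auto
    from less.IH[OF this(4), of ?st2, OF this(1-3)] obtain st' where
      st': "runs Q D ?w ?st2 ((4 * m0 + 12) * bit_length (m div 2) + 1) st'"
        "st' rDepth = nat_data (Suc q + bit_length (m div 2))"
        "\<forall>v. v \<notin> {rI, rA, rDepth} \<longrightarrow> st' v = ?st2 v" by blast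
    have "runs Q D ?w st (Suc (Suc (5 + (4 * (m - 1) + 1)) + ((4 * m0 + 12) * bit_length (m div 2) + 1))) st'"
    proof (rule runs_While_step[OF _ runs_Seq[OF _ runs_half] st'(1)])
      show "runs Q D ?pre st 5 ?st1"
        by (rule runs_straightI) (use less.prems in \<open>simp_all add: snd_data_nat_data\<close>)
    qed (use less.prems False in simp_all)
    then have "runs Q D ?w st ((4 * m0 + 12) * bit_length m + 1) st'"
      by (rule runs_weaken) (use less.prems(3) False in \<open>simp add: bit_length_pos\<close>)
    then show ?thesis using st'(2,3) False by (intro exI[of _ st']) (auto simp: bit_length_pos)
  qed
qed

definition init_cost :: "nat \<Rightarrow> nat \<Rightarrow> nat \<Rightarrow> nat \<Rightarrow> nat" where
  "init_cost n s k0 B = 4 * n + 4 * s + 5 * k0 + (4 * s + 12) * bit_length s + 4 * B + 60"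

lemma runs_init:
  fixes n s k0 c0 c A :: nat
  defines "s' \<equiv> max 1 s"
  defines "B \<equiv> k0 + bit_length s' + c0"
  assumes "\<And>j. j < k0 \<Longrightarrow> \<not> D (nat_data j)" "D (nat_data k0)"
  shows "\<exists>st. runs Q D (init_com A c0 c) (init_store n s) (init_cost n s' k0 B) st \<and>
    st rN = nat_data n \<and> st rK = nat_data (A * (n + s')) \<and>
    st rStack = Pair (node_data n B c [] s' B) Empty \<and> st rOut = Empty"
proof -
  let ?st0 = "init_store n s"
  let ?st1 = "?st0(rS := nat_data s', rK := nat_data 0, rI := nat_data n)"
  let ?st2 = "?st1(rK := (Pair Empty ^^ (A * n)) (?st1 rK), rI := Empty)"
  let ?st3 = "?st2(rI := nat_data s')"
  let ?st4 = "?st3(rK := (Pair Empty ^^ (A * s')) (?st3 rK), rI := Empty)"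
  let ?st5 = "?st4(rDepth := nat_data 0, rX := bool_data True)"
  let ?st6 = "?st5(rDepth := nat_data k0, rX := Empty, rA := bool_data True)"
  let ?st7 = "?st6(rI := nat_data s')"
  have stk: "?st7 rI = nat_data s'" "?st7 rDepth = nat_data k0" "s' \<le> s'" by simp_all
  obtain st8 where st8: "runs Q D log_com ?st7 ((4 * s' + 12) * bit_length s' + 1) st8"
    "st8 rDepth = nat_data (k0 + bit_length s')" "\<forall>v. v \<notin> {rI, rA, rDepth} \<longrightarrow> st8 v = ?st7 v"
    using runs_log[where st = ?st7, OF stk] by blast
  let ?st9 = "st8(rDepth := nat_data B, rDigits := digits_data 0, rI := nat_data B)"
  let ?st10 = "?st9(rDigits := (Pair Empty ^^ ((c + 1) * B)) (?st9 rDigits), rI := Empty)"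
  let ?st11 = "?st10(rOut := Empty, rStack := Pair (node_data n B c [] s' B) Empty)"
  have K: "?st4 rK = nat_data (A * (n + s'))"
    by (simp add: pad_nat_data distrib_left add.commute del: nat_data.simps)
  have r1: "runs Q D (If (Var rS) Skip (Assign rS TrueE) ;; Assign rK EmptyE ;; Assign rI (Var rN)) ?st0 6 ?st1"
    by (rule runs_straightI) (auto simp: init_store_def s'_def fun_eq_iff max_def)
  have r2: "runs Q D (pad_com rK A) ?st1 (4 * n + 1) ?st2"
    by (rule runs_pad) simp_all
  have r3: "runs Q D (Assign rI (Var rS)) ?st2 1 ?st3"
    by (rule runs_straightI) simp_all
  have r4: "runs Q D (pad_com rK A) ?st3 (4 * s' + 1) ?st4"
    by (rule runs_pad) simp_all
  have r5: "runs Q D (Assign rDepth EmptyE ;; Assign rX TrueE) ?st4 3 ?st5"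
    by (rule runs_straightI) (simp_all add: bool_data_def)
  have r6: "runs Q D first_digit_com ?st5 (5 * (k0 - 0) + 6) ?st6"
    by (rule runs_first_digit) (use assms(3,4) in \<open>simp_all add: bool_data_def\<close>)
  have r7: "runs Q D (Assign rI (Var rS)) ?st6 1 ?st7"
    by (rule runs_straightI) simp_all
  have r9: "runs Q D (Assign rDepth ((PairE EmptyE ^^ c0) (Var rDepth)) ;;
      Assign rDigits (PairE TrueE EmptyE) ;; Assign rI (Var rDepth)) st8 5 ?st9"
    by (rule runs_straightI)
      (simp_all add: expr_val_PairE_power st8(2) pad_nat_data B_def add.commute bool_data_def)
  have r10: "runs Q D (pad_com rDigits (c + 1)) ?st9 (4 * B + 1) ?st10"
    by (rule runs_pad) simp_all
  have "?st10 rDigits = digits_data (B + c * B)"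
    by (simp add: pad_digits_data del: digits_data.simps)
  moreover have "?st10 rN = nat_data n" "?st10 rS = nat_data s'"
    using st8(3) by (simp_all add: init_store_def)
  ultimately have r11: "runs Q D (Assign rOut EmptyE ;;
      Assign rStack (PairE (PairE EmptyE (PairE EmptyE (PairE (Var rN) (PairE (Var rS)
        (PairE (Var rDepth) (Var rDigits)))))) EmptyE)) ?st10 3 ?st11"
    by (intro runs_straightI) (simp_all add: node_data_def flags_data_empty)
  note runs = runs_Seq[OF r1 runs_Seq[OF r2 runs_Seq[OF r3 runs_Seq[OF r4 runs_Seq[OF r5 runs_Seq[OF r6
    runs_Seq[OF r7 runs_Seq[OF st8(1) runs_Seq[OF r9 runs_Seq[OF r10 r11]]]]]]]]]]
  have "runs Q D (init_com A c0 c) ?st0 (init_cost n s' k0 B) ?st11"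
    unfolding init_com_def by (rule runs_weaken[OF runs]) (simp add: init_cost_def)
  moreover have "?st11 rN = nat_data n" "?st11 rK = nat_data (A * (n + s'))"
    using st8(3) K by (simp_all add: init_store_def)
  ultimately show ?thesis by (intro exI[of _ ?st11]) simp
qed

section \<open>Polynomial bounds\<close>

definition learner_com :: "nat \<Rightarrow> nat \<Rightarrow> nat \<Rightarrow> nat \<Rightarrow> com \<Rightarrow> com" where
  "learner_com A c0 c N P = init_com A c0 c ;; main_com N P c ;; Assign 0 (Fst (Var rOut))"

text \<open>Spelled out with explicit arguments: the costs in the locale belong to a fixed
  \<open>n\<close> and \<open>s0\<close>, while polynomiality concerns all of them at once.\<close>

definition learner_time :: "nat \<Rightarrow> nat \<Rightarrow> nat \<Rightarrow> nat \<Rightarrow> nat \<Rightarrow> nat \<Rightarrow> nat \<Rightarrow> nat \<Rightarrow> nat" where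
  "learner_time N c n s k0 B tb k =
     init_cost n s k0 B + 2 * s * (n * (s * (2 * (k * ((B * (10 * n + 20) + 5 * ((c + 1) * B) + 20) * tb + 2 * N + 20)
       + 5 * k + 20) + 31) + 21) + 20 + (16 * n + B * (10 * n + 20) + 60) + 60) + 10"

lemma (in learner_main) wpn_learner:
  assumes "s0 = max 1 s" "B = k0 + bit_length s0 + c0" "k = A * (n + s0)"
    and digits: "\<And>j. j < k0 \<Longrightarrow> \<not> D (nat_data j)" "D (nat_data k0)"
    and ok: "\<And>T. dt_wf n T \<Longrightarrow> leaves T \<le> s0 \<Longrightarrow>
      near s0 (1 / 2 ^ (B + c * B)) [] \<longrightarrow> good_error [] s0 B T \<Longrightarrow> ok (dtree_data T)"
  shows "wpn Q D (learner_time N c n s0 k0 B tb k) [learner_com A c0 c N P]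
     (\<lambda>st. if ok (st 0) then 0 else 1) (init_store n s) \<le> of_nat (2 * s0 - 1) * node_fail"
proof -
  let ?F = "\<lambda>st. if ok (st 0) then 0 else 1 :: ennreal"
  let ?out = "Assign 0 (Fst (Var rOut))"
  obtain st where st: "runs Q D (init_com A c0 c) (init_store n s) (init_cost n s0 k0 B) st"
    "st rN = nat_data n" "st rK = nat_data k" "st rStack = Pair (node_data n B c [] s0 B) Empty" "st rOut = Empty"
    using runs_init[where ?k0.0 = k0 and D = D and s = s and c = c and n = n and A = A and ?c0.0 = c0 and Q = Q, OF digits] unfolding assms(1-3) by blast
  have s0: "1 \<le> s0" using assms(1) by simp
  have "learner_time N c n s0 k0 B tb k = init_cost n s0 k0 B + 2 * s0 * node_cost + 10"
    unfolding node_cost_def expand_cost_def test_cost_def learner_time_def by (rule refl)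
  moreover have "(2 * s0 - 1) * node_cost \<le> 2 * s0 * node_cost"
    by (intro mult_right_mono) auto
  ultimately have time: "Suc (init_cost n s0 k0 B + Suc (2 + (2 * s0 - 1) * node_cost)) \<le> learner_time N c n s0 k0 B tb k"
    by linarith
  have "wpn Q D (learner_time N c n s0 k0 B tb k) [learner_com A c0 c N P] ?F (init_store n s) \<le>
    wpn Q D (Suc (init_cost n s0 k0 B + Suc (2 + (2 * s0 - 1) * node_cost))) [learner_com A c0 c N P] ?F (init_store n s)"
    by (rule wpn_antimono[OF time])
  also have "\<dots> = wpn Q D (init_cost n s0 k0 B + Suc (2 + (2 * s0 - 1) * node_cost))
      [init_com A c0 c, main_com N P c ;; ?out] ?F (init_store n s)"
    unfolding learner_com_def wpn.simps by (rule refl)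
  also have "\<dots> \<le> wpn Q D (Suc (2 + (2 * s0 - 1) * node_cost)) [main_com N P c ;; ?out] ?F st"
    by (rule runsD[OF st(1)])
  also have "\<dots> = wpn Q D (2 + (2 * s0 - 1) * node_cost) [main_com N P c, ?out] ?F st"
    unfolding wpn.simps by (rule refl)
  also have "\<dots> \<le> 0 + of_nat (2 * s0 - 1) * node_fail"
  proof (rule wpn_main[OF _ _ s0 order_refl st(2-5)])
    fix T st' assume T: "dt_wf n T" "leaves T \<le> s0" and out: "st' rStack = Empty" "st' rOut = Pair (dtree_data T) Empty"
    have "ok (dtree_data T)" if "near s0 (1 / 2 ^ (B + c * B)) [] \<longrightarrow> good_error [] s0 B T"
      using ok[OF T that] .
    then show "wpn Q D 2 [main_com N P c, ?out] ?F st' \<le> 0 + (if near s0 (1 / 2 ^ (B + c * B)) [] \<longrightarrow> good_error [] s0 B T then 0 else 1)"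
      using out by (auto simp: main_com_def numeral_2_eq_2 simp del: restrict_point.simps)
  qed (simp_all add: path_ok_def)
  finally show ?thesis by simp
qed

section \<open>Closure properties of polynomial bounds\<close>

definition polynomial :: "(nat \<Rightarrow> nat \<Rightarrow> real \<Rightarrow> real) \<Rightarrow> bool" where
  "polynomial f \<longleftrightarrow> (\<exists>K d. \<forall>n s \<epsilon>. 0 < \<epsilon> \<and> \<epsilon> < 1 \<longrightarrow> \<bar>f n s \<epsilon>\<bar> \<le> poly_bound K d s n \<epsilon>)"

text \<open>A base of at least 1 lets different degrees be raised to a common one.\<close>

lemma base_ge_1: "0 < \<epsilon> \<Longrightarrow> \<epsilon> < 1 \<Longrightarrow> 1 \<le> real s + real n + 1 / \<epsilon>"
proof -
  assume "0 < \<epsilon>" "\<epsilon> < 1"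
  then have "1 \<le> 1 / \<epsilon>" by simp
  then show ?thesis by simp
qed

lemma polynomial_mono:
  assumes "polynomial g" "\<And>n s \<epsilon>. 0 < \<epsilon> \<Longrightarrow> \<epsilon> < 1 \<Longrightarrow> \<bar>f n s \<epsilon>\<bar> \<le> g n s \<epsilon>"
  shows "polynomial f"
  using assms unfolding polynomial_def by (meson abs_ge_self order_trans)

lemma polynomialI1:
  assumes "\<And>n s \<epsilon>. 0 < \<epsilon> \<Longrightarrow> \<epsilon> < 1 \<Longrightarrow> \<bar>f n s \<epsilon>\<bar> \<le> real s + real n + 1 / \<epsilon>"
  shows "polynomial f"
  unfolding polynomial_def poly_bound_def using assms by (intro exI[of _ 1]) auto

lemma polynomial_const: "polynomial (\<lambda>n s \<epsilon>. a)"
  unfolding polynomial_def poly_bound_def by (intro exI[of _ "\<bar>a\<bar>"] exI[of _ 0]) simp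

lemma polynomial_n: "polynomial (\<lambda>n s \<epsilon>. real n)"
  and polynomial_s: "polynomial (\<lambda>n s \<epsilon>. real s)"
  and polynomial_inverse: "polynomial (\<lambda>n s \<epsilon>. 1 / \<epsilon>)"
  by (rule polynomialI1, simp)+

lemma polynomial_add:
  assumes "polynomial f" "polynomial g"
  shows "polynomial (\<lambda>n s \<epsilon>. f n s \<epsilon> + g n s \<epsilon>)"
proof -
  obtain K d K' d' where f: "\<And>n s \<epsilon>. 0 < \<epsilon> \<and> \<epsilon> < 1 \<longrightarrow> \<bar>f n s \<epsilon>\<bar> \<le> poly_bound K d s n \<epsilon>"
    and g: "\<And>n s \<epsilon>. 0 < \<epsilon> \<and> \<epsilon> < 1 \<longrightarrow> \<bar>g n s \<epsilon>\<bar> \<le> poly_bound K' d' s n \<epsilon>"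
    using assms unfolding polynomial_def by metis
  have "\<bar>f n s \<epsilon> + g n s \<epsilon>\<bar> \<le> poly_bound (\<bar>K\<bar> + \<bar>K'\<bar>) (d + d') s n \<epsilon>" if e: "0 < \<epsilon> \<and> \<epsilon> < 1" for n s \<epsilon>
  proof -
    let ?X = "real s + real n + 1 / \<epsilon>"
    have X: "1 \<le> ?X" using base_ge_1 e by blast
    have "\<bar>f n s \<epsilon> + g n s \<epsilon>\<bar> \<le> K * ?X ^ d + K' * ?X ^ d'"
      using f g e unfolding poly_bound_def by (smt (verit))
    also have "\<dots> \<le> \<bar>K\<bar> * ?X ^ (d + d') + \<bar>K'\<bar> * ?X ^ (d + d')"
      using X by (intro add_mono mult_mono power_increasing) auto
    finally show ?thesis by (simp add: poly_bound_def distrib_right)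
  qed
  then show ?thesis unfolding polynomial_def by blast
qed

lemma polynomial_mult:
  assumes "polynomial f" "polynomial g"
  shows "polynomial (\<lambda>n s \<epsilon>. f n s \<epsilon> * g n s \<epsilon>)"
proof -
  obtain K d K' d' where f: "\<And>n s \<epsilon>. 0 < \<epsilon> \<and> \<epsilon> < 1 \<longrightarrow> \<bar>f n s \<epsilon>\<bar> \<le> poly_bound K d s n \<epsilon>"
    and g: "\<And>n s \<epsilon>. 0 < \<epsilon> \<and> \<epsilon> < 1 \<longrightarrow> \<bar>g n s \<epsilon>\<bar> \<le> poly_bound K' d' s n \<epsilon>"
    using assms unfolding polynomial_def by metis
  have "\<bar>f n s \<epsilon> * g n s \<epsilon>\<bar> \<le> poly_bound (K * K') (d + d') s n \<epsilon>" if e: "0 < \<epsilon> \<and> \<epsilon> < 1" for n s \<epsilon>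
  proof -
    have "\<bar>f n s \<epsilon> * g n s \<epsilon>\<bar> \<le> poly_bound K d s n \<epsilon> * poly_bound K' d' s n \<epsilon>"
      unfolding abs_mult using f g e by (intro mult_mono) (auto intro: order_trans[OF abs_ge_zero])
    then show ?thesis by (simp add: poly_bound_def power_add algebra_simps)
  qed
  then show ?thesis unfolding polynomial_def by blast
qed

lemma polynomial_power: "polynomial f \<Longrightarrow> polynomial (\<lambda>n s \<epsilon>. f n s \<epsilon> ^ j)"
  by (induction j) (auto intro: polynomial_const polynomial_mult)

lemmas polynomial_intros =
  polynomial_add polynomial_mult polynomial_power polynomial_const polynomial_n polynomial_s polynomial_inverse

section \<open>Depth budget and running time\<close>

definition first_digit :: "real \<Rightarrow> nat" where
  "first_digit \<epsilon> = (LEAST j. 1 \<le> \<epsilon> * 2 ^ j)"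

lemma first_digit:
  assumes "0 < \<epsilon>" "\<epsilon> < 1"
  shows "1 \<le> \<epsilon> * 2 ^ first_digit \<epsilon>" "\<epsilon> * 2 ^ first_digit \<epsilon> < 2" "j < first_digit \<epsilon> \<Longrightarrow> \<epsilon> * 2 ^ j < 1"
    "1 \<le> first_digit \<epsilon>"
proof -
  obtain m where "1 / \<epsilon> < 2 ^ m" using real_arch_pow[of 2 "1 / \<epsilon>"] by auto
  then have "1 \<le> \<epsilon> * 2 ^ m" using assms by (simp add: field_simps)
  then show ge: "1 \<le> \<epsilon> * 2 ^ first_digit \<epsilon>"
    unfolding first_digit_def by (rule LeastI)
  have less: "\<epsilon> * 2 ^ j < 1" if "j < first_digit \<epsilon>" for j
    using not_less_Least[OF that[unfolded first_digit_def]] by simp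
  then show "j < first_digit \<epsilon> \<Longrightarrow> \<epsilon> * 2 ^ j < 1" .
  show pos: "1 \<le> first_digit \<epsilon>"
  proof (rule ccontr)
    assume "\<not> 1 \<le> first_digit \<epsilon>"
    then have "first_digit \<epsilon> = 0" by simp
    then show False using ge assms by simp
  qed
  then show "\<epsilon> * 2 ^ first_digit \<epsilon> < 2"
    using less[of "first_digit \<epsilon> - 1"] by (cases "first_digit \<epsilon>") auto
qed

lemma first_digit_oracle:
  assumes "0 < \<epsilon>" "\<epsilon> < 1"
  shows "j < first_digit \<epsilon> \<Longrightarrow> \<not> digit_oracle \<epsilon> (nat_data j)" "digit_oracle \<epsilon> (nat_data (first_digit \<epsilon>))"
proof -
  show "\<not> digit_oracle \<epsilon> (nat_data j)" if "j < first_digit \<epsilon>"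
  proof -
    have "\<lfloor>\<epsilon> * 2 ^ j\<rfloor> = 0"
      using first_digit(3)[OF assms that] assms(1) by (simp add: floor_eq_iff)
    then show ?thesis by (simp add: digit_oracle_def)
  qed
  have "\<lfloor>\<epsilon> * 2 ^ first_digit \<epsilon>\<rfloor> = 1"
    using first_digit(1,2)[OF assms] by (simp add: floor_eq_iff)
  then show "digit_oracle \<epsilon> (nat_data (first_digit \<epsilon>))"
    by (simp add: digit_oracle_def)
qed

text \<open>The first summand provides \<open>1 / \<epsilon>\<close>, the second more than the size,
  so cut-offs and samples contribute error at most \<open>\<epsilon>\<close>; \<open>c0\<close>
  makes bad samples rare. The first two powers overshoot by at most a factor 2, so
  \<open>2 ^ depth\<close> is linear in \<open>max 1 s / \<epsilon>\<close> and its power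
  \<open>c + 1\<close>, the inverse of the finest accuracy, stays polynomial.\<close>

definition depth :: "nat \<Rightarrow> nat \<Rightarrow> real \<Rightarrow> nat" where
  "depth c0 s \<epsilon> = first_digit \<epsilon> + bit_length (max 1 s) + c0"

lemma polynomial_size: "polynomial (\<lambda>n s \<epsilon>. real (max 1 s))"
  by (rule polynomial_mono[where g = "\<lambda>n s \<epsilon>. 1 + real s"]) (auto intro: polynomial_intros)

lemma two_power_depth_le:
  assumes "0 < \<epsilon>" "\<epsilon> < 1"
  shows "2 ^ depth c0 s \<epsilon> \<le> 2 * (1 / \<epsilon>) * (2 * real (max 1 s)) * 2 ^ c0"
proof -
  have "2 ^ first_digit \<epsilon> \<le> 2 * (1 / \<epsilon>)"
    using first_digit(2)[OF assms] assms(1) by (simp add: field_simps)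
  moreover have "2 ^ bit_length (max 1 s) \<le> 2 * max 1 s"
    by (rule power_bit_length_le) simp
  then have "2 ^ bit_length (max 1 s) \<le> 2 * real (max 1 s)"
    by (metis of_nat_le_iff of_nat_mult of_nat_numeral of_nat_power)
  ultimately show ?thesis
    unfolding depth_def power_add using assms by (intro mult_mono) auto
qed

lemma polynomial_power_depth: "polynomial (\<lambda>n s \<epsilon>. 2 ^ depth c0 s \<epsilon>)"
proof (rule polynomial_mono)
  show "polynomial (\<lambda>n s \<epsilon>. 2 * (1 / \<epsilon>) * (2 * real (max 1 s)) * 2 ^ c0)"
    by (intro polynomial_intros polynomial_size)
qed (use two_power_depth_le in simp)

lemma le_two_power: "real m \<le> 2 ^ m"
  using of_nat_less_two_power[of m] by (simp add: less_imp_le)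

lemma polynomial_depth: "polynomial (\<lambda>n s \<epsilon>. real (depth c0 s \<epsilon>))"
  and polynomial_first_digit: "polynomial (\<lambda>n s \<epsilon>. real (first_digit \<epsilon>))"
  and polynomial_bit_length: "polynomial (\<lambda>n s \<epsilon>. real (bit_length (max 1 s)))"
proof -
  show d: "polynomial (\<lambda>n s \<epsilon>. real (depth c0 s \<epsilon>))" for c0
    by (rule polynomial_mono[OF polynomial_power_depth[of c0]]) (simp only: abs_of_nat le_two_power)
  show "polynomial (\<lambda>n s \<epsilon>. real (first_digit \<epsilon>))"
    "polynomial (\<lambda>n s \<epsilon>. real (bit_length (max 1 s)))"
    by (rule polynomial_mono[OF d[of 0]], simp add: depth_def)+
qed

text \<open>\<open>(2 ^ depth) ^ (c + 1)\<close> bounds the inverse accuracy of every test and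
  replaces the last summand in the tester's own polynomial.\<close>

definition tester_time :: "nat \<Rightarrow> nat \<Rightarrow> nat \<Rightarrow> nat \<Rightarrow> nat \<Rightarrow> nat \<Rightarrow> real \<Rightarrow> nat" where
  "tester_time K d c c0 n s \<epsilon> = K * (max 1 s + n + (2 ^ depth c0 s \<epsilon>) ^ (c + 1)) ^ d"

lemma polynomial_tester_time: "polynomial (\<lambda>n s \<epsilon>. real (tester_time K d c c0 n s \<epsilon>))"
  unfolding tester_time_def of_nat_mult of_nat_add of_nat_power of_nat_numeral
  by (intro polynomial_intros polynomial_size polynomial_power_depth)

lemma polynomial_learner_time:
  "polynomial (\<lambda>n s \<epsilon>. real (learner_time N c n (max 1 s) (first_digit \<epsilon>) (depth c0 s \<epsilon>)
     (tester_time K d c c0 n s \<epsilon>) (A * (n + max 1 s))))"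
  unfolding learner_time_def init_cost_def of_nat_mult of_nat_add of_nat_numeral
  by (intro polynomial_intros polynomial_size polynomial_depth polynomial_first_digit
      polynomial_bit_length polynomial_tester_time)


lemma restrict_bool_funs:
  "g \<in> bool_funs n \<Longrightarrow> path_ok n \<rho> \<Longrightarrow> (restricted g \<rho>) \<in> bool_funs n"
  using restrict_point_cube by (auto simp: bool_funs_def)

text \<open>Enlarging the constant weakens only the promise on rejection, so
  \<open>C' \<ge> 1\<close> may be arranged; a smaller probability and a longer time are harmless as
  well.\<close>

lemma tester_wpn:
  fixes p p' C C' \<epsilon> :: real
  assumes f: "halts_by P n s \<epsilon> f t"
    and acc: "(\<exists>T \<in> size_dtrees n s. close n \<epsilon> f (dt_eval T)) \<Longrightarrow>
      measure_pmf.prob (run P n s \<epsilon> f t) {cfg. result cfg \<noteq> Empty} \<ge> p"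
    and rej: "(\<forall>T \<in> size_dtrees n s. far n (C * \<epsilon>) f (dt_eval T)) \<Longrightarrow>
      measure_pmf.prob (run P n s \<epsilon> f t) {cfg. result cfg = Empty} \<ge> p"
    and C: "C \<le> C'" "1 \<le> C'" and p: "p' \<le> p" "p' \<le> 1" and \<epsilon>: "0 < \<epsilon>" and t: "t \<le> tb"
    and ok: "ok = (\<lambda>b. if b then near_size n s (C' * \<epsilon>) f else \<not> near_size n s \<epsilon> f)"
  shows "wpn (query_oracle n f) (digit_oracle \<epsilon>) tb [P] (\<lambda>st. if ok (st 0 \<noteq> Empty) then 0 else 1)
    (init_store n s) \<le> ennreal (1 - p')"
proof -
  have mono: "near_size n s e f \<Longrightarrow> e \<le> e' \<Longrightarrow> near_size n s e' f" for e e'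
    unfolding near_size_def close_def by (meson order_trans)
  have C\<epsilon>: "\<epsilon> \<le> C' * \<epsilon>" "C * \<epsilon> \<le> C' * \<epsilon>" using C \<epsilon> by simp_all
  have "p' \<le> measure_pmf.prob (run P n s \<epsilon> f t) {cfg. ok (result cfg \<noteq> Empty)}"
  proof (cases "near_size n s \<epsilon> f")
    case True
    then have "{cfg. ok (result cfg \<noteq> Empty)} = {cfg. result cfg \<noteq> Empty}"
      using mono[OF True C\<epsilon>(1)] by (auto simp: ok)
    then show ?thesis using acc True p(1) by (simp add: near_size_def)
  next
    case not_near: False
    show ?thesis
    proof (cases "near_size n s (C' * \<epsilon>) f")
      case True
      then have "{cfg. ok (result cfg \<noteq> Empty)} = UNIV" using not_near by (auto simp: ok)
      then show ?thesis using p(2) by simp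
    next
      case False
      then have "{cfg. ok (result cfg \<noteq> Empty)} = {cfg. result cfg = Empty}" using not_near by (auto simp: ok)
      moreover have "\<not> near_size n s (C * \<epsilon>) f" using mono[OF _ C\<epsilon>(2)] False by blast
      ultimately show ?thesis using rej p(1) by (simp add: near_size_def far_def)
    qed
  qed
  then have "wpn (query_oracle n f) (digit_oracle \<epsilon>) t [P] (\<lambda>st. if ok (st 0 \<noteq> Empty) then 0 else 1)
    (init_store n s) \<le> ennreal (1 - p')"
    using halting_run_le[where ok = "\<lambda>v. ok (v \<noteq> Empty)"] f p(2) unfolding halts_by_def run_def by blast
  then show ?thesis using wpn_antimono[OF t] order_trans by blast
qed

section \<open>Total failure probability and final error\<close>

lemma power_vanishes:
  assumes "0 \<le> (x::real)" "x < 1" "0 < y"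
  shows "\<exists>k. x ^ k \<le> y"
  using real_arch_pow_inv[OF assms(3,2)] by (meson less_imp_le)

text \<open>Repeating \<open>A * (n + s)\<close> times makes one vote fail with probability
  geometric in \<open>n + s\<close>, which beats the factor \<open>4 * n * s * s\<close> from
  counting tests, as \<open>n \<le> 4 ^ n\<close> and \<open>s * s \<le> 4 ^ s\<close>. The 32 is
  chosen to give \<open>4 * (4 * (w / 32)) = w / 2\<close>; the samples get the other half.\<close>

lemma failure_bound:
  fixes \<theta> w :: real
  assumes w: "0 < w" "w \<le> 1" and \<theta>: "0 \<le> \<theta>" "\<theta> ^ A \<le> w / 32" and c0: "(1 / 2) ^ c0 \<le> w / 4"
    and s: "1 \<le> s" and B: "2 * real s / 2 ^ B \<le> 2 * (1 / 2) ^ c0"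
  shows "real (2 * s - 1) * (real n * (real s * (2 * \<theta> ^ (A * (n + s)))) + 1 / 2 ^ B) \<le> w"
proof -
  have n: "real n \<le> 4 ^ n"
  proof -
    have "real n \<le> 2 ^ n" by (rule le_two_power)
    also have "\<dots> \<le> 4 ^ n" by (rule power_mono) auto
    finally show ?thesis .
  qed
  have "real s * real s \<le> 2 ^ s * 2 ^ s" by (intro mult_mono le_two_power) auto
  also have "\<dots> = 4 ^ s" by (simp flip: power_mult_distrib)
  finally have ss: "real s * real s \<le> 4 ^ s" .
  have "\<theta> ^ (A * (n + s)) \<le> (w / 32) ^ (n + s)"
    unfolding power_mult using \<theta> by (intro power_mono) auto
  then have "4 * (real n * (real s * real s)) * \<theta> ^ (A * (n + s)) \<le> 4 * (4 ^ n * 4 ^ s) * (w / 32) ^ (n + s)"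
    using \<theta>(1) n ss by (intro mult_mono) auto
  also have "\<dots> = 4 * (4 * (w / 32)) ^ (n + s)"
    by (simp only: power_mult_distrib power_add mult_ac)
  also have "\<dots> \<le> 4 * (4 * (w / 32)) ^ 1"
    using w s by (intro mult_left_mono power_decreasing) auto
  finally have 1: "4 * (real n * (real s * real s)) * \<theta> ^ (A * (n + s)) \<le> w / 2" by simp
  have 2: "2 * real s * (1 / 2 ^ B) \<le> w / 2" using B c0 by simp
  have "real (2 * s - 1) * (real n * (real s * (2 * \<theta> ^ (A * (n + s)))) + 1 / 2 ^ B) \<le>
    2 * real s * (real n * (real s * (2 * \<theta> ^ (A * (n + s)))) + 1 / 2 ^ B)"
    using \<theta>(1) s by (intro mult_right_mono) auto
  also have "\<dots> = 4 * (real n * (real s * real s)) * \<theta> ^ (A * (n + s)) + 2 * real s * (1 / 2 ^ B)"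
    by (simp add: algebra_simps)
  finally show ?thesis using 1 2 by linarith
qed

lemma depth_bounds:
  assumes "0 < \<epsilon>" "\<epsilon> < 1"
  shows "2 \<le> depth c0 s \<epsilon>" "2 * real (max 1 s) / 2 ^ depth c0 s \<epsilon> \<le> 2 * (1 / 2) ^ c0"
    "real (max 1 s) / 2 ^ depth c0 s \<epsilon> + 1 / 2 ^ depth c0 s \<epsilon> \<le> \<epsilon>"
proof -
  let ?s = "max 1 s" and ?k = "first_digit \<epsilon>"
  have k: "1 \<le> \<epsilon> * 2 ^ ?k" "1 \<le> ?k" using first_digit[OF assms] by auto
  have "bit_length ?s \<ge> 1" by (simp add: bit_length_pos)
  then show "2 \<le> depth c0 s \<epsilon>" using k(2) by (simp add: depth_def)
  \<comment> \<open>The strictness of \<open>less_power_bit_length\<close> provides the extra 1 that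
    pays for the sampling error.\<close>
  have "Suc ?s \<le> 2 ^ bit_length ?s" unfolding Suc_le_eq by (rule less_power_bit_length)
  then have s: "real ?s + 1 \<le> 2 ^ bit_length ?s"
    by (metis of_nat_Suc of_nat_le_iff of_nat_numeral of_nat_power add.commute)
  have two: "(2::real) ^ depth c0 s \<epsilon> = 2 ^ ?k * 2 ^ bit_length ?s * 2 ^ c0"
    by (simp add: depth_def power_add)
  have "real ?s * 2 ^ c0 \<le> (2 ^ ?k * 2 ^ bit_length ?s) * 2 ^ c0"
  proof (rule mult_right_mono)
    have "real ?s \<le> 1 * 2 ^ bit_length ?s" using s unfolding mult_1 by linarith
    also have "\<dots> \<le> 2 ^ ?k * 2 ^ bit_length ?s" by (intro mult_right_mono) auto
    finally show "real ?s \<le> 2 ^ ?k * 2 ^ bit_length ?s" .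
  qed simp
  then show "2 * real ?s / 2 ^ depth c0 s \<epsilon> \<le> 2 * (1 / 2) ^ c0"
    unfolding two by (simp add: field_simps)
  have "real ?s + 1 \<le> 1 * 2 ^ bit_length ?s * 1" using s unfolding mult_1 mult_1_right .
  also have "\<dots> \<le> (\<epsilon> * 2 ^ ?k) * 2 ^ bit_length ?s * 2 ^ c0"
    using k(1) assms by (intro mult_mono) auto
  finally have "real ?s + 1 \<le> \<epsilon> * 2 ^ depth c0 s \<epsilon>"
    by (simp add: two algebra_simps)
  then show "real ?s / 2 ^ depth c0 s \<epsilon> + 1 / 2 ^ depth c0 s \<epsilon> \<le> \<epsilon>"
    by (simp add: field_simps)
qed

theorem theorem1p3:
  fixes p q :: real
  assumes "1/2 < p" and "q < 1"
    and "\<exists>P. dt_tester p P"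
  shows "\<exists>L. dt_proper_learner q L"
proof -
  obtain P C0 K0 d0 where "C0 > 0" and tester: "\<And>n s \<epsilon> f. 0 < \<epsilon> \<and> \<epsilon> < 1 \<and> f \<in> bool_funs n \<Longrightarrow>
         \<exists>t. real t \<le> poly_bound K0 d0 s n \<epsilon> \<and> halts_by P n s \<epsilon> f t \<and>
              ((\<exists>T \<in> size_dtrees n s. close n \<epsilon> f (dt_eval T)) \<longrightarrow>
                 measure_pmf.prob (run P n s \<epsilon> f t) {cfg. result cfg \<noteq> Empty} \<ge> p) \<and>
              ((\<forall>T \<in> size_dtrees n s. far n (C0 * \<epsilon>) f (dt_eval T)) \<longrightarrow>
                 measure_pmf.prob (run P n s \<epsilon> f t) {cfg. result cfg = Empty} \<ge> p)"
    using assms(3) unfolding dt_tester_def by metis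
  define C where "C = max 1 C0"
  \<comment> \<open>The cap keeps \<open>1 - p'\<close> positive, so that \<open>l\<close> is a
    proper quotient.\<close>
  define p' where "p' = min p (3 / 4)"
  \<comment> \<open>The optimal weight would be a square root. This choice turns
    \<open>(1 - p') * l\<close> into \<open>1 / 2\<close>, after which \<open>\<theta> < 1\<close>
    is just \<open>(2 * p' - 1) ^ 2 > 0\<close>.\<close>
  define l where "l = 1 / (2 * (1 - p'))"
  define \<theta> where "\<theta> = (1 - p') * l + p' / l"
  \<comment> \<open>\<open>q\<close> may be negative, while \<open>failure_bound\<close> asks for a
    \<open>w\<close> of at most 1.\<close>
  define w where "w = min 1 (1 - q)"
  define K where "K = nat \<lceil>\<bar>K0\<bar>\<rceil>"
  have p': "1 / 2 < p'" "p' < 1" "p' \<le> p" using assms(1) by (auto simp: p'_def)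
  have l: "l > 1" using p' by (simp add: l_def field_simps)
  have \<theta>_eq: "\<theta> = 1 / 2 + 2 * p' * (1 - p')"
    using p' by (simp add: \<theta>_def l_def field_simps)
  have "0 < (2 * p' - 1) ^ 2" using p' by (intro zero_less_power) simp
  then have \<theta>: "0 \<le> \<theta>" "\<theta> < 1"
    unfolding \<theta>_eq using p' by (simp, simp add: power2_eq_square algebra_simps)
  have w: "0 < w" "w \<le> 1" "w \<le> 1 - q" using assms(2) by (auto simp: w_def)
  obtain A where A: "\<theta> ^ A \<le> w / 32" using power_vanishes[OF \<theta>, of "w / 32"] w by auto
  obtain c0 where c0: "(1 / 2) ^ c0 \<le> w / 4" using power_vanishes[of "1 / 2" "w / 4"] w by auto
  obtain c where "2 * C < 2 ^ c" using real_arch_pow[of 2 "2 * C"] by auto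
  then have c: "2 * C \<le> 2 ^ c" by simp
  obtain N0 where N0: "com_vars P \<subseteq> {..<N0}"
    using finite_com_vars[of P] by (meson finite_nat_iff_bounded)
  \<comment> \<open>The 2 includes the input registers 0 and 1 even if the tester does not mention
    them.\<close>
  define N where "N = N0 + 2"
  define L where "L = learner_com A c0 c N P"
  let ?time = "\<lambda>n s \<epsilon>. learner_time N c n (max 1 s) (first_digit \<epsilon>) (depth c0 s \<epsilon>)
     (tester_time K d0 c c0 n s \<epsilon>) (A * (n + max 1 s))"
  obtain K1 d1 where time: "\<And>n s \<epsilon>. 0 < \<epsilon> \<and> \<epsilon> < 1 \<Longrightarrow> real (?time n s \<epsilon>) \<le> poly_bound K1 d1 s n \<epsilon>"
    using polynomial_learner_time[of N c c0 K d0 A] unfolding polynomial_def by auto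
  have "halts_by L n s \<epsilon> g (?time n s \<epsilon>) \<and>
      ((\<exists>T \<in> size_dtrees n s. \<forall>x \<in> cube n. dt_eval T x = g x) \<longrightarrow>
         measure_pmf.prob (run L n s \<epsilon> g (?time n s \<epsilon>))
           {cfg. \<exists>T \<in> size_dtrees n s. result cfg = dtree_data T \<and> disagreement n (dt_eval T) g \<le> \<epsilon>} \<ge> q)"
    if \<epsilon>: "0 < \<epsilon>" "\<epsilon> < 1" and g: "g \<in> bool_funs n" for n s \<epsilon> g
  proof -
    let ?s = "max 1 s" and ?B = "depth c0 s \<epsilon>" and ?k = "A * (n + max 1 s)"
    let ?tb = "tester_time K d0 c c0 n s \<epsilon>"
    interpret learner_main n g "digit_oracle \<epsilon>" P N ?tb ?k c ?B ?s p' l C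
    proof unfold_locales
      show "wpn (query_oracle n (restricted g \<rho>)) (digit_oracle (1 / 2 ^ m)) ?tb [P]
        (\<lambda>st. if ok (st 0 \<noteq> Empty) then 0 else 1) (init_store n s'') \<le> ennreal (1 - p')"
        if \<rho>: "path_ok n \<rho>" and m: "1 \<le> m" "m \<le> (c + 1) * ?B" and s'': "s'' \<le> ?s"
          and ok: "ok = (\<lambda>b. if b then near_size n s'' (C / 2 ^ m) (restricted g \<rho>)
                 else \<not> near_size n s'' (1 / 2 ^ m) (restricted g \<rho>))" for \<rho> m s'' ok
      proof -
        have "(1::real) < 2 ^ m" using m(1) by (intro one_less_power) auto
        then have "0 < (1 / 2 ^ m :: real) \<and> (1 / 2 ^ m :: real) < 1 \<and> (restricted g \<rho>) \<in> bool_funs n"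
          using restrict_bool_funs[OF g \<rho>] by simp
        from tester[OF this, of s''] obtain t where
          t: "real t \<le> poly_bound K0 d0 s'' n (1 / 2 ^ m)"
            "halts_by P n s'' (1 / 2 ^ m) (restricted g \<rho>) t"
            "(\<exists>T \<in> size_dtrees n s''. close n (1 / 2 ^ m) (restricted g \<rho>) (dt_eval T)) \<longrightarrow>
               measure_pmf.prob (run P n s'' (1 / 2 ^ m) (restricted g \<rho>) t) {cfg. result cfg \<noteq> Empty} \<ge> p"
            "(\<forall>T \<in> size_dtrees n s''. far n (C0 * (1 / 2 ^ m)) (restricted g \<rho>) (dt_eval T)) \<longrightarrow>
               measure_pmf.prob (run P n s'' (1 / 2 ^ m) (restricted g \<rho>) t) {cfg. result cfg = Empty} \<ge> p"
          by blast
        have "(2::real) ^ m \<le> (2 ^ ?B) ^ (c + 1)"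
          using m(2) unfolding power_mult[symmetric] by (intro power_increasing) (auto simp: mult.commute)
        then have "real s'' + real n + 1 / (1 / 2 ^ m) \<le> real ?s + real n + (2 ^ ?B) ^ (c + 1)"
          using s'' by simp
        moreover have "K0 \<le> real K"
          unfolding K_def by linarith
        ultimately have "poly_bound K0 d0 s'' n (1 / 2 ^ m) \<le> real K * (real ?s + real n + (2 ^ ?B) ^ (c + 1)) ^ d0"
          unfolding poly_bound_def by (intro mult_mono power_mono) auto
        then have "real t \<le> real ?tb"
          using t(1) unfolding tester_time_def by simp
        then have "t \<le> ?tb" by simp
        show ?thesis
          by (rule tester_wpn[where C = C0 and C' = C, OF t(2) _ _ _ _ p'(3) _ _ \<open>t \<le> ?tb\<close>])
            (use t(3,4) p'(2) ok in \<open>auto simp: C_def\<close>)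
      qed
    qed (use l c p' N0 g depth_bounds(1)[OF \<epsilon>] in \<open>auto simp: C_def N_def\<close>)
    have "of_nat (2 * ?s - 1) * node_fail =
        ennreal (real (2 * ?s - 1) * (real n * (real ?s * (2 * \<theta> ^ ?k)) + 1 / 2 ^ ?B))"
      unfolding node_fail_def test_fail_def \<theta>_def[symmetric] using \<theta>(1)
      by (simp add: ennreal_mult ennreal_plus ennreal_of_nat_eq_real_of_nat del: of_nat_max)
    also have "\<dots> \<le> ennreal (1 - q)"
      using order_trans[OF failure_bound[where n = n and s = ?s and B = ?B, OF w(1,2) \<theta>(1) A c0 _
          depth_bounds(2)[OF \<epsilon>]] w(3)] by (intro ennreal_leI) (simp only: max.cobounded1)
    finally have fail: "of_nat (2 * ?s - 1) * node_fail \<le> ennreal (1 - q)" .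
    \<comment> \<open>\<open>ok\<close> is left open: the trivial property gives halting for every
      \<open>g\<close>, the intended one the guarantee on the output.\<close>
    have wpn: "wpn (query_oracle n g) (digit_oracle \<epsilon>) (?time n s \<epsilon>) [L]
        (\<lambda>st. if ok (st 0) then 0 else 1) (init_store n s) \<le> ennreal (1 - q)"
      if ok: "\<And>T. dt_wf n T \<Longrightarrow> leaves T \<le> ?s \<Longrightarrow>
        near ?s (1 / 2 ^ (?B + c * ?B)) [] \<longrightarrow> good_error [] ?s ?B T \<Longrightarrow> ok (dtree_data T)" for ok
      unfolding L_def
      by (rule order_trans[OF wpn_learner fail]) (use depth_def first_digit_oracle[OF \<epsilon>] ok in simp_all)
    note bound = wpn_le_halting[where \<delta> = "1 - q" and T = "?time n s \<epsilon>" and ?cs0.0 = "[L]" and ?q0.0 = 0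
        and Q = "query_oracle n g" and D = "digit_oracle \<epsilon>" and ?st0.0 = "init_store n s", folded run_def]
    have "halts_by L n s \<epsilon> g (?time n s \<epsilon>)"
      using bound(1)[OF wpn[where ok = "\<lambda>_. True"]] unfolding halts_by_def by simp
    moreover have "q \<le> measure_pmf.prob (run L n s \<epsilon> g (?time n s \<epsilon>))
           {cfg. \<exists>T \<in> size_dtrees n s. result cfg = dtree_data T \<and> disagreement n (dt_eval T) g \<le> \<epsilon>}"
      if ex: "\<exists>T \<in> size_dtrees n s. \<forall>x \<in> cube n. dt_eval T x = g x"
    proof -
      obtain T0 where T0: "T0 \<in> size_dtrees n s" "\<forall>x \<in> cube n. dt_eval T0 x = g x"
        using ex by blast
      \<comment> \<open>A tree has at least one leaf, so here the replacement of size 0 by 1 has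
        changed nothing.\<close>
      then have s: "?s = s" using leaves_pos[of T0] by (auto simp: size_dtrees_def)
      have "{x \<in> cube n. g x \<noteq> dt_eval T0 x} = {}" using T0(2) by auto
      then have "cube_prob n (\<lambda>x. g x \<noteq> dt_eval T0 x) = 0"
        unfolding cube_prob_def by (simp only: card.empty)
      then have "near ?s (1 / 2 ^ (?B + c * ?B)) []"
        using T0(1) unfolding s by (intro near_sizeI[of n T0]) (auto simp: size_dtrees_def)
      moreover have "disagreement n (dt_eval T) g \<le> \<epsilon>" if "good_error [] ?s ?B T" for T
        using that depth_bounds(3)[OF \<epsilon>, where s = s and ?c0.0 = c0]
        by (simp add: good_error_def path_error_def disagreement_eq)
      ultimately show ?thesis
        using bound(2)[OF wpn[where ok = "\<lambda>v. \<exists>T \<in> size_dtrees n s. v = dtree_data T \<and> disagreement n (dt_eval T) g \<le> \<epsilon>"]]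
          assms(2) s by (auto simp: size_dtrees_def)
    qed
    ultimately show ?thesis by blast
  qed
  then have "dt_proper_learner q L"
    unfolding dt_proper_learner_def using time by (intro exI[of _ K1] exI[of _ d1]) blast
  then show ?thesis by blast
qed

end
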